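(* Let $Z\subset X$ be irreducible affine cones in $V\cong\mathbb{C}^{N+1}$, where $\dim(X)=n+1$ and $\dim(Z)=d+1$. Assume that $X$ is ED regular given $Z$ (in the projective sense). Then $\mathrm{DL}_{X|Z}$ is irreducible of dimension $N+1-n+d$.
   Context: $V=\mathbb{C}^{N+1}$ carries the bilinear form $\langle x,y\rangle=\sum_i x_iy_i$ and quadratic form $q(x)=\sum_i x_i^2$, with isotropic quadric $Q=\{q=0\}$. An affine cone is a subvariety $X\subset V$ with $\lambda x\in X$ for all $x\in X$, $\lambda\in\mathbb{C}$. For a smooth point $x$ of $X$, $T_xX\subset V$ is the linear tangent space and $N_xX=\{y\in V\mid\langle y,v\rangle=0\ \forall v\in T_xX\}$. $\mathcal{E}_{X|Z}=\overline{\{(x,u)\in V\times V\mid x\in X_{\rm sm}\cap Z,\ u-x\in N_xX\}}$, $\mathcal{E}_X=\mathcal{E}_{X|X}$. The projective ED correspondence $\mathcal{PE}_X\subset\mathbb{P}(V)\times V$ is the closure of the image of $\mathcal{E}_X\cap((V\setminus\{0\})\times V)$ under $(x,u)\mapsto([x],u)$. The ED data locus of $X$ given $Z$ is $\mathrm{DL}_{X|Z}=\overline{\mathrm{pr}_2(\mathcal{E}_{X|Z})}\subset V$. $X$ is ED regular given $Z$ if $Z\not\subset X_{\rm sing}\cup Q$ and $\mathrm{DL}_{X|Z}$ is not contained in the proper subvariety of points $u\in V$ over which the fibre of $\mathcal{PE}_X\to V$ has positive dimension. *)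

theory Defs
  imports "HOL-Analysis.Analysis"
begin

section \<open>Irreducibility and Krull dimension in a topological space\<close>

definition irreducible_in :: "'a topology \<Rightarrow> 'a set \<Rightarrow> bool" where
  "irreducible_in T S \<longleftrightarrow> S \<subseteq> topspace T \<and> S \<noteq> {} \<and>
     (\<forall>A B. closedin T A \<longrightarrow> closedin T B \<longrightarrow> S \<subseteq> A \<union> B \<longrightarrow> S \<subseteq> A \<or> S \<subseteq> B)"

text \<open>The supremum of the lengths of chains of irreducible relatively closed subsets.
  With this definition the empty set has dimension 0.\<close>

definition krull_dim :: "'a topology \<Rightarrow> 'a set \<Rightarrow> enat" where
  "krull_dim T S = (SUP k \<in> {k. \<exists>C :: nat \<Rightarrow> 'a set.
       (\<forall>i\<le>k. closedin (subtopology T S) (C i) \<and> irreducible_in T (C i)) \<and>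
       (\<forall>i<k. C i \<subset> C (Suc i))}. enat k)"


section \<open>Polynomial functions and Zariski topologies\<close>

inductive_set poly_functions :: "('a \<Rightarrow> complex) set \<Rightarrow> ('a \<Rightarrow> complex) set"
  for X :: "('a \<Rightarrow> complex) set" where
  coord: "f \<in> X \<Longrightarrow> f \<in> poly_functions X"
| const: "(\<lambda>_. c) \<in> poly_functions X"
| add: "f \<in> poly_functions X \<Longrightarrow> g \<in> poly_functions X \<Longrightarrow> (\<lambda>x. f x + g x) \<in> poly_functions X"
| mult: "f \<in> poly_functions X \<Longrightarrow> g \<in> poly_functions X \<Longrightarrow> (\<lambda>x. f x * g x) \<in> poly_functions X"

definition coords :: "(complex^'n \<Rightarrow> complex) set" where
  "coords = range (\<lambda>i x. x $ i)"

definition coords2 :: "((complex^'n) \<times> (complex^'n) \<Rightarrow> complex) set" where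
  "coords2 = range (\<lambda>i (x, u). x $ i) \<union> range (\<lambda>i (x, u). u $ i)"

text \<open>The Zariski topology on an affine space with coordinate functions \<open>X\<close>.\<close>

definition zariski_topology :: "('a \<Rightarrow> complex) set \<Rightarrow> 'a topology" where
  "zariski_topology X =
     topology (\<lambda>U. \<exists>F \<subseteq> poly_functions X. - U = {x. \<forall>f\<in>F. f x = 0})"

abbreviation zariski :: "(complex^'n) topology" where
  "zariski \<equiv> zariski_topology coords"

abbreviation zariski2 :: "((complex^'n) \<times> (complex^'n)) topology" where
  "zariski2 \<equiv> zariski_topology coords2"

text \<open>A point of \<open>\<bbbP>(V)\<close> is a line through the origin.\<close>

definition proj_point :: "complex^'n \<Rightarrow> (complex^'n) set" where
  "proj_point x = range (\<lambda>c. c *s x)"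

text \<open>Polynomials on \<open>V \<times> V\<close> that are homogeneous in the first argument; their zero loci
  are the closed subsets of \<open>\<bbbP>(V) \<times> V\<close>.\<close>

definition fst_homogeneous :: "((complex^'n) \<times> (complex^'n) \<Rightarrow> complex) set" where
  "fst_homogeneous = {f \<in> poly_functions coords2.
     \<exists>k::nat. \<forall>t x u. f (t *s x, u) = t ^ k * f (x, u)}"

definition proj_affine :: "((complex^'n) set \<times> (complex^'n)) set" where
  "proj_affine = {(proj_point x, u) | x u. x \<noteq> 0}"

definition proj_zero_locus ::
    "((complex^'n) \<times> (complex^'n) \<Rightarrow> complex) set \<Rightarrow> ((complex^'n) set \<times> (complex^'n)) set" where
  "proj_zero_locus F = {(proj_point x, u) | x u. x \<noteq> 0 \<and> (\<forall>f\<in>F. f (x, u) = 0)}"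

definition zariski_proj :: "((complex^'n) set \<times> (complex^'n)) topology" where
  "zariski_proj = topology (\<lambda>U. U \<subseteq> proj_affine \<and>
     (\<exists>F \<subseteq> fst_homogeneous. proj_affine - U = proj_zero_locus F))"

lemma openin_zariski_topology:
  "openin (zariski_topology X) U \<longleftrightarrow>
     (\<exists>F \<subseteq> poly_functions X. - U = {x. \<forall>f\<in>F. f x = 0})"
proof -
  have "istopology (\<lambda>U. \<exists>F \<subseteq> poly_functions X. - U = {x. \<forall>f\<in>F. f x = 0})"
    unfolding istopology_def
  proof (intro conjI allI impI)
    fix S T
    assume "\<exists>F \<subseteq> poly_functions X. - S = {x. \<forall>f\<in>F. f x = 0}"
      and "\<exists>F \<subseteq> poly_functions X. - T = {x. \<forall>f\<in>F. f x = 0}"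
    then obtain F G where F: "F \<subseteq> poly_functions X" "- S = {x. \<forall>f\<in>F. f x = 0}"
      and G: "G \<subseteq> poly_functions X" "- T = {x. \<forall>f\<in>G. f x = 0}" by blast
    let ?H = "(\<lambda>(f, g) x. f x * g x) ` (F \<times> G)"
    have "?H \<subseteq> poly_functions X"
      using F(1) G(1) by (auto intro: poly_functions.mult)
    moreover have "- (S \<inter> T) = {x. \<forall>f\<in>?H. f x = 0}"
    proof (intro set_eqI)
      fix x
      have "x \<in> - (S \<inter> T) \<longleftrightarrow> x \<in> - S \<or> x \<in> - T"
        by simp
      also have "\<dots> \<longleftrightarrow> (\<forall>f\<in>F. \<forall>g\<in>G. f x * g x = 0)"
        unfolding F(2) G(2) mem_Collect_eq mult_eq_0_iff by blast
      also have "\<dots> \<longleftrightarrow> x \<in> {x. \<forall>f\<in>?H. f x = 0}"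
        by simp
      finally show "x \<in> - (S \<inter> T) \<longleftrightarrow> x \<in> {x. \<forall>f\<in>?H. f x = 0}" .
    qed
    ultimately show "\<exists>F \<subseteq> poly_functions X. - (S \<inter> T) = {x. \<forall>f\<in>F. f x = 0}"
      by (intro exI[of _ ?H] conjI)
  next
    fix \<K>
    assume "\<forall>K\<in>\<K>. \<exists>F \<subseteq> poly_functions X. - K = {x. \<forall>f\<in>F. f x = 0}"
    from bchoice[OF this] obtain F
      where *: "\<forall>K\<in>\<K>. F K \<subseteq> poly_functions X \<and> - K = {x. \<forall>f\<in>F K. f x = 0}" ..
    have F: "F K \<subseteq> poly_functions X" "- K = {x. \<forall>f\<in>F K. f x = 0}" if "K \<in> \<K>" for K
      using bspec[OF * that] by (rule conjunct1, rule conjunct2)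
    have "- \<Union>\<K> = (\<Inter>K\<in>\<K>. - K)"
      by blast
    also have "\<dots> = (\<Inter>K\<in>\<K>. {x. \<forall>f\<in>F K. f x = 0})"
      using F(2) by (intro INF_cong refl)
    also have "\<dots> = {x. \<forall>f\<in>\<Union>(F ` \<K>). f x = 0}"
      by blast
    finally have "- \<Union>\<K> = {x. \<forall>f\<in>\<Union>(F ` \<K>). f x = 0}" .
    then show "\<exists>F \<subseteq> poly_functions X. - \<Union>\<K> = {x. \<forall>f\<in>F. f x = 0}"
      using F(1) by (intro exI[of _ "\<Union>(F ` \<K>)"] conjI UN_least)
  qed
  then show ?thesis
    by (simp add: zariski_topology_def)
qed

lemma proj_zero_locus_iff:
  assumes "F \<subseteq> fst_homogeneous" "x \<noteq> 0"
  shows "(proj_point x, u) \<in> proj_zero_locus F \<longleftrightarrow> (\<forall>f\<in>F. f (x, u) = 0)"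
proof
  assume "(proj_point x, u) \<in> proj_zero_locus F"
  then obtain y where y: "proj_point x = proj_point y" "\<forall>f\<in>F. f (y, u) = 0"
    by (auto simp: proj_zero_locus_def)
  have "x \<in> proj_point x"
    unfolding proj_point_def by (rule range_eqI[of _ _ 1]) simp
  then have "x \<in> proj_point y"
    by (simp only: y(1))
  then obtain t where t: "x = t *s y" by (auto simp: proj_point_def)
  show "\<forall>f\<in>F. f (x, u) = 0"
  proof
    fix f assume "f \<in> F"
    with assms(1) have "f \<in> fst_homogeneous" by blast
    then obtain k where "f (t *s y, u) = t ^ k * f (y, u)"
      unfolding fst_homogeneous_def mem_Collect_eq by metis
    with y(2) \<open>f \<in> F\<close> show "f (x, u) = 0" by (simp add: t)
  qed
next
  assume "\<forall>f\<in>F. f (x, u) = 0"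
  with assms(2) show "(proj_point x, u) \<in> proj_zero_locus F"
    unfolding proj_zero_locus_def by blast
qed

lemma fst_homogeneous_mult:
  assumes "f \<in> fst_homogeneous" "g \<in> fst_homogeneous"
  shows "(\<lambda>p. f p * g p) \<in> fst_homogeneous"
proof -
  obtain j k where "\<forall>t x u. f (t *s x, u) = t ^ j * f (x, u)"
    "\<forall>t x u. g (t *s x, u) = t ^ k * g (x, u)"
    using assms unfolding fst_homogeneous_def by blast
  then have "\<forall>t x u. f (t *s x, u) * g (t *s x, u) = t ^ (j + k) * (f (x, u) * g (x, u))"
    by (simp add: power_add)
  moreover have "(\<lambda>p. f p * g p) \<in> poly_functions coords2"
    using assms unfolding fst_homogeneous_def by (intro poly_functions.mult) blast+
  ultimately show ?thesis
    unfolding fst_homogeneous_def by blast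
qed

lemma openin_zariski_proj:
  fixes U :: "((complex^'n) set \<times> (complex^'n)) set"
  shows "openin zariski_proj U \<longleftrightarrow> U \<subseteq> proj_affine \<and>
     (\<exists>F \<subseteq> fst_homogeneous. proj_affine - U = proj_zero_locus F)"
proof -
  have mem: "(proj_point x, u) \<in> U \<longleftrightarrow> \<not> (\<forall>f\<in>F. f (x, u) = 0)"
    if "F \<subseteq> fst_homogeneous" "proj_affine - U = proj_zero_locus F" "x \<noteq> 0"
    for F :: "((complex^'n) \<times> (complex^'n) \<Rightarrow> complex) set" and U x u
  proof -
    have "(proj_point x, u) \<in> proj_affine"
      unfolding proj_affine_def using that(3) by blast
    then have "(proj_point x, u) \<in> U \<longleftrightarrow> (proj_point x, u) \<notin> proj_affine - U"
      by simp
    then show ?thesis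
      by (simp only: that(2) proj_zero_locus_iff[OF that(1,3)])
  qed
  have eqI: "proj_affine - U = proj_zero_locus F"
    if "F \<subseteq> fst_homogeneous"
      "\<And>x u :: complex^'n. x \<noteq> 0 \<Longrightarrow> (proj_point x, u) \<in> U \<longleftrightarrow> \<not> (\<forall>f\<in>F. f (x, u) = 0)"
    for F :: "((complex^'n) \<times> (complex^'n) \<Rightarrow> complex) set" and U
  proof (intro set_eqI iffI)
    fix p assume p: "p \<in> proj_affine - U"
    then obtain x u where xu: "p = (proj_point x, u)" "x \<noteq> 0"
      by (auto simp: proj_affine_def)
    with p show "p \<in> proj_zero_locus F"
      by (simp add: proj_zero_locus_iff[OF that(1)] that(2))
  next
    fix p assume p: "p \<in> proj_zero_locus F"
    then obtain x u where xu: "p = (proj_point x, u)" "x \<noteq> 0" "\<forall>f\<in>F. f (x, u) = 0"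
      by (auto simp: proj_zero_locus_def)
    moreover have "p \<in> proj_affine"
      using xu(1,2) unfolding proj_affine_def by blast
    ultimately show "p \<in> proj_affine - U"
      by (simp add: that(2))
  qed
  have "istopology (\<lambda>U :: ((complex^'n) set \<times> (complex^'n)) set. U \<subseteq> proj_affine \<and>
     (\<exists>F \<subseteq> fst_homogeneous. proj_affine - U = proj_zero_locus F))"
    unfolding istopology_def
  proof (intro conjI allI impI)
    fix S T :: "((complex^'n) set \<times> (complex^'n)) set"
    assume S: "S \<subseteq> proj_affine \<and> (\<exists>F \<subseteq> fst_homogeneous. proj_affine - S = proj_zero_locus F)"
      and T: "T \<subseteq> proj_affine \<and> (\<exists>F \<subseteq> fst_homogeneous. proj_affine - T = proj_zero_locus F)"
    from S T show "S \<inter> T \<subseteq> proj_affine" by blast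
    from S T obtain F G where
      F: "F \<subseteq> fst_homogeneous" "proj_affine - S = proj_zero_locus F" and
      G: "G \<subseteq> fst_homogeneous" "proj_affine - T = proj_zero_locus G" by blast
    let ?H = "(\<lambda>(f, g) p. f p * g p) ` (F \<times> G)"
    have H: "?H \<subseteq> fst_homogeneous"
      using F(1) G(1) by (auto intro: fst_homogeneous_mult)
    have "proj_affine - (S \<inter> T) = proj_zero_locus ?H"
      by (rule eqI[OF H]) (auto simp: mem[OF F] mem[OF G])
    with H show "\<exists>F \<subseteq> fst_homogeneous. proj_affine - (S \<inter> T) = proj_zero_locus F" by blast
  next
    fix \<K> :: "((complex^'n) set \<times> (complex^'n)) set set"
    assume K: "\<forall>K\<in>\<K>. K \<subseteq> proj_affine \<and>
      (\<exists>F \<subseteq> fst_homogeneous. proj_affine - K = proj_zero_locus F)"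
    then show "\<Union>\<K> \<subseteq> proj_affine" by blast
    from K obtain F where F: "\<And>K. K \<in> \<K> \<Longrightarrow> F K \<subseteq> fst_homogeneous"
      "\<And>K. K \<in> \<K> \<Longrightarrow> proj_affine - K = proj_zero_locus (F K)" by metis
    have H: "\<Union>(F ` \<K>) \<subseteq> fst_homogeneous" using F(1) by blast
    have "proj_affine - \<Union>\<K> = proj_zero_locus (\<Union>(F ` \<K>))"
      by (rule eqI[OF H]) (auto simp: mem[OF F])
    with H show "\<exists>F \<subseteq> fst_homogeneous. proj_affine - \<Union>\<K> = proj_zero_locus F" by blast
  qed
  then show ?thesis
    by (simp add: zariski_proj_def)
qed


section \<open>Tangent spaces, smooth points and normal spaces\<close>

definition bilin :: "complex^'n \<Rightarrow> complex^'n \<Rightarrow> complex" where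
  "bilin x y = (\<Sum>i\<in>UNIV. x $ i * y $ i)"

definition isotropic_quadric :: "(complex^'n) set" where
  "isotropic_quadric = {x. bilin x x = 0}"

definition affine_cone :: "(complex^'n) set \<Rightarrow> bool" where
  "affine_cone X \<longleftrightarrow> closedin zariski X \<and> (\<forall>x\<in>X. \<forall>c. c *s x \<in> X)"

definition vanishing_ideal :: "(complex^'n) set \<Rightarrow> (complex^'n \<Rightarrow> complex) set" where
  "vanishing_ideal X = {f \<in> poly_functions coords. \<forall>x\<in>X. f x = 0}"

text \<open>The common kernel of the differentials at \<open>x\<close> of the polynomials vanishing on \<open>X\<close>.\<close>

definition tangent_space :: "(complex^'n) set \<Rightarrow> complex^'n \<Rightarrow> (complex^'n) set" where
  "tangent_space X x = {v. \<forall>f\<in>vanishing_ideal X. deriv (\<lambda>t. f (x + t *s v)) 0 = 0}"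

definition normal_space :: "(complex^'n) set \<Rightarrow> complex^'n \<Rightarrow> (complex^'n) set" where
  "normal_space X x = {y. \<forall>v\<in>tangent_space X x. bilin y v = 0}"

text \<open>The local dimension of \<open>X\<close> at \<open>x\<close>; it is the dimension of \<open>X\<close> if \<open>X\<close> is irreducible.\<close>

definition local_dim :: "(complex^'n) set \<Rightarrow> complex^'n \<Rightarrow> enat" where
  "local_dim X x = (SUP W \<in> {W. irreducible_in zariski W \<and> x \<in> W \<and> W \<subseteq> X}. krull_dim zariski W)"

definition smooth_points :: "(complex^'n) set \<Rightarrow> (complex^'n) set" where
  "smooth_points X = {x \<in> X. enat (vec.dim (tangent_space X x)) = local_dim X x}"

definition singular_points :: "(complex^'n) set \<Rightarrow> (complex^'n) set" where
  "singular_points X = X - smooth_points X"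


section \<open>ED correspondences and ED data loci\<close>

definition ED_corr :: "(complex^'n) set \<Rightarrow> (complex^'n) set \<Rightarrow> ((complex^'n) \<times> (complex^'n)) set" where
  "ED_corr X Z = zariski2 closure_of
     {(x, u). x \<in> smooth_points X \<inter> Z \<and> u - x \<in> normal_space X x}"

definition proj_ED_corr :: "(complex^'n) set \<Rightarrow> ((complex^'n) set \<times> (complex^'n)) set" where
  "proj_ED_corr X = zariski_proj closure_of
     ((\<lambda>(x, u). (proj_point x, u)) ` (ED_corr X X \<inter> (- {0}) \<times> UNIV))"

definition ED_data_locus :: "(complex^'n) set \<Rightarrow> (complex^'n) set \<Rightarrow> (complex^'n) set" where
  "ED_data_locus X Z = zariski closure_of (snd ` ED_corr X Z)"

definition positive_dim_fibres :: "(complex^'n) set \<Rightarrow> (complex^'n) set" where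
  "positive_dim_fibres X = {u. krull_dim zariski_proj {p \<in> proj_ED_corr X. snd p = u} > 0}"

definition ED_regular_given :: "(complex^'n) set \<Rightarrow> (complex^'n) set \<Rightarrow> bool" where
  "ED_regular_given X Z \<longleftrightarrow> \<not> Z \<subseteq> singular_points X \<union> isotropic_quadric \<and>
     \<not> ED_data_locus X Z \<subseteq> positive_dim_fibres X"

end

theory Submission
  imports Defs "HOL-Library.Function_Algebras" "HOL-Computational_Algebra.Fundamental_Theorem_Algebra"
begin

text \<open>Over the smooth points of \<open>X\<close> in \<open>Z\<close> the correspondence is a bundle of affine spaces
  \<open>x + N\<^sub>xX\<close> of dimension \<open>N - n\<close>, so it is irreducible of dimension \<open>N - n + d + 1\<close>, and the
  point is that its projection to the data locus is generically finite. Take a data point \<open>u0\<close> with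
  finite projective fibre and a hyperplane missing that fibre. By elimination theory the hyperplane
  misses the fibres over all \<open>u\<close> in a Zariski neighbourhood of \<open>u0\<close>, hence these are finite too; and
  a line through a nonisotropic \<open>x\<close> carries at most one point of the affine fibre, since
  \<open>u - x\<close> is orthogonal to \<open>x\<close>.

  Dimensions are computed as transcendence degrees of primes of polynomial functions. If the
  coordinates are adjoined one at a time, the number of transcendental steps is the dimension of the
  Zariski tangent space at a general zero, so it does not depend on the order of the coordinates.\<close>

text \<open>The dimension is read off by comparing two orders of adjoining coordinates to a single
  prime, that of the correspondence in \<open>complex^('n + 'n)\<close>. With x before u, the count
  is dim Z plus the codimension of X. With u before x, the coordinates of u count the data locus,
  and generic finiteness says that those of x add nothing. Hence N + 1 - n + d is (d + 1) + (N + 1)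
  - (n + 1). Generic finiteness is used only in the form that every coordinate of x is algebraic
  over those of u. It is proved by contradiction, through the Euclidean metric: a transcendental
  coordinate takes arbitrarily large values over a general u, while a bounded algebraic set is
  finite. Regularity provides one good data point u0, but the extension of zeros works only over a
  general u, which need not be u0. Elimination bridges this gap. Characteristic zero makes the
  derivative of a minimal relation nonzero at a general zero. No quotient ring or fraction field is
  formed: relations are congruences modulo a prime, with denominators cleared.\<close>

definition subring :: "'r::comm_ring_1 set \<Rightarrow> bool" where
  "subring B \<longleftrightarrow> 1 \<in> B \<and> (\<forall>a\<in>B. - a \<in> B) \<and> (\<forall>a\<in>B. \<forall>b\<in>B. a + b \<in> B \<and> a * b \<in> B)"

lemma subringD:
  assumes "subring B"
  shows "1 \<in> B" "0 \<in> B" "a \<in> B \<Longrightarrow> - a \<in> B" "a \<in> B \<Longrightarrow> b \<in> B \<Longrightarrow> a + b \<in> B"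
    "a \<in> B \<Longrightarrow> b \<in> B \<Longrightarrow> a * b \<in> B" "a \<in> B \<Longrightarrow> b \<in> B \<Longrightarrow> a - b \<in> B"
proof -
  show "1 \<in> B" "a \<in> B \<Longrightarrow> - a \<in> B" "a \<in> B \<Longrightarrow> b \<in> B \<Longrightarrow> a + b \<in> B"
    "a \<in> B \<Longrightarrow> b \<in> B \<Longrightarrow> a * b \<in> B"
    using assms by (auto simp: subring_def)
  have "1 + (- 1) \<in> B" using assms unfolding subring_def by blast
  then show "0 \<in> B" by simp
  show "a \<in> B \<Longrightarrow> b \<in> B \<Longrightarrow> a - b \<in> B"
    using assms unfolding subring_def by (metis diff_conv_add_uminus)
qed

lemma subring_sum: "subring B \<Longrightarrow> (\<And>i. i \<in> I \<Longrightarrow> f i \<in> B) \<Longrightarrow> sum f I \<in> B"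
  by (induction I rule: infinite_finite_induct) (auto intro: subringD)

lemma subring_power: "subring B \<Longrightarrow> a \<in> B \<Longrightarrow> a ^ k \<in> B"
  by (induction k) (auto intro: subringD)

lemma subring_of_nat: "subring B \<Longrightarrow> of_nat k \<in> B"
  by (induction k) (auto intro: subringD)

section \<open>Polynomials with coefficients in a subring, and pseudo-division\<close>

definition coeffs_in :: "'r::zero set \<Rightarrow> 'r poly \<Rightarrow> bool" where
  "coeffs_in B p \<longleftrightarrow> (\<forall>k. coeff p k \<in> B)"

lemma coeffs_in_ring:
  assumes "subring B"
  shows "coeffs_in B 0" "coeffs_in B p \<Longrightarrow> coeffs_in B q \<Longrightarrow> coeffs_in B (p + q)"
    "coeffs_in B p \<Longrightarrow> coeffs_in B q \<Longrightarrow> coeffs_in B (p - q)"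
    "coeffs_in B p \<Longrightarrow> coeffs_in B q \<Longrightarrow> coeffs_in B (p * q)"
    "a \<in> B \<Longrightarrow> coeffs_in B p \<Longrightarrow> coeffs_in B (smult a p)"
    "a \<in> B \<Longrightarrow> coeffs_in B (monom a k)"
    "coeffs_in B p \<Longrightarrow> a \<in> B \<Longrightarrow> coeffs_in B (pCons a p)"
  using assms by (auto simp: coeffs_in_def coeff_mult coeff_pCons subringD
      split: nat.splits intro!: subring_sum subringD subring_of_nat)

lemma coeffs_in_pCons: "coeffs_in B (pCons a p) \<longleftrightarrow> a \<in> B \<and> coeffs_in B p"
  by (auto simp: coeffs_in_def coeff_pCons split: nat.splits dest: spec[of _ 0] spec[of _ "Suc _"])

lemma poly_in_subring:
  "subring B \<Longrightarrow> coeffs_in B p \<Longrightarrow> x \<in> B \<Longrightarrow> poly p x \<in> B"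
  by (induction p) (auto simp: coeffs_in_pCons intro!: subringD)

lemma coeffs_in_mono: "coeffs_in B p \<Longrightarrow> B \<subseteq> B' \<Longrightarrow> coeffs_in B' p"
  by (auto simp: coeffs_in_def)

text \<open>Multiplying \<open>g\<close> by the leading coefficient of \<open>q\<close> before
  cancelling its top term avoids all fractions. The bound on \<open>degree s\<close> serves later to
  show that a quotient of a minimal relation is shorter than the relation itself.\<close>

lemma pseudo_division_in_subring:
  fixes B :: "'r::comm_ring_1 set"
  assumes B: "subring B" and q: "coeffs_in B q" "degree q \<noteq> 0" and "coeffs_in B g"
  shows "\<exists>k s r. coeffs_in B s \<and> coeffs_in B r \<and> smult (lead_coeff q ^ k) g = q * s + r \<and>
    degree r < degree q \<and> degree s \<le> degree g - degree q"
  using assms(4)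
proof (induction "degree g" arbitrary: g rule: less_induct)
  case less
  show ?case
  proof (cases "degree g < degree q")
    case True
    then show ?thesis
      using less.prems B by (intro exI[of _ "0::nat"], rule_tac x = "0::'r poly" in exI, rule_tac x = g in exI)
        (auto simp: coeffs_in_ring)
  next
    case False
    define a c where "a = lead_coeff q" and "c = lead_coeff g"
    define h where "h = monom c (degree g - degree q)"
    define g' where "g' = smult a g - h * q"
    have ac: "a \<in> B" "c \<in> B" using q less.prems by (auto simp: a_def c_def coeffs_in_def)
    have h: "coeffs_in B h" and g': "coeffs_in B g'"
      using B ac q less.prems by (auto simp: h_def g'_def coeffs_in_ring)
    have dh: "degree h \<le> degree g - degree q" by (simp add: h_def degree_monom_le)
    have "degree (h * q) \<le> degree g"
      using degree_mult_le[of h q] dh False by linarith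
    then have "degree g' \<le> degree g"
      unfolding g'_def by (intro degree_diff_le) (auto intro: order_trans[OF degree_smult_le])
    moreover have "coeff g' (degree g) = 0"
      using False by (simp add: g'_def h_def coeff_monom_mult a_def c_def)
    ultimately have less': "degree g' < degree g"
      using False q(2) by (metis (no_types, lifting) degree_0 le_neq_implies_less leading_coeff_0_iff gr_zeroI leI)
    from less.hyps[OF less' g'] obtain k s r where
      IH: "coeffs_in B s" "coeffs_in B r" "smult (a ^ k) g' = q * s + r"
        "degree r < degree q" "degree s \<le> degree g' - degree q"
      by (auto simp: a_def)
    let ?s = "s + smult (a ^ k) h"
    have "smult (a ^ Suc k) g = smult (a ^ k) g' + q * smult (a ^ k) h"
      by (simp add: g'_def smult_diff_right algebra_simps)
    also have "\<dots> = q * ?s + r"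
      using IH(3) by (simp add: algebra_simps)
    finally have "smult (a ^ Suc k) g = q * ?s + r" .
    moreover have "degree ?s \<le> degree g - degree q"
      using IH(5) less' dh by (intro degree_add_le) (auto intro: order_trans[OF degree_smult_le])
    moreover have "coeffs_in B ?s"
      using B IH(1) ac h by (intro coeffs_in_ring subring_power)
    ultimately show ?thesis
      using IH(2,4) unfolding a_def by blast
  qed
qed

text \<open>The ambient type will be that of all complex functions, which has zero divisors and is
  far too large; so the ring is a subset \<open>R\<close>, and primality is required relative to
  it.\<close>

locale prime_ideal_in =
  fixes R P :: "'r::comm_ring_1 set"
  assumes subring_R: "subring R"
    and P_sub: "P \<subseteq> R"
    and P_zero: "0 \<in> P"
    and P_add: "a \<in> P \<Longrightarrow> b \<in> P \<Longrightarrow> a + b \<in> P"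
    and P_mult: "a \<in> R \<Longrightarrow> b \<in> P \<Longrightarrow> a * b \<in> P"
    and P_one: "1 \<notin> P"
    and P_prime: "a \<in> R \<Longrightarrow> b \<in> R \<Longrightarrow> a * b \<in> P \<Longrightarrow> a \<in> P \<or> b \<in> P"
begin

lemma P_mult2: "b \<in> R \<Longrightarrow> a \<in> P \<Longrightarrow> a * b \<in> P"
  using P_mult[of b a] by (simp add: mult.commute)

lemma P_uminus: "a \<in> P \<Longrightarrow> - a \<in> P"
  using P_mult[of "-1" a] subring_R by (simp add: subringD)

lemma P_diff: "a \<in> P \<Longrightarrow> b \<in> P \<Longrightarrow> a - b \<in> P"
  using P_add[of a "-b"] P_uminus by simp

lemma P_sum: "(\<And>i. i \<in> I \<Longrightarrow> f i \<in> P) \<Longrightarrow> sum f I \<in> P"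
  by (induction I rule: infinite_finite_induct) (auto intro: P_add P_zero)

lemma P_power: "a \<in> R \<Longrightarrow> a ^ k \<in> P \<Longrightarrow> a \<in> P"
proof (induction k)
  case (Suc k)
  then show ?case using P_prime[of a "a ^ k"] subring_power[OF subring_R] by auto
qed (use P_one in simp)

lemma poly_in_P: "coeffs_in P p \<Longrightarrow> x \<in> R \<Longrightarrow> poly p x \<in> P"
  by (induction p) (auto simp: coeffs_in_pCons P_zero intro!: P_add P_mult)

lemma P_cong: "a - b \<in> P \<Longrightarrow> a \<in> P \<longleftrightarrow> b \<in> P"
  using P_add[of "a - b" b] P_diff[of a "a - b"] by auto

text \<open>Algebraicity of the class of \<open>x\<close> over the image of \<open>B\<close> in
  \<open>R/P\<close>: a polynomial whose coefficients do not all lie in \<open>P\<close> is a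
  nonzero polynomial over that image.\<close>

definition algebraic_over :: "'r set \<Rightarrow> 'r \<Rightarrow> bool" where
  "algebraic_over B x \<longleftrightarrow> (\<exists>q. coeffs_in B q \<and> \<not> coeffs_in P q \<and> poly q x \<in> P)"

lemma algebraic_over_mono: "algebraic_over B x \<Longrightarrow> B \<subseteq> B' \<Longrightarrow> algebraic_over B' x"
  unfolding algebraic_over_def using coeffs_in_mono by blast

text \<open>A top term with coefficient in \<open>P\<close> vanishes modulo \<open>P\<close> and may
  be dropped. This lets \<open>degree\<close> act as the degree modulo \<open>P\<close> in arguments
  by minimality.\<close>

lemma coeffs_in_P_minus_monom:
  assumes B: "subring B" "B \<subseteq> R" and p: "coeffs_in B p" and x: "x \<in> R"
    and lc: "lead_coeff p \<in> P" and nz: "degree p \<noteq> 0"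
  obtains p' where "coeffs_in B p'" "degree p' < degree p" "coeffs_in P (p - p')"
    "poly p x - poly p' x \<in> P"
proof -
  define p' where "p' = p - monom (lead_coeff p) (degree p)"
  have "lead_coeff p \<in> B" using p by (auto simp: coeffs_in_def)
  then have 1: "coeffs_in B p'"
    using B p unfolding p'_def by (auto intro: coeffs_in_ring)
  have "degree p' \<le> degree p" unfolding p'_def
    by (intro degree_diff_le) (auto simp: degree_monom_le)
  moreover have "coeff p' (degree p) = 0" by (simp add: p'_def)
  ultimately have 2: "degree p' < degree p"
    using nz by (metis degree_0 le_neq_implies_less leading_coeff_0_iff gr_zeroI)
  have 3: "coeffs_in P (p - p')"
    using lc P_zero by (auto simp: p'_def coeffs_in_def)
  then have "poly (p - p') x \<in> P" using x by (rule poly_in_P)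
  then show ?thesis using that[OF 1 2 3] by simp
qed

lemma coeffs_in_P_diff: "coeffs_in P p \<Longrightarrow> coeffs_in P q \<Longrightarrow> coeffs_in P (p - q)"
  by (auto simp: coeffs_in_def intro: P_diff)

lemma coeffs_in_P_add: "coeffs_in P p \<Longrightarrow> coeffs_in P q \<Longrightarrow> coeffs_in P (p + q)"
  by (auto simp: coeffs_in_def intro: P_add)

text \<open>A relation of least degree has leading coefficient outside \<open>P\<close>, since
  otherwise dropping the top term would give a shorter one. It is the minimal polynomial of
  \<open>x\<close> over the fraction field of the image of \<open>B\<close>, with denominators
  cleared.\<close>

lemma exists_minimal_relation:
  assumes B: "subring B" "B \<subseteq> R" and x: "x \<in> R" and alg: "algebraic_over B x"
  obtains q where "coeffs_in B q" "lead_coeff q \<notin> P" "degree q \<noteq> 0" "poly q x \<in> P"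
    "\<And>r. coeffs_in B r \<Longrightarrow> degree r < degree q \<Longrightarrow> poly r x \<in> P \<Longrightarrow> coeffs_in P r"
proof -
  let ?A = "\<lambda>q. coeffs_in B q \<and> \<not> coeffs_in P q \<and> poly q x \<in> P"
  obtain q where q: "?A q" and min: "\<And>r. ?A r \<Longrightarrow> degree q \<le> degree r"
    using alg ex_has_least_nat[of ?A _ degree] unfolding algebraic_over_def by blast
  have nz: "degree q \<noteq> 0"
  proof
    assume "degree q = 0"
    then obtain c where "q = [:c:]" by (metis degree_eq_zeroE)
    with q show False
      using P_zero by (auto simp: coeffs_in_def coeff_pCons split: nat.splits)
  qed
  have lc: "lead_coeff q \<notin> P"
  proof
    assume lc: "lead_coeff q \<in> P"
    from q have "coeffs_in B q" by simp
    then obtain p' where p': "coeffs_in B p'" "degree p' < degree q" "coeffs_in P (q - p')"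
      "poly q x - poly p' x \<in> P"
      by (rule coeffs_in_P_minus_monom[OF B _ x lc nz])
    have "poly p' x \<in> P" using p'(4) q P_cong by blast
    moreover have "\<not> coeffs_in P p'"
      using q p'(3) coeffs_in_P_add[of "q - p'" p'] by auto
    ultimately show False using min[of p'] p' by auto
  qed
  show ?thesis
  proof (rule that)
    show "coeffs_in B q" "lead_coeff q \<notin> P" "degree q \<noteq> 0" "poly q x \<in> P"
      using q lc nz by auto
    show "coeffs_in P r" if "coeffs_in B r" "degree r < degree q" "poly r x \<in> P" for r
      using min[of r] that by fastforce
  qed
qed

text \<open>The elimination is Bezout's identity: a combination of \<open>g\<close> and the minimal relation \<open>q\<close>
  of least degree, modulo \<open>P\<close>, divides both up to denominators, so it is constant.\<close>

lemma algebraic_element_divides_base: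
  assumes B: "subring B" "B \<subseteq> R" and x: "x \<in> R" and alg: "algebraic_over B x"
    and g: "coeffs_in B g" "poly g x \<notin> P"
  obtains u b where "coeffs_in B u" "b \<in> B" "b \<notin> P" "poly u x * poly g x - b \<in> P"
proof -
  obtain q where q: "coeffs_in B q" "lead_coeff q \<notin> P" "degree q \<noteq> 0" "poly q x \<in> P"
    and qmin: "\<And>r. coeffs_in B r \<Longrightarrow> degree r < degree q \<Longrightarrow> poly r x \<in> P \<Longrightarrow> coeffs_in P r"
    using exists_minimal_relation[OF B x alg] by blast
  \<comment> \<open>The nonzero members, modulo \<open>P\<close>, of the ideal generated by
    \<open>g\<close> and \<open>q\<close>; one of least degree plays the gcd.\<close>
  let ?H = "\<lambda>h. coeffs_in B h \<and> \<not> coeffs_in P h \<and>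
    (\<exists>u v. coeffs_in B u \<and> coeffs_in B v \<and> coeffs_in P (h - (u * g + v * q)))"
  have c01: "coeffs_in B 0" "coeffs_in B 1" "coeffs_in P 0"
    using B P_zero by (auto simp: coeffs_in_def subringD coeff_1)
  have "\<not> coeffs_in P q" using q(2) by (auto simp: coeffs_in_def)
  then have "?H q"
    using q(1) c01 by (intro conjI exI[of _ "0 :: 'r poly"] exI[of _ "1 :: 'r poly"]) auto
  then obtain h where h: "?H h" and hmin: "\<And>r. ?H r \<Longrightarrow> degree h \<le> degree r"
    using ex_has_least_nat[of ?H q degree] by blast
  from h obtain u v where uv: "coeffs_in B u" "coeffs_in B v" "coeffs_in P (h - (u * g + v * q))"
    by blast
  have hB: "coeffs_in B h" "\<not> coeffs_in P h" using h by auto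
  have evh: "poly h x - poly u x * poly g x \<in> P"
  proof -
    have "poly (h - (u * g + v * q)) x + poly v x * poly q x \<in> P"
      using uv x q(4) B poly_in_subring[OF subring_R coeffs_in_mono[OF uv(2) B(2)] x]
      by (intro P_add P_mult[of "poly v x"] poly_in_P[OF uv(3)]) auto
    then show ?thesis by (simp add: algebra_simps)
  qed
  have deg0: "degree h = 0"
  proof (rule ccontr)
    assume nz: "degree h \<noteq> 0"
    have lc: "lead_coeff h \<notin> P"
    proof
      assume lc: "lead_coeff h \<in> P"
      obtain p' where p': "coeffs_in B p'" "degree p' < degree h" "coeffs_in P (h - p')"
        using coeffs_in_P_minus_monom[OF B hB(1) x lc nz] by blast
      have "\<not> coeffs_in P p'"
        using hB p'(3) coeffs_in_P_add[of "h - p'" p'] by auto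
      moreover have "coeffs_in P (p' - (u * g + v * q))"
        using coeffs_in_P_diff[OF uv(3) p'(3)] by (simp add: algebra_simps)
      ultimately show False using hmin[of p'] p'(1,2) uv by auto
    qed
    \<comment> \<open>The remainder of a combination \<open>f\<close> of \<open>g\<close> and
      \<open>q\<close> is again such a combination modulo \<open>P\<close>, and of smaller degree
      than \<open>h\<close>; minimality leaves it no choice but to vanish modulo
      \<open>P\<close>.\<close>
    have rem: "coeffs_in P r" if "coeffs_in B f" "smult (lead_coeff h ^ k) f = h * s + r"
      "coeffs_in B s" "coeffs_in B r" "degree r < degree h"
      "coeffs_in B a" "coeffs_in B b" "f = a * g + b * q" for f a b k s r
    proof (rule ccontr)
      assume nr: "\<not> coeffs_in P r"
      let ?c = "lead_coeff h ^ k"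
      have cB: "?c \<in> B" using hB B by (auto simp: coeffs_in_def intro: subring_power)
      have "coeffs_in B (smult ?c a - s * u)" "coeffs_in B (smult ?c b - s * v)"
        using that uv B cB by (auto intro!: coeffs_in_ring)
      moreover have "r - ((smult ?c a - s * u) * g + (smult ?c b - s * v) * q)
          = - (s * (h - (u * g + v * q)))"
      proof -
        have "r = smult ?c f - h * s" using that(2) by (simp add: algebra_simps)
        then show ?thesis by (simp add: that(8) algebra_simps smult_add_right)
      qed
      moreover have "coeffs_in P (- (s * (h - (u * g + v * q))))"
        using that(3) uv(3) B(2) unfolding coeffs_in_def coeff_minus coeff_mult
        by (intro allI P_uminus P_sum P_mult) auto
      ultimately have "?H r" using that(4) nr by metis
      then show False using hmin that(5) by fastforce
    qed
    have hR: "coeffs_in R h" "coeffs_in R q" using hB q B coeffs_in_mono by blast+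
    \<comment> \<open>\<open>h\<close> divides \<open>g\<close> up to denominators, and
      \<open>g\<close> does not vanish at \<open>x\<close> modulo \<open>P\<close>; hence neither
      does \<open>h\<close>.\<close>
    obtain k s r where d1: "coeffs_in B s" "coeffs_in B r" "smult (lead_coeff h ^ k) g = h * s + r"
      "degree r < degree h"
      using pseudo_division_in_subring[OF B(1) hB(1) nz g(1)] by blast
    have "coeffs_in P r"
      by (rule rem[OF g(1) d1(3,1,2,4), of 1 0])
        (use B in \<open>auto simp: coeffs_in_def subringD coeff_1\<close>)
    then have "poly r x \<in> P" using x by (rule poly_in_P)
    have sR: "poly s x \<in> R" using poly_in_subring[OF subring_R coeffs_in_mono[OF d1(1) B(2)] x] .
    have lR: "lead_coeff h ^ k \<in> R" for k using hR subring_R by (auto simp: coeffs_in_def intro: subring_power)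
    have gR: "poly g x \<in> R" using poly_in_subring[OF subring_R coeffs_in_mono[OF g(1) B(2)] x] .
    have hxn: "poly h x \<notin> P"
    proof
      assume "poly h x \<in> P"
      then have "poly (h * s + r) x \<in> P"
        using \<open>poly r x \<in> P\<close> sR by (auto intro: P_add P_mult2)
      then have "lead_coeff h ^ k * poly g x \<in> P" using d1(3) by (metis poly_smult)
      then show False using P_prime[OF lR gR] g(2) lc P_power hR by (auto simp: coeffs_in_def)
    qed
    \<comment> \<open>\<open>h\<close> divides \<open>q\<close> as well, and \<open>q\<close>
      vanishes at \<open>x\<close> while \<open>h\<close> does not; so the cofactor \<open>s\<close>
      does. As \<open>h\<close> is not constant, \<open>s\<close> is shorter than \<open>q\<close>
      and must vanish modulo \<open>P\<close>, which contradicts the leading coefficient of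
      \<open>q\<close>.\<close>
    obtain k s r where d2: "coeffs_in B s" "coeffs_in B r" "smult (lead_coeff h ^ k) q = h * s + r"
      "degree r < degree h" "degree s \<le> degree q - degree h"
      using pseudo_division_in_subring[OF B(1) hB(1) nz q(1)] by blast
    have rP: "coeffs_in P r"
      by (rule rem[OF q(1) d2(3,1,2,4), of 0 1])
        (use B in \<open>auto simp: coeffs_in_def subringD coeff_1\<close>)
    then have "poly r x \<in> P" using x by (rule poly_in_P)
    have sR: "poly s x \<in> R" using poly_in_subring[OF subring_R coeffs_in_mono[OF d2(1) B(2)] x] .
    have hxR: "poly h x \<in> R" using poly_in_subring[OF subring_R hR(1) x] .
    have "poly h x * poly s x + poly r x = lead_coeff h ^ k * poly q x"
      using d2(3) by (metis poly_add poly_mult poly_smult)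
    then have "poly h x * poly s x + poly r x \<in> P" using q(4) lR P_mult by metis
    then have "poly h x * poly s x \<in> P" using \<open>poly r x \<in> P\<close> P_diff by fastforce
    then have "poly s x \<in> P" using P_prime hxR sR hxn by blast
    then have "coeffs_in P s"
      using d2(5) nz q(3) by (intro qmin d2(1)) auto
    have "coeffs_in P (h * s + r)"
      unfolding coeffs_in_def coeff_add coeff_mult
      using hR rP \<open>coeffs_in P s\<close> by (auto simp: coeffs_in_def intro!: P_add P_sum P_mult)
    then have "lead_coeff h ^ k * lead_coeff q \<in> P"
      using d2(3) by (metis coeff_smult coeffs_in_def)
    moreover have "lead_coeff q \<in> R" using hR by (auto simp: coeffs_in_def)
    ultimately have "lead_coeff h ^ k \<in> P" using P_prime[OF lR] q(2) by blast
    then show False using P_power[of "lead_coeff h" k] lR[of 1] lc by simp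
  qed
  then obtain b where b: "h = [:b:]" by (metis degree_eq_zeroE)
  have "b \<in> B" using hB b by (simp add: coeffs_in_pCons)
  moreover have "b \<notin> P" using hB b P_zero by (auto simp: coeffs_in_def coeff_pCons split: nat.splits)
  moreover have "poly u x * poly g x - b \<in> P" using evh P_uminus b by fastforce
  ultimately show ?thesis using that uv by blast
qed

end

section \<open>Polynomial functions in a subset of the coordinates\<close>

abbreviation (input) coord_fun :: "'m \<Rightarrow> complex^'m \<Rightarrow> complex" where
  "coord_fun i \<equiv> (\<lambda>x. x $ i)"

definition polys_in :: "'m set \<Rightarrow> (complex^'m \<Rightarrow> complex) set" where
  "polys_in T = poly_functions (coord_fun ` T)"

lemma polys_in_UNIV: "polys_in UNIV = poly_functions coords"
  by (simp add: polys_in_def coords_def)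

lemma poly_functions_uminus: "f \<in> poly_functions X \<Longrightarrow> - f \<in> poly_functions X"
  using poly_functions.mult[OF poly_functions.const[of "-1" X]] by (simp add: fun_Compl_def)

lemma subring_poly_functions: "subring (poly_functions X)"
  unfolding subring_def
  using poly_functions.const[of 1 X] poly_functions_uminus
  by (auto simp: plus_fun_def times_fun_def one_fun_def intro: poly_functions.intros)

lemma subring_polys_in: "subring (polys_in T)"
  by (simp add: polys_in_def subring_poly_functions)

lemma poly_functions_mono: "X \<subseteq> Y \<Longrightarrow> poly_functions X \<subseteq> poly_functions Y"
proof
  fix f assume "X \<subseteq> Y" "f \<in> poly_functions X"
  from this(2) show "f \<in> poly_functions Y"
    by induction (use \<open>X \<subseteq> Y\<close> in \<open>auto intro: poly_functions.intros\<close>)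
qed

lemma polys_in_mono: "S \<subseteq> T \<Longrightarrow> polys_in S \<subseteq> polys_in T"
  unfolding polys_in_def by (intro poly_functions_mono image_mono)

lemma polys_in_const [simp]: "(\<lambda>_. c) \<in> polys_in T"
  by (simp add: polys_in_def poly_functions.const)

lemma polys_in_coord: "i \<in> T \<Longrightarrow> coord_fun i \<in> polys_in T"
  by (auto simp: polys_in_def intro: poly_functions.coord)

lemma polys_in_coord_UNIV [simp]: "coord_fun i \<in> polys_in UNIV"
  by (simp add: polys_in_coord)

lemma polys_in_induct [consumes 1, case_names coord const add mult]:
  assumes "f \<in> polys_in T"
    and "\<And>i. i \<in> T \<Longrightarrow> Q (coord_fun i)" and "\<And>c. Q (\<lambda>_. c)"
    and "\<And>f g. f \<in> polys_in T \<Longrightarrow> g \<in> polys_in T \<Longrightarrow> Q f \<Longrightarrow> Q g \<Longrightarrow> Q (f + g)"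
    and "\<And>f g. f \<in> polys_in T \<Longrightarrow> g \<in> polys_in T \<Longrightarrow> Q f \<Longrightarrow> Q g \<Longrightarrow> Q (f * g)"
  shows "Q f"
  using assms(1) unfolding polys_in_def
proof induction
  case (add f g)
  then show ?case using assms(4)[of f g] by (simp add: polys_in_def plus_fun_def)
next
  case (mult f g)
  then show ?case using assms(5)[of f g] by (simp add: polys_in_def times_fun_def)
qed (use assms in auto)

lemma polys_in_cong: "f \<in> polys_in T \<Longrightarrow> (\<And>i. i \<in> T \<Longrightarrow> x $ i = y $ i) \<Longrightarrow> f x = f y"
  by (induction rule: polys_in_induct) auto

lemma polys_in_empty: "f \<in> polys_in {} \<Longrightarrow> \<exists>c. f = (\<lambda>_. c)"
  by (induction rule: polys_in_induct) (auto simp: fun_eq_iff)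

lemma poly_functions_insertE:
  assumes "f \<in> poly_functions (insert g X)"
  obtains q where "coeffs_in (poly_functions X) q" "f = poly q g"
proof -
  note sr = subring_poly_functions[of X]
  from assms have "\<exists>q. coeffs_in (poly_functions X) q \<and> f = poly q g"
  proof induction
    case (coord f)
    show ?case
    proof (cases "f = g")
      case True
      have "coeffs_in (poly_functions X) [:0, 1:]"
        using sr coeffs_in_ring(1)[OF sr] by (auto simp: coeffs_in_pCons intro: subringD)
      moreover have "f = poly [:0, 1:] g" using True by simp
      ultimately show ?thesis by blast
    next
      case False
      then have "coeffs_in (poly_functions X) [:f:]" "f = poly [:f:] g"
        using coord sr by (auto simp: coeffs_in_pCons coeffs_in_ring intro: poly_functions.coord)
      then show ?thesis by blast
    qed
  next
    case (const c)
    have "coeffs_in (poly_functions X) [:\<lambda>_. c:]" "(\<lambda>_. c) = poly [:\<lambda>_. c:] g"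
      using sr by (auto simp: coeffs_in_pCons coeffs_in_ring poly_functions.const)
    then show ?case by blast
  next
    case (add f f')
    then obtain q q' where "coeffs_in (poly_functions X) q" "f = poly q g"
      "coeffs_in (poly_functions X) q'" "f' = poly q' g" by blast
    then have "coeffs_in (poly_functions X) (q + q')" "(\<lambda>x. f x + f' x) = poly (q + q') g"
      using sr by (auto simp: coeffs_in_ring plus_fun_def)
    then show ?case by blast
  next
    case (mult f f')
    then obtain q q' where "coeffs_in (poly_functions X) q" "f = poly q g"
      "coeffs_in (poly_functions X) q'" "f' = poly q' g" by blast
    then have "coeffs_in (poly_functions X) (q * q')" "(\<lambda>x. f x * f' x) = poly (q * q') g"
      using sr by (auto simp: coeffs_in_ring times_fun_def)
    then show ?case by blast
  qed
  then show ?thesis using that by blast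
qed

lemma polys_in_insertE:
  assumes "f \<in> polys_in (insert i T)"
  obtains q where "coeffs_in (polys_in T) q" "f = poly q (coord_fun i)"
  using assms poly_functions_insertE[of f "coord_fun i" "coord_fun ` T"]
  by (auto simp: polys_in_def)

text \<open>Specialising the coefficients at a point gives a polynomial in one variable over the
  complex numbers, where roots can be counted and found.\<close>

definition eval_poly :: "'a \<Rightarrow> ('a \<Rightarrow> complex) poly \<Rightarrow> complex poly" where
  "eval_poly x = map_poly (\<lambda>c. c x)"

lemma eval_poly_pCons [simp]: "eval_poly x (pCons c q) = pCons (c x) (eval_poly x q)"
  and eval_poly_0 [simp]: "eval_poly x 0 = 0"
  by (simp_all add: eval_poly_def map_poly_pCons)

lemma coeff_eval_poly: "coeff (eval_poly x q) k = coeff q k x"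
  by (simp add: eval_poly_def coeff_map_poly)

lemma poly_fun_apply: "poly q f x = poly (eval_poly x q) (f x)"
  by (induction q) auto

text \<open>Reduces to one variable; the domain property, the existence of directional derivatives
  and the irreducibility of the correspondence all rest on it.\<close>

lemma poly_along_line:
  assumes "f \<in> polys_in UNIV"
  shows "\<exists>p. \<forall>t. f (x + t *s v) = poly p t"
  using assms
proof (induction rule: polys_in_induct)
  case (coord i)
  show ?case by (intro exI[of _ "[:x $ i, v $ i:]"]) simp
next
  case (const c)
  show ?case by (intro exI[of _ "[:c:]"]) simp
next
  case (add f g)
  then show ?case by (metis plus_fun_apply poly_add)
next
  case (mult f g)
  then show ?case by (metis times_fun_apply poly_mult)
qed

text \<open>On the line joining a point where \<open>f\<close> is nonzero to one where
  \<open>g\<close> is nonzero, both restrict to nonzero polynomials in one variable, whose product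
  cannot vanish identically.\<close>

lemma polys_in_domain:
  assumes "f \<in> polys_in UNIV" "g \<in> polys_in UNIV" "f * g = 0"
  shows "f = 0 \<or> g = 0"
proof (rule ccontr)
  assume "\<not> ?thesis"
  then obtain a b where ab: "f a \<noteq> 0" "g b \<noteq> 0" by (auto simp: fun_eq_iff)
  obtain p q where p: "\<And>t. f (a + t *s (b - a)) = poly p t" and q: "\<And>t. g (a + t *s (b - a)) = poly q t"
    using poly_along_line[OF assms(1)] poly_along_line[OF assms(2)] by metis
  have "p \<noteq> 0" using p[of 0] ab by auto
  moreover have "q \<noteq> 0" using q[of 1] ab by auto
  moreover have "poly (p * q) t = 0" for t
    using fun_cong[OF assms(3), of "a + t *s (b - a)"] by (simp only: p q times_fun_apply poly_mult zero_fun_apply)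
  ultimately show False by (metis mult_eq_0_iff poly_all_0_iff_0)
qed

definition upd_coord :: "complex^'m \<Rightarrow> 'm \<Rightarrow> complex \<Rightarrow> complex^'m" where
  "upd_coord x i t = (\<chi> j. if j = i then t else x $ j)"

lemma upd_coord_nth [simp]: "upd_coord x i t $ j = (if j = i then t else x $ j)"
  by (simp add: upd_coord_def)

lemma polys_in_upd: "f \<in> polys_in T \<Longrightarrow> i \<notin> T \<Longrightarrow> f (upd_coord x i t) = f x"
  by (rule polys_in_cong) auto

lemma poly_upd_coord:
  assumes "coeffs_in (polys_in T) q" "i \<notin> T"
  shows "poly q (coord_fun i) (upd_coord x i t) = poly (eval_poly x q) t"
proof -
  have "eval_poly (upd_coord x i t) q = eval_poly x q"
    using assms by (intro poly_eqI) (auto simp: coeff_eval_poly coeffs_in_def intro: polys_in_upd)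
  then show ?thesis by (simp add: poly_fun_apply)
qed

lemma poly_coord_in:
  assumes "coeffs_in (polys_in T) q"
  shows "poly q (coord_fun i) \<in> polys_in (insert i T)"
  using assms polys_in_mono[of T "insert i T"] coeffs_in_mono
  by (intro poly_in_subring subring_polys_in polys_in_coord) blast+

lemma exists_large_nonroot:
  fixes p :: "complex poly"
  assumes "p \<noteq> 0"
  shows "\<exists>t. poly p t \<noteq> 0 \<and> norm t > M"
proof -
  have "finite {t. poly p t = 0}" using assms by (rule poly_roots_finite)
  then have "bounded {t. poly p t = 0}" by (rule finite_imp_bounded)
  then obtain B where B: "\<And>t. poly p t = 0 \<Longrightarrow> norm t \<le> B"
    by (auto simp: bounded_iff)
  define s where "s = max 0 (max B M) + 1"
  have "norm (of_real s :: complex) > B" "norm (of_real s :: complex) > M"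
    by (auto simp: s_def)
  then show ?thesis using B[of "of_real s"] by force
qed


section \<open>Prime ideals of polynomial functions: extension of zeros\<close>

locale polynomial_prime = prime_ideal_in "polys_in UNIV" P
  for P :: "(complex^'m \<Rightarrow> complex) set"
begin

definition alg :: "'m set \<Rightarrow> 'm \<Rightarrow> bool" where
  "alg T i \<longleftrightarrow> algebraic_over (polys_in T) (coord_fun i)"

text \<open>Only the relations among the coordinates in \<open>T\<close> are imposed, so the other
  coordinates are free until they are adjoined.\<close>

definition zeros_on :: "'m set \<Rightarrow> (complex^'m) set" where
  "zeros_on T = {x. \<forall>f\<in>P \<inter> polys_in T. f x = 0}"

lemma zeros_on_UNIV: "zeros_on UNIV = {x. \<forall>f\<in>P. f x = 0}"
  using P_sub by (auto simp: zeros_on_def)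

lemma polys_in_sub: "polys_in T \<subseteq> polys_in UNIV"
  by (simp add: polys_in_mono)

lemma alg_mono: "alg T i \<Longrightarrow> T \<subseteq> T' \<Longrightarrow> alg T' i"
  unfolding alg_def using algebraic_over_mono polys_in_mono by blast

lemma const_in_P: "(\<lambda>_. c) \<in> P \<Longrightarrow> c = 0"
  using P_mult[of "\<lambda>_. 1 / c" "\<lambda>_. c"] P_one
  by (cases "c = 0") (auto simp: times_fun_def one_fun_def)

lemma zeros_on_empty: "zeros_on {} = UNIV"
proof -
  have "f x = 0" if "f \<in> P" "f \<in> polys_in {}" for f x
    using polys_in_empty[OF that(2)] that(1) const_in_P by auto
  then show ?thesis by (auto simp: zeros_on_def)
qed

text \<open>Every relation in \<open>P\<close> has all its coefficients in \<open>P\<close> when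
  written in powers of coordinate \<open>i\<close>, so it holds at any value of that coordinate. For
  \<open>h\<close> one takes a coefficient of \<open>f\<close> outside \<open>P\<close>: where it is
  nonzero, \<open>f\<close> excludes only finitely many values.\<close>

lemma extend_zero_transcendental:
  assumes "\<not> alg T i" "i \<notin> T" "f \<in> polys_in (insert i T)" "f \<notin> P"
  obtains h where "h \<in> polys_in T" "h \<notin> P"
    "\<And>x M. x \<in> zeros_on T \<Longrightarrow> h x \<noteq> 0 \<Longrightarrow>
       \<exists>t. upd_coord x i t \<in> zeros_on (insert i T) \<and> f (upd_coord x i t) \<noteq> 0 \<and> norm t > M"
proof -
  obtain q where q: "coeffs_in (polys_in T) q" "f = poly q (coord_fun i)"
    using polys_in_insertE[OF assms(3)] by blast
  have "\<not> coeffs_in P q"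
    using assms(4) poly_in_P[of q "coord_fun i"] q by auto
  then obtain k where k: "coeff q k \<notin> P" by (auto simp: coeffs_in_def)
  show ?thesis
  proof (rule that[of "coeff q k"])
    show "coeff q k \<in> polys_in T" using q by (auto simp: coeffs_in_def)
    fix x M assume x: "x \<in> zeros_on T" "coeff q k x \<noteq> 0"
    have "eval_poly x q \<noteq> 0" using x(2) coeff_eval_poly[of x q k] by auto
    then obtain t where t: "poly (eval_poly x q) t \<noteq> 0" "norm t > M"
      using exists_large_nonroot by blast
    have "g (upd_coord x i t) = 0" if g: "g \<in> P" "g \<in> polys_in (insert i T)" for g
    proof -
      obtain r where r: "coeffs_in (polys_in T) r" "g = poly r (coord_fun i)"
        using polys_in_insertE[OF g(2)] by blast
      then have "coeffs_in P r"
        using assms(1) g(1) by (auto simp: alg_def algebraic_over_def)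
      then have "coeff r j x = 0" for j
        using x(1) r by (auto simp: zeros_on_def coeffs_in_def)
      then have "eval_poly x r = 0" by (intro poly_eqI) (simp add: coeff_eval_poly)
      then show ?thesis using poly_upd_coord[OF r(1) assms(2)] r(2) by simp
    qed
    then have "upd_coord x i t \<in> zeros_on (insert i T)" by (simp add: zeros_on_def)
    moreover have "f (upd_coord x i t) \<noteq> 0"
      using poly_upd_coord[OF q(1) assms(2)] q(2) t(1) by simp
    ultimately show "\<exists>t. upd_coord x i t \<in> zeros_on (insert i T) \<and> f (upd_coord x i t) \<noteq> 0 \<and> norm t > M"
      using t(2) by blast
  qed (rule k)
qed

text \<open>The new coordinate must be a root of the specialised minimal relation. It then satisfies
  every other relation as well: pseudo-division by the minimal relation leaves a remainder with
  coefficients in \<open>P\<close>.\<close>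

lemma extend_zero_algebraic:
  assumes "alg T i" "i \<notin> T" "f \<in> polys_in (insert i T)" "f \<notin> P"
  obtains h where "h \<in> polys_in T" "h \<notin> P"
    "\<And>x. x \<in> zeros_on T \<Longrightarrow> h x \<noteq> 0 \<Longrightarrow>
       \<exists>t. upd_coord x i t \<in> zeros_on (insert i T) \<and> f (upd_coord x i t) \<noteq> 0"
proof -
  note sr = subring_polys_in[of T] and sub = polys_in_sub[of T]
  obtain g where g: "coeffs_in (polys_in T) g" "f = poly g (coord_fun i)"
    using polys_in_insertE[OF assms(3)] by blast
  have alg: "algebraic_over (polys_in T) (coord_fun i)" using assms(1) by (simp add: alg_def)
  obtain q where q: "coeffs_in (polys_in T) q" "lead_coeff q \<notin> P" "degree q \<noteq> 0"
      "poly q (coord_fun i) \<in> P"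
    and qmin: "\<And>r. coeffs_in (polys_in T) r \<Longrightarrow> degree r < degree q \<Longrightarrow> poly r (coord_fun i) \<in> P \<Longrightarrow> coeffs_in P r"
    using exists_minimal_relation[OF sr sub polys_in_coord_UNIV alg] by blast
  obtain u b where ub: "coeffs_in (polys_in T) u" "b \<in> polys_in T" "b \<notin> P"
    "poly u (coord_fun i) * poly g (coord_fun i) - b \<in> P"
    using algebraic_element_divides_base[OF sr sub polys_in_coord_UNIV alg g(1)] g(2) assms(4) by metis
  let ?a = "lead_coeff q"
  have aT: "?a \<in> polys_in T" using q by (auto simp: coeffs_in_def)
  show ?thesis
  \<comment> \<open>\<open>?a\<close> keeps the degree of \<open>q\<close> under specialisation, so
    that a root exists. \<open>b\<close> is a multiple of \<open>f\<close> modulo \<open>P\<close>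
    that is free of coordinate \<open>i\<close>, so where it is nonzero no choice of root can make
    \<open>f\<close> vanish.\<close>
  proof (rule that[of "?a * b"])
    show "?a * b \<in> polys_in T" using aT ub sr by (intro subringD)
    show "?a * b \<notin> P" using aT ub sub q(2) P_prime by blast
    fix x assume x: "x \<in> zeros_on T" "(?a * b) x \<noteq> 0"
    then have ax: "?a x \<noteq> 0" and bx: "b x \<noteq> 0" by auto
    have "coeff (eval_poly x q) (degree q) \<noteq> 0" using ax by (simp add: coeff_eval_poly)
    then have "degree q \<le> degree (eval_poly x q)" by (rule le_degree)
    then obtain t where t: "poly (eval_poly x q) t = 0"
      using q(3) alg_closed_imp_poly_has_root[of "eval_poly x q"] by auto
    let ?x = "upd_coord x i t"
    have z: "p ?x = 0" if p: "p \<in> P" "p \<in> polys_in (insert i T)" for p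
    proof -
      obtain r where r: "coeffs_in (polys_in T) r" "p = poly r (coord_fun i)"
        using polys_in_insertE[OF p(2)] by blast
      obtain k s r' where d: "coeffs_in (polys_in T) s" "coeffs_in (polys_in T) r'"
        "smult (?a ^ k) r = q * s + r'" "degree r' < degree q"
        using pseudo_division_in_subring[OF sr q(1,3) r(1)] by blast
      have e: "?a ^ k * p = poly q (coord_fun i) * poly s (coord_fun i) + poly r' (coord_fun i)"
        by (metis d(3) r(2) poly_add poly_mult poly_smult)
      have "poly s (coord_fun i) \<in> polys_in UNIV" "?a ^ k \<in> polys_in UNIV"
        using poly_coord_in[OF d(1), of i] polys_in_sub subring_power[OF sr aT] by blast+
      then have "poly q (coord_fun i) * poly s (coord_fun i) \<in> P" "?a ^ k * p \<in> P"
        using q(4) p(1) by (auto intro: P_mult P_mult2)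
      then have "poly r' (coord_fun i) \<in> P" 
        using P_diff[of "?a ^ k * p" "poly q (coord_fun i) * poly s (coord_fun i)"]
        by (simp only: e add_diff_cancel_left')
      then have "coeffs_in P r'" using qmin d by blast
      then have "coeff r' j x = 0" for j
        using x(1) d(2) by (simp add: zeros_on_def coeffs_in_def)
      then have "eval_poly x r' = 0" by (intro poly_eqI) (simp add: coeff_eval_poly)
      then have "poly r' (coord_fun i) ?x = 0" using poly_upd_coord[OF d(2) assms(2)] by simp
      moreover have "poly q (coord_fun i) ?x = 0" using poly_upd_coord[OF q(1) assms(2)] t by simp
      ultimately have "(?a ^ k * p) ?x = 0"
        by (simp only: e plus_fun_apply times_fun_apply mult_zero_left add_0_left)
      moreover have "?a ?x = ?a x" by (rule polys_in_upd[OF aT assms(2)])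
      moreover have "(?a ^ k) ?x = (?a ?x) ^ k" by (induction k) auto
      ultimately show ?thesis using ax by simp
    qed
    then have "?x \<in> zeros_on (insert i T)" by (simp add: zeros_on_def)
    moreover have "f ?x \<noteq> 0"
    proof
      assume "f ?x = 0"
      have "poly u (coord_fun i) * poly g (coord_fun i) - b \<in> polys_in (insert i T)"
        by (intro subringD(5,6)[OF subring_polys_in] poly_coord_in ub(1) g(1)
            subsetD[OF polys_in_mono[of T] ub(2)] subset_insertI)
      from z[OF ub(4) this] have "poly u (coord_fun i) ?x * f ?x - b ?x = 0"
        by (simp only: minus_apply times_fun_apply g(2))
      then have "b ?x = 0" using \<open>f ?x = 0\<close> by simp
      then show False using bx polys_in_upd[OF ub(2) assms(2)] by simp
    qed
    ultimately show "\<exists>t. upd_coord x i t \<in> zeros_on (insert i T) \<and> f (upd_coord x i t) \<noteq> 0"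
      by blast
  qed
qed

text \<open>This is Chevalley's theorem in the form needed: a general zero of the relations among
  \<open>T\<close> lifts to a zero with \<open>f\<close> nonzero. Coordinates are removed one at a
  time, the condition \<open>g\<close> for lifting over the last one becoming the function to be
  kept nonzero over the others.\<close>

lemma extend_zero:
  assumes "f \<in> polys_in T'" "f \<notin> P" "T \<subseteq> T'"
  obtains h where "h \<in> polys_in T" "h \<notin> P"
    "\<And>x. x \<in> zeros_on T \<Longrightarrow> h x \<noteq> 0 \<Longrightarrow>
       \<exists>x'\<in>zeros_on T'. (\<forall>j\<in>T. x' $ j = x $ j) \<and> f x' \<noteq> 0"
proof -
  have "\<exists>h\<in>polys_in T - P. \<forall>x\<in>zeros_on T. h x \<noteq> 0 \<longrightarrow>
      (\<exists>x'\<in>zeros_on (T \<union> D). (\<forall>j\<in>T. x' $ j = x $ j) \<and> f x' \<noteq> 0)"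
    if "finite D" "f \<in> polys_in (T \<union> D)" "f \<notin> P" for D f
    using that
  proof (induction D arbitrary: f rule: finite_induct)
    case empty
    then show ?case by auto
  next
    case (insert i D)
    show ?case
    proof (cases "i \<in> T")
      case True
      then have "T \<union> insert i D = T \<union> D" by auto
      then show ?thesis using insert by simp
    next
      case False
      have f: "f \<in> polys_in (insert i (T \<union> D))" and i: "i \<notin> T \<union> D"
        using insert False by auto
      obtain g where g: "g \<in> polys_in (T \<union> D)" "g \<notin> P" "\<And>x. x \<in> zeros_on (T \<union> D) \<Longrightarrow> g x \<noteq> 0 \<Longrightarrow>
        \<exists>t. upd_coord x i t \<in> zeros_on (insert i (T \<union> D)) \<and> f (upd_coord x i t) \<noteq> 0"
      proof (cases "alg (T \<union> D) i")
        case True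
        from extend_zero_algebraic[OF this i f insert.prems(2)] that show ?thesis by blast
      next
        case False
        show ?thesis
          by (rule extend_zero_transcendental[OF False i f insert.prems(2)], rule that) blast+
      qed
      obtain h where h: "h \<in> polys_in T - P" "\<forall>x\<in>zeros_on T. h x \<noteq> 0 \<longrightarrow>
        (\<exists>x'\<in>zeros_on (T \<union> D). (\<forall>j\<in>T. x' $ j = x $ j) \<and> g x' \<noteq> 0)"
        using insert.IH[OF g(1,2)] by blast
      have "\<exists>x'\<in>zeros_on (T \<union> insert i D). (\<forall>j\<in>T. x' $ j = x $ j) \<and> f x' \<noteq> 0"
        if x: "x \<in> zeros_on T" "h x \<noteq> 0" for x
      proof -
        obtain y where y: "y \<in> zeros_on (T \<union> D)" "\<forall>j\<in>T. y $ j = x $ j" "g y \<noteq> 0"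
          using h(2) x by blast
        obtain t where t: "upd_coord y i t \<in> zeros_on (insert i (T \<union> D))" "f (upd_coord y i t) \<noteq> 0"
          using g(3) y by blast
        moreover have "\<forall>j\<in>T. upd_coord y i t $ j = x $ j" using y(2) False by auto
        moreover have "T \<union> insert i D = insert i (T \<union> D)" by simp
        ultimately show ?thesis by (intro bexI[of _ "upd_coord y i t"]) simp_all
      qed
      then have "\<forall>x\<in>zeros_on T. h x \<noteq> 0 \<longrightarrow>
          (\<exists>x'\<in>zeros_on (T \<union> insert i D). (\<forall>j\<in>T. x' $ j = x $ j) \<and> f x' \<noteq> 0)"
        by simp
      then show ?thesis using h(1) by (rule bexI)
    qed
  qed
  from this[of T' f] assms have "\<exists>h\<in>polys_in T - P. \<forall>x\<in>zeros_on T. h x \<noteq> 0 \<longrightarrow>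
      (\<exists>x'\<in>zeros_on T'. (\<forall>j\<in>T. x' $ j = x $ j) \<and> f x' \<noteq> 0)"
    by (simp add: Un_absorb1)
  then obtain h where h: "h \<in> polys_in T - P" and ext: "\<forall>x\<in>zeros_on T. h x \<noteq> 0 \<longrightarrow>
      (\<exists>x'\<in>zeros_on T'. (\<forall>j\<in>T. x' $ j = x $ j) \<and> f x' \<noteq> 0)"
    by (rule bexE)
  show ?thesis
  proof (rule that)
    show "h \<in> polys_in T" "h \<notin> P" using h by simp_all
    show "\<exists>x'\<in>zeros_on T'. (\<forall>j\<in>T. x' $ j = x $ j) \<and> f x' \<noteq> 0" if "x \<in> zeros_on T" "h x \<noteq> 0" for x
      using ext that by simp
  qed
qed

text \<open>Extension from no coordinates at all: there every point is a zero, and the condition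
  \<open>h\<close> is a nonzero constant.\<close>

theorem nullstellensatz:
  assumes "f \<in> polys_in UNIV" "f \<notin> P"
  shows "\<exists>x\<in>zeros_on UNIV. f x \<noteq> 0"
proof -
  obtain h where h: "h \<in> polys_in {}" "h \<notin> P"
    "\<And>x. x \<in> zeros_on {} \<Longrightarrow> h x \<noteq> 0 \<Longrightarrow> \<exists>x'\<in>zeros_on UNIV. (\<forall>j\<in>{}. x' $ j = x $ j) \<and> f x' \<noteq> 0"
    using extend_zero[OF assms, of "{}"] by blast
  from h(2) have "h \<noteq> 0" using P_zero by auto
  then obtain x where "h x \<noteq> 0" by (auto simp: fun_eq_iff)
  then show ?thesis using h(3)[of x] by (auto simp: zeros_on_empty)
qed

lemma vanishing_on_zeros: "{f \<in> polys_in UNIV. \<forall>x\<in>zeros_on UNIV. f x = 0} = P"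
  using nullstellensatz P_sub by (auto simp: zeros_on_UNIV)

text \<open>The condition \<open>f\<close> is first pushed down to the coordinates in
  \<open>insert i T\<close>; only then is coordinate \<open>i\<close> chosen, large and outside a
  finite set, and the remaining coordinates follow. The resulting unboundedness is what contradicts
  finiteness later.\<close>

lemma unbounded_extension:
  assumes "\<not> alg T i" "i \<notin> T" "f \<in> polys_in UNIV" "f \<notin> P"
  obtains h where "h \<in> polys_in T" "h \<notin> P"
    "\<And>x M. x \<in> zeros_on T \<Longrightarrow> h x \<noteq> 0 \<Longrightarrow>
       \<exists>x'\<in>zeros_on UNIV. (\<forall>j\<in>T. x' $ j = x $ j) \<and> f x' \<noteq> 0 \<and> norm (x' $ i) > M"
proof -
  obtain g where g: "g \<in> polys_in (insert i T)" "g \<notin> P"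
    "\<And>x. x \<in> zeros_on (insert i T) \<Longrightarrow> g x \<noteq> 0 \<Longrightarrow>
       \<exists>x'\<in>zeros_on UNIV. (\<forall>j\<in>insert i T. x' $ j = x $ j) \<and> f x' \<noteq> 0"
    using extend_zero[OF assms(3,4), of "insert i T"] by blast
  obtain h where h: "h \<in> polys_in T" "h \<notin> P"
    "\<And>x M. x \<in> zeros_on T \<Longrightarrow> h x \<noteq> 0 \<Longrightarrow>
       \<exists>t. upd_coord x i t \<in> zeros_on (insert i T) \<and> g (upd_coord x i t) \<noteq> 0 \<and> norm t > M"
    by (rule extend_zero_transcendental[OF assms(1,2) g(1,2)], rule that) blast+
  show ?thesis
  proof (rule that[OF h(1,2)])
    fix x M assume "x \<in> zeros_on T" "h x \<noteq> 0"
    from h(3)[OF this, of M] obtain t where t: "upd_coord x i t \<in> zeros_on (insert i T)"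
      "g (upd_coord x i t) \<noteq> 0" "norm t > M" by blast
    from g(3)[OF t(1,2)] obtain x' where x': "x'\<in>zeros_on UNIV"
      "\<forall>j\<in>insert i T. x' $ j = upd_coord x i t $ j" "f x' \<noteq> 0" by blast
    have "\<forall>j\<in>T. x' $ j = x $ j" "x' $ i = t" using x'(2) assms(2) by auto
    then show "\<exists>x'\<in>zeros_on UNIV. (\<forall>j\<in>T. x' $ j = x $ j) \<and> f x' \<noteq> 0 \<and> norm (x' $ i) > M"
      using x' t(3) by blast
  qed
qed

end

section \<open>Directional derivatives\<close>

definition dir_deriv :: "complex^'m \<Rightarrow> complex^'m \<Rightarrow> (complex^'m \<Rightarrow> complex) \<Rightarrow> complex" where
  "dir_deriv x v f = deriv (\<lambda>t. f (x + t *s v)) 0"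

lemma has_dir_deriv:
  assumes "f \<in> polys_in UNIV"
  shows "((\<lambda>t. f (x + t *s v)) has_field_derivative dir_deriv x v f) (at 0)"
proof -
  obtain p where "\<forall>t. f (x + t *s v) = poly p t" using poly_along_line[OF assms] by blast
  then have "(\<lambda>t. f (x + t *s v)) = poly p" by auto
  then show ?thesis
    unfolding dir_deriv_def by (metis poly_DERIV DERIV_deriv_iff_real_differentiable DERIV_imp_deriv)
qed

lemma dir_derivI:
  assumes "((\<lambda>t. f (x + t *s v)) has_field_derivative D) (at 0)"
  shows "dir_deriv x v f = D"
  using assms unfolding dir_deriv_def by (rule DERIV_imp_deriv)

lemma dir_deriv_const [simp]: "dir_deriv x v (\<lambda>_. c) = 0"
  by (rule dir_derivI) simp

lemma dir_deriv_zero [simp]: "dir_deriv x v 0 = 0"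
  unfolding zero_fun_def by simp

lemma dir_deriv_coord [simp]: "dir_deriv x v (coord_fun i) = v $ i"
proof (rule dir_derivI)
  have "((\<lambda>t. x $ i + t * v $ i) has_field_derivative v $ i) (at 0)"
    by (auto intro!: derivative_eq_intros)
  then show "((\<lambda>t. (x + t *s v) $ i) has_field_derivative v $ i) (at 0)" by simp
qed

lemma dir_deriv_add:
  assumes "f \<in> polys_in UNIV" "g \<in> polys_in UNIV"
  shows "dir_deriv x v (f + g) = dir_deriv x v f + dir_deriv x v g"
  using DERIV_add[OF has_dir_deriv[OF assms(1), of x v] has_dir_deriv[OF assms(2), of x v]]
  by (intro dir_derivI) simp

lemma dir_deriv_mult:
  assumes "f \<in> polys_in UNIV" "g \<in> polys_in UNIV"
  shows "dir_deriv x v (f * g) = f x * dir_deriv x v g + g x * dir_deriv x v f"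
  using DERIV_mult[OF has_dir_deriv[OF assms(1), of x v] has_dir_deriv[OF assms(2), of x v]]
  by (intro dir_derivI) (simp add: algebra_simps)

definition grad :: "(complex^'m \<Rightarrow> complex) \<Rightarrow> complex^'m \<Rightarrow> complex^'m" where
  "grad f x = (\<chi> i. dir_deriv x (axis i 1) f)"

lemma grad_nth: "grad f x $ i = dir_deriv x (axis i 1) f"
  by (simp add: grad_def)

lemma polys_in_add: "f \<in> polys_in T \<Longrightarrow> g \<in> polys_in T \<Longrightarrow> f + g \<in> polys_in T"
  and polys_in_mult: "f \<in> polys_in T \<Longrightarrow> g \<in> polys_in T \<Longrightarrow> f * g \<in> polys_in T"
  using subringD[OF subring_polys_in] by blast+

lemma dir_deriv_eq_grad:
  "f \<in> polys_in UNIV \<Longrightarrow> dir_deriv x v f = (\<Sum>i\<in>UNIV. v $ i * grad f x $ i)"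
proof (induction rule: polys_in_induct)
  case (coord i)
  have "(\<Sum>j\<in>UNIV. v $ j * grad (coord_fun i) x $ j) = (\<Sum>j\<in>UNIV. if j = i then v $ j else 0)"
    by (intro sum.cong) (auto simp: grad_nth axis_def)
  then show ?case by simp
next
  case (add f g)
  then show ?case
    by (simp only: grad_nth dir_deriv_add) (simp add: algebra_simps sum.distrib)
next
  case (mult f g)
  then show ?case
    by (simp only: grad_nth dir_deriv_mult)
      (simp add: algebra_simps sum.distrib sum_distrib_left)
qed (simp add: grad_nth)

lemma grad_polys_in: "f \<in> polys_in UNIV \<Longrightarrow> (\<lambda>x. grad f x $ i) \<in> polys_in UNIV"
proof (induction rule: polys_in_induct)
  case (add f g)
  then have "(\<lambda>x. grad (f + g) x $ i) = (\<lambda>x. grad f x $ i) + (\<lambda>x. grad g x $ i)"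
    by (intro ext) (simp only: grad_nth dir_deriv_add plus_fun_apply)
  then show ?case using add by (simp only: polys_in_add)
next
  case (mult f g)
  then have "(\<lambda>x. grad (f * g) x $ i) = f * (\<lambda>x. grad g x $ i) + g * (\<lambda>x. grad f x $ i)"
    by (intro ext) (simp only: grad_nth dir_deriv_mult plus_fun_apply times_fun_apply)
  then show ?case using mult by (simp only: polys_in_add polys_in_mult)
qed (simp_all add: grad_nth)

lemma dir_deriv_vec_add:
  "f \<in> polys_in UNIV \<Longrightarrow> dir_deriv x (v + w) f = dir_deriv x v f + dir_deriv x w f"
  by (simp add: dir_deriv_eq_grad algebra_simps sum.distrib)

lemma dir_deriv_vec_scale:
  "f \<in> polys_in UNIV \<Longrightarrow> dir_deriv x (c *s v) f = c * dir_deriv x v f"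
  by (simp add: dir_deriv_eq_grad algebra_simps sum_distrib_left)

lemma dir_deriv_vec_zero: "f \<in> polys_in UNIV \<Longrightarrow> dir_deriv x 0 f = 0"
  by (simp add: dir_deriv_eq_grad)

lemma dir_deriv_cong:
  assumes "f \<in> polys_in T" "\<And>i. i \<in> T \<Longrightarrow> v $ i = w $ i"
  shows "dir_deriv x v f = dir_deriv x w f"
  using assms(1)
proof (induction rule: polys_in_induct)
  case (add f g)
  then have "f \<in> polys_in UNIV" "g \<in> polys_in UNIV" using polys_in_mono[of T UNIV] by auto
  then show ?case using add by (simp only: dir_deriv_add)
next
  case (mult f g)
  then have "f \<in> polys_in UNIV" "g \<in> polys_in UNIV" using polys_in_mono[of T UNIV] by auto
  then show ?case using mult by (simp only: dir_deriv_mult)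
qed (use assms in auto)

text \<open>The product rule along the Horner form: one summand differentiates the coefficients, the
  other the inserted function.\<close>

lemma dir_deriv_poly:
  assumes "coeffs_in (polys_in UNIV) q" "f \<in> polys_in UNIV"
  shows "dir_deriv x v (poly q f) =
    poly (map_poly (dir_deriv x v) q) (f x) + poly (pderiv (eval_poly x q)) (f x) * dir_deriv x v f"
  using assms(1)
proof (induction q)
  case (pCons a q)
  then have a: "a \<in> polys_in UNIV" and q: "coeffs_in (polys_in UNIV) q"
    by (auto simp: coeffs_in_pCons)
  have "poly q f \<in> polys_in UNIV"
    by (rule poly_in_subring[OF subring_polys_in q assms(2)])
  then have "dir_deriv x v (poly (pCons a q) f) =
      dir_deriv x v a + (f x * dir_deriv x v (poly q f) + poly q f x * dir_deriv x v f)"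
    using a assms(2) by (simp only: poly_pCons dir_deriv_add dir_deriv_mult polys_in_mult)
  then show ?case
    using pCons.IH[OF q]
    by (simp only: poly_fun_apply map_poly_pCons dir_deriv_zero eval_poly_pCons pderiv_pCons
        poly_pCons poly_add) (simp add: algebra_simps)
qed (simp add: eval_poly_def)

text \<open>A relation whose coefficients already vanish to first order at \<open>x\<close> along
  \<open>v\<close> puts no condition on the new component of \<open>v\<close>.\<close>

lemma dir_deriv_poly_eq_0:
  assumes "coeffs_in (polys_in UNIV) q" "f \<in> polys_in UNIV"
    and "\<And>k. coeff q k x = 0" "\<And>k. dir_deriv x v (coeff q k) = 0"
  shows "dir_deriv x v (poly q f) = 0"
proof -
  have "eval_poly x q = 0" by (intro poly_eqI) (simp add: coeff_eval_poly assms(3))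
  moreover have "map_poly (dir_deriv x v) q = 0"
    by (intro poly_eqI) (simp add: coeff_map_poly assms(4))
  ultimately show ?thesis using dir_deriv_poly[OF assms(1,2), of x v] by simp
qed


section \<open>Transcendence degree as generic dimension of the tangent space\<close>

text \<open>Attached to a set of functions rather than to a variety, because the induction along a
  tower needs it for \<open>P \<inter> polys_in U\<close>.\<close>

definition tangent_at :: "(complex^'m \<Rightarrow> complex) set \<Rightarrow> complex^'m \<Rightarrow> (complex^'m) set" where
  "tangent_at P x = {v. \<forall>f\<in>P. dir_deriv x v f = 0}"

lemma subspace_tangent_at: "P \<subseteq> polys_in UNIV \<Longrightarrow> vec.subspace (tangent_at P x)"
  unfolding vec.subspace_def tangent_at_def
  by (auto simp: dir_deriv_vec_add dir_deriv_vec_scale dir_deriv_vec_zero subset_iff)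

lemma elimination_identity: "a * (c * e - b) + (a * b - h) = (a * c) * e - (h :: 'r::comm_ring_1)"
  by (simp add: algebra_simps)

context polynomial_prime
begin

text \<open>In \<open>tower U B\<close> the coordinates in \<open>U\<close> have been adjoined, and \<open>B\<close> consists of those that
  were transcendental over their predecessors.\<close>

inductive tower :: "'m set \<Rightarrow> 'm set \<Rightarrow> bool" where
  empty: "tower {} {}"
| alg: "tower U B \<Longrightarrow> i \<notin> U \<Longrightarrow> alg U i \<Longrightarrow> tower (insert i U) B"
| trans: "tower U B \<Longrightarrow> i \<notin> U \<Longrightarrow> \<not> alg U i \<Longrightarrow> tower (insert i U) (insert i B)"

lemma tower_subset: "tower U B \<Longrightarrow> B \<subseteq> U"
  by (induction rule: tower.induct) auto

lemma zeros_on_mono: "T \<subseteq> T' \<Longrightarrow> zeros_on T' \<subseteq> zeros_on T"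
  unfolding zeros_on_def using polys_in_mono[of T T'] by blast

text \<open>The formal derivative of a minimal relation has smaller degree, and its top coefficient
  is a nonzero integer times the leading coefficient of \<open>q\<close>, hence outside
  \<open>P\<close> in characteristic zero. By minimality its value \<open>D\<close> at the
  coordinate is outside \<open>P\<close>.\<close>

lemma separating_relation:
  assumes "alg T i" "i \<notin> T"
  obtains q D where "coeffs_in (polys_in T) q" "lead_coeff q \<notin> P" "degree q \<noteq> 0"
    "poly q (coord_fun i) \<in> P"
    "\<And>r. coeffs_in (polys_in T) r \<Longrightarrow> degree r < degree q \<Longrightarrow> poly r (coord_fun i) \<in> P \<Longrightarrow> coeffs_in P r"
    "D \<in> polys_in UNIV" "D \<notin> P" "\<And>x. D x = poly (pderiv (eval_poly x q)) (x $ i)"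
proof -
  note sr = subring_polys_in[of T] and sub = polys_in_sub[of T]
  have alg: "algebraic_over (polys_in T) (coord_fun i)" using assms(1) by (simp add: alg_def)
  obtain q where q: "coeffs_in (polys_in T) q" "lead_coeff q \<notin> P" "degree q \<noteq> 0"
      "poly q (coord_fun i) \<in> P"
    and qmin: "\<And>r. coeffs_in (polys_in T) r \<Longrightarrow> degree r < degree q \<Longrightarrow> poly r (coord_fun i) \<in> P \<Longrightarrow> coeffs_in P r"
    by (rule exists_minimal_relation[OF sr sub polys_in_coord_UNIV alg], rule that) blast+
  define dq where "dq = (\<Sum>k<degree q. monom (\<lambda>x. of_nat (Suc k) * coeff q (Suc k) x) k)"
  have cdq: "coeff dq k = (\<lambda>x. of_nat (Suc k) * coeff q (Suc k) x)" for k
  proof (cases "k < degree q")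
    case True
    then show ?thesis by (simp add: dq_def coeff_sum)
  next
    case False
    then have "coeff q (Suc k) = 0" by (intro coeff_eq_0) simp
    then show ?thesis using False by (auto simp add: dq_def coeff_sum fun_eq_iff intro: sum.neutral)
  qed
  have deg: "degree dq < degree q"
  proof -
    have "degree dq \<le> degree q - 1" unfolding dq_def
      by (intro degree_sum_le) (auto intro: order_trans[OF degree_monom_le])
    then show ?thesis using q(3) by simp
  qed
  have cT: "coeffs_in (polys_in T) dq"
    unfolding coeffs_in_def cdq
  proof
    fix k
    have "(\<lambda>_. of_nat (Suc k)) * coeff q (Suc k) \<in> polys_in T"
      using q(1) by (intro polys_in_mult) (auto simp: coeffs_in_def)
    then show "(\<lambda>x. of_nat (Suc k) * coeff q (Suc k) x) \<in> polys_in T"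
      by (simp only: times_fun_def)
  qed
  have notP: "poly dq (coord_fun i) \<notin> P"
  proof
    assume "poly dq (coord_fun i) \<in> P"
    then have "coeffs_in P dq" using qmin[OF cT deg] by simp
    then have "coeff dq (degree q - 1) \<in> P" by (simp add: coeffs_in_def)
    then have "(\<lambda>_. 1 / of_nat (degree q)) * coeff dq (degree q - 1) \<in> P"
      by (intro P_mult) auto
    moreover have "(\<lambda>_. 1 / of_nat (degree q)) * coeff dq (degree q - 1) = lead_coeff q"
      using q(3) by (auto simp: cdq fun_eq_iff)
    ultimately show False using q(2) by simp
  qed
  have ev: "eval_poly x dq = pderiv (eval_poly x q)" for x
    by (intro poly_eqI) (simp add: coeff_eval_poly coeff_pderiv cdq)
  show ?thesis
  proof (rule that[OF q qmin _ notP])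
    show "poly dq (coord_fun i) \<in> polys_in UNIV"
      using poly_coord_in[OF cT, of i] polys_in_sub by blast
    show "poly dq (coord_fun i) x = poly (pderiv (eval_poly x q)) (x $ i)" for x
      by (simp only: poly_fun_apply ev)
  qed
qed

text \<open>At a general zero, a tangent vector can be prescribed arbitrarily on \<open>B\<close>, and its remaining
  components are then determined by differentiating the minimal relations.\<close>

lemma tower_tangent:
  "tower U B \<Longrightarrow> \<exists>g\<in>polys_in UNIV - P. \<forall>x\<in>zeros_on U. g x \<noteq> 0 \<longrightarrow>
    (\<forall>w. \<exists>v\<in>tangent_at (P \<inter> polys_in U) x. \<forall>i\<in>B. v $ i = w $ i) \<and>
    (\<forall>v\<in>tangent_at (P \<inter> polys_in U) x. (\<forall>i\<in>B. v $ i = 0) \<longrightarrow> (\<forall>i\<in>U. v $ i = 0))"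
proof (induction rule: tower.induct)
  case empty
  have "dir_deriv x 0 f = 0" if "f \<in> P" for f x using that P_sub dir_deriv_vec_zero by blast
  then have "0 \<in> tangent_at (P \<inter> polys_in {}) x" for x by (simp add: tangent_at_def)
  then show ?case
    using P_one subringD(1)[OF subring_polys_in] by (intro bexI[of _ 1]) auto
next
  case (alg U B i)
  obtain q D where q: "coeffs_in (polys_in U) q" "lead_coeff q \<notin> P" "degree q \<noteq> 0"
    "poly q (coord_fun i) \<in> P"
    and qmin: "\<And>r. coeffs_in (polys_in U) r \<Longrightarrow> degree r < degree q \<Longrightarrow> poly r (coord_fun i) \<in> P \<Longrightarrow> coeffs_in P r"
    and D: "D \<in> polys_in UNIV" "D \<notin> P" "\<And>x. D x = poly (pderiv (eval_poly x q)) (x $ i)"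
    by (rule separating_relation[OF alg(3,2)], rule that) blast+
  obtain g where g: "g \<in> polys_in UNIV - P" and IH: "\<forall>x\<in>zeros_on U. g x \<noteq> 0 \<longrightarrow>
    (\<forall>w. \<exists>v\<in>tangent_at (P \<inter> polys_in U) x. \<forall>i\<in>B. v $ i = w $ i) \<and>
    (\<forall>v\<in>tangent_at (P \<inter> polys_in U) x. (\<forall>i\<in>B. v $ i = 0) \<longrightarrow> (\<forall>i\<in>U. v $ i = 0))"
    using alg.IH by (rule bexE)
  let ?a = "lead_coeff q" and ?U = "insert i U"
  have subU: "polys_in U \<subseteq> polys_in ?U" by (intro polys_in_mono) auto
  have aU: "?a \<in> polys_in U" using q(1) by (auto simp: coeffs_in_def)
  have qR: "coeffs_in (polys_in UNIV) q" using q(1) polys_in_sub by (rule coeffs_in_mono)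
  \<comment> \<open>Besides the condition \<open>g\<close> on the smaller tower, \<open>?a\<close>
    must be invertible to divide by \<open>q\<close>, and \<open>D\<close> to solve the
    differentiated relation for component \<open>i\<close>.\<close>
  define g' where "g' = g * (?a * D)"
  have "?a * D \<in> polys_in UNIV" "?a * D \<notin> P"
    using aU polys_in_sub D q(2) P_prime[of ?a D] polys_in_mult[of ?a UNIV D] by auto
  then have g': "g' \<in> polys_in UNIV - P"
    using g P_prime[of g "?a * D"] by (auto simp: g'_def polys_in_mult)
  have key: "(\<forall>w. \<exists>v\<in>tangent_at (P \<inter> polys_in ?U) x. \<forall>i\<in>B. v $ i = w $ i) \<and>
    (\<forall>v\<in>tangent_at (P \<inter> polys_in ?U) x. (\<forall>i\<in>B. v $ i = 0) \<longrightarrow> (\<forall>i\<in>?U. v $ i = 0))"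
    if x: "x \<in> zeros_on ?U" "g' x \<noteq> 0" for x
  proof -
    have xU: "x \<in> zeros_on U" using x(1) zeros_on_mono[of U ?U] by blast
    have nz: "g x \<noteq> 0" "?a x \<noteq> 0" "D x \<noteq> 0" using x(2) by (auto simp: g'_def)
    have ddq: "dir_deriv x v (poly q (coord_fun i)) =
        poly (map_poly (dir_deriv x v) q) (x $ i) + D x * v $ i" for v
      by (simp only: dir_deriv_poly[OF qR polys_in_coord_UNIV] D(3) dir_deriv_coord)
    have qx: "poly q (coord_fun i) x = 0"
      using x(1) q(1,4) poly_coord_in by (auto simp: zeros_on_def)
    have ex: "\<exists>v\<in>tangent_at (P \<inter> polys_in ?U) x. \<forall>i\<in>B. v $ i = w $ i" for w
    proof -
      obtain v where v: "v \<in> tangent_at (P \<inter> polys_in U) x" "\<forall>i\<in>B. v $ i = w $ i"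
        using IH xU nz(1) by blast
      \<comment> \<open>The only value of component \<open>i\<close> at which the derivative of
        \<open>q\<close> along the extended vector is zero.\<close>
      define s where "s = - poly (map_poly (dir_deriv x v) q) (x $ i) / D x"
      let ?v = "upd_coord v i s"
      have same: "dir_deriv x ?v f = dir_deriv x v f" if "f \<in> polys_in U" for f
        using that alg(2) by (intro dir_deriv_cong[of f U]) auto
      have "map_poly (dir_deriv x ?v) q = map_poly (dir_deriv x v) q"
        using q(1) by (intro poly_eqI) (simp add: coeff_map_poly same coeffs_in_def)
      then have dq0: "dir_deriv x ?v (poly q (coord_fun i)) = 0"
        using nz(3) by (simp only: ddq) (simp add: s_def)
      have "dir_deriv x ?v f = 0" if f: "f \<in> P" "f \<in> polys_in ?U" for f
      proof -
        obtain r where r: "coeffs_in (polys_in U) r" "f = poly r (coord_fun i)"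
          using polys_in_insertE[OF f(2)] by blast
        \<comment> \<open>A power of \<open>?a\<close> times \<open>f\<close> is a multiple of
          \<open>q\<close> plus a remainder with coefficients in \<open>P\<close>. Along
          \<open>?v\<close> the first has derivative zero because \<open>q\<close> vanishes at
          \<open>x\<close> to first order, the second because its coefficients do.\<close>
        obtain k t r' where d: "coeffs_in (polys_in U) t" "coeffs_in (polys_in U) r'"
          "smult (?a ^ k) r = q * t + r'" "degree r' < degree q"
          using pseudo_division_in_subring[OF subring_polys_in q(1,3) r(1)] by blast
        let ?Q = "poly q (coord_fun i)" and ?T = "poly t (coord_fun i)" and ?R = "poly r' (coord_fun i)"
        have e: "?a ^ k * f = ?Q * ?T + ?R"
          by (metis d(3) r(2) poly_add poly_mult poly_smult)
        have fR: "f \<in> polys_in UNIV" using f P_sub by blast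
        have akR: "?a ^ k \<in> polys_in UNIV" using aU polys_in_sub subring_power[OF subring_polys_in] by blast
        have QR: "?Q \<in> polys_in UNIV" "?T \<in> polys_in UNIV" "?R \<in> polys_in UNIV"
          using poly_coord_in[OF q(1), of i] poly_coord_in[OF d(1), of i] poly_coord_in[OF d(2), of i]
            polys_in_sub by blast+
        have "?a ^ k * f \<in> P" "?Q * ?T \<in> P"
          using q(4) f(1) akR QR by (auto intro: P_mult P_mult2)
        then have "?R \<in> P"
          using P_diff[of "?a ^ k * f" "?Q * ?T"] by (simp only: e add_diff_cancel_left')
        then have r'P: "coeffs_in P r'" using qmin d(2,4) by blast
        have r'0: "coeff r' j x = 0" "dir_deriv x ?v (coeff r' j) = 0" for j
        proof -
          have "coeff r' j \<in> P \<inter> polys_in U" using r'P d(2) by (auto simp: coeffs_in_def)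
          then show "coeff r' j x = 0" "dir_deriv x ?v (coeff r' j) = 0"
            using xU v(1) same[of "coeff r' j"] by (auto simp: zeros_on_def tangent_at_def)
        qed
        have "dir_deriv x ?v ?R = 0"
          using d(2) polys_in_sub r'0 by (intro dir_deriv_poly_eq_0) (auto intro: coeffs_in_mono)
        moreover have "dir_deriv x ?v (?Q * ?T) = 0"
          using dq0 qx by (simp only: dir_deriv_mult[OF QR(1,2)]) simp
        ultimately have "dir_deriv x ?v (?a ^ k * f) = 0"
          by (simp only: e dir_deriv_add[OF polys_in_mult[OF QR(1,2)] QR(3)] add_0_left)
        moreover have "f x = 0" using x(1) f by (auto simp: zeros_on_def)
        moreover have "(?a ^ k) x = (?a x) ^ k" by (induction k) auto
        ultimately show ?thesis
          using nz(2) by (simp add: dir_deriv_mult[OF akR fR])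
      qed
      then have "?v \<in> tangent_at (P \<inter> polys_in ?U) x" by (simp add: tangent_at_def)
      moreover have "\<forall>j\<in>B. ?v $ j = w $ j" using v(2) alg(2) tower_subset[OF alg(1)] by auto
      ultimately show ?thesis by blast
    qed
    have uniq: "v $ j = 0" if v: "v \<in> tangent_at (P \<inter> polys_in ?U) x" "\<forall>i\<in>B. v $ i = 0"
      and j: "j \<in> ?U" for v j
    proof -
      have "v \<in> tangent_at (P \<inter> polys_in U) x" using v(1) subU by (auto simp: tangent_at_def)
      then have vU: "\<forall>i\<in>U. v $ i = 0" using IH xU nz(1) v(2) by blast
      have "dir_deriv x v (coeff q k) = 0" for k
      proof -
        have "coeff q k \<in> polys_in U" using q(1) by (simp add: coeffs_in_def)
        then have "dir_deriv x v (coeff q k) = dir_deriv x 0 (coeff q k)"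
          using vU by (intro dir_deriv_cong) auto
        then show ?thesis using qR by (simp add: dir_deriv_vec_zero coeffs_in_def)
      qed
      then have "map_poly (dir_deriv x v) q = 0" by (intro poly_eqI) (simp add: coeff_map_poly)
      moreover have "dir_deriv x v (poly q (coord_fun i)) = 0"
        using v(1) q(4) poly_coord_in[OF q(1), of i] by (simp add: tangent_at_def)
      ultimately have "v $ i = 0" using ddq[of v] nz(3) by simp
      then show ?thesis using vU j by auto
    qed
    show ?thesis
      by (intro conjI allI ballI impI) (rule ex, rule uniq)
  qed
  then have "\<forall>x\<in>zeros_on ?U. g' x \<noteq> 0 \<longrightarrow>
    (\<forall>w. \<exists>v\<in>tangent_at (P \<inter> polys_in ?U) x. \<forall>i\<in>B. v $ i = w $ i) \<and>
    (\<forall>v\<in>tangent_at (P \<inter> polys_in ?U) x. (\<forall>i\<in>B. v $ i = 0) \<longrightarrow> (\<forall>i\<in>?U. v $ i = 0))"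
    by (intro ballI impI)
  then show ?case using g' by (rule bexI)
next
  case (trans U B i)
  obtain g where g: "g \<in> polys_in UNIV - P" and IH: "\<forall>x\<in>zeros_on U. g x \<noteq> 0 \<longrightarrow>
    (\<forall>w. \<exists>v\<in>tangent_at (P \<inter> polys_in U) x. \<forall>i\<in>B. v $ i = w $ i) \<and>
    (\<forall>v\<in>tangent_at (P \<inter> polys_in U) x. (\<forall>i\<in>B. v $ i = 0) \<longrightarrow> (\<forall>i\<in>U. v $ i = 0))"
    using trans.IH by (rule bexE)
  let ?U = "insert i U" and ?B = "insert i B"
  have subU: "polys_in U \<subseteq> polys_in ?U" by (intro polys_in_mono) auto
  have key: "(\<forall>w. \<exists>v\<in>tangent_at (P \<inter> polys_in ?U) x. \<forall>i\<in>?B. v $ i = w $ i) \<and>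
    (\<forall>v\<in>tangent_at (P \<inter> polys_in ?U) x. (\<forall>i\<in>?B. v $ i = 0) \<longrightarrow> (\<forall>i\<in>?U. v $ i = 0))"
    if x: "x \<in> zeros_on ?U" "g x \<noteq> 0" for x
  proof -
    have xU: "x \<in> zeros_on U" using x(1) zeros_on_mono[of U ?U] by blast
    have ex: "\<exists>v\<in>tangent_at (P \<inter> polys_in ?U) x. \<forall>i\<in>?B. v $ i = w $ i" for w
    proof -
      obtain v where v: "v \<in> tangent_at (P \<inter> polys_in U) x" "\<forall>i\<in>B. v $ i = w $ i"
        using IH xU x(2) by blast
      let ?v = "upd_coord v i (w $ i)"
      have same: "dir_deriv x ?v f = dir_deriv x v f" if "f \<in> polys_in U" for f
        using that trans(2) by (intro dir_deriv_cong[of f U]) auto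
      have "dir_deriv x ?v f = 0" if f: "f \<in> P" "f \<in> polys_in ?U" for f
      proof -
        obtain r where r: "coeffs_in (polys_in U) r" "f = poly r (coord_fun i)"
          using polys_in_insertE[OF f(2)] by blast
        then have rP: "coeffs_in P r"
          using trans(3) f(1) by (auto simp: alg_def algebraic_over_def)
        have r0: "coeff r j x = 0" "dir_deriv x ?v (coeff r j) = 0" for j
        proof -
          have "coeff r j \<in> P \<inter> polys_in U" using rP r(1) by (auto simp: coeffs_in_def)
          then show "coeff r j x = 0" "dir_deriv x ?v (coeff r j) = 0"
            using xU v(1) same[of "coeff r j"] by (auto simp: zeros_on_def tangent_at_def)
        qed
        show ?thesis unfolding r(2)
          using r(1) polys_in_sub r0 by (intro dir_deriv_poly_eq_0) (auto intro: coeffs_in_mono)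
      qed
      then have "?v \<in> tangent_at (P \<inter> polys_in ?U) x" by (simp add: tangent_at_def)
      moreover have "\<forall>j\<in>?B. ?v $ j = w $ j" using v(2) trans(2) tower_subset[OF trans(1)] by auto
      ultimately show ?thesis by blast
    qed
    have uniq: "v $ j = 0" if v: "v \<in> tangent_at (P \<inter> polys_in ?U) x" "\<forall>i\<in>?B. v $ i = 0"
      and j: "j \<in> ?U" for v j
    proof -
      have "v \<in> tangent_at (P \<inter> polys_in U) x" using v(1) subU by (auto simp: tangent_at_def)
      then have "\<forall>i\<in>U. v $ i = 0" using IH xU x(2) v(2) by blast
      then show ?thesis using v(2) j by auto
    qed
    show ?thesis
      by (intro conjI allI ballI impI) (rule ex, rule uniq)
  qed
  then have "\<forall>x\<in>zeros_on ?U. g x \<noteq> 0 \<longrightarrow>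
    (\<forall>w. \<exists>v\<in>tangent_at (P \<inter> polys_in ?U) x. \<forall>i\<in>?B. v $ i = w $ i) \<and>
    (\<forall>v\<in>tangent_at (P \<inter> polys_in ?U) x. (\<forall>i\<in>?B. v $ i = 0) \<longrightarrow> (\<forall>i\<in>?U. v $ i = 0))"
    by (intro ballI impI)
  then show ?case using g by (rule bexI)
qed

text \<open>Algebraicity persists over larger sets of coordinates, so when everything outside
  \<open>U\<close> is algebraic over \<open>U\<close>, no further step is transcendental and the
  basis is unchanged. That clause evaluates both towers of the correspondence.\<close>

lemma tower_extend:
  assumes "tower U B"
  shows "\<exists>B'. tower UNIV B' \<and> B \<subseteq> B' \<and> ((\<forall>i. i \<notin> U \<longrightarrow> alg U i) \<longrightarrow> B' = B)"
proof -
  have "\<exists>B'. tower (U \<union> D) B' \<and> B \<subseteq> B' \<and> ((\<forall>i. i \<notin> U \<longrightarrow> alg U i) \<longrightarrow> B' = B)"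
    if "finite D" for D
    using that
  proof (induction rule: finite_induct)
    case (insert i D)
    then obtain B' where B': "tower (U \<union> D) B'" "B \<subseteq> B'" "(\<forall>i. i \<notin> U \<longrightarrow> alg U i) \<longrightarrow> B' = B"
      by blast
    have e: "U \<union> insert i D = insert i (U \<union> D)" by simp
    show ?case
    proof (cases "i \<in> U")
      case True
      then have "U \<union> insert i D = U \<union> D" by auto
      then show ?thesis using B' by auto
    next
      case False
      then have i: "i \<notin> U \<union> D" using insert by simp
      show ?thesis
      proof (cases "alg (U \<union> D) i")
        case True
        then show ?thesis using tower.alg[OF B'(1) i] B' unfolding e by blast
      next
        case False
        then have "\<not> alg U i" using alg_mono by blast
        then show ?thesis
          using tower.trans[OF B'(1) i False] B'(2) \<open>i \<notin> U\<close> unfolding e by blast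
      qed
    qed
  qed (use assms in auto)
  from this[of UNIV] show ?thesis by simp
qed

lemma exists_tower: "\<exists>B. tower UNIV B"
  using tower_extend[OF tower.empty] by blast

text \<open>By \<open>tower_tangent\<close>, at a general zero the restriction of tangent vectors to
  the components in \<open>B\<close> is surjective and injective; \<open>\<phi>\<close> is this
  restriction, padded with zeros.\<close>

lemma tower_generic_dim:
  assumes "tower UNIV B"
  shows "\<exists>g\<in>polys_in UNIV - P. \<forall>x\<in>zeros_on UNIV. g x \<noteq> 0 \<longrightarrow> vec.dim (tangent_at P x) = card B"
proof -
  have PR: "P \<inter> polys_in UNIV = P" using P_sub by blast
  obtain g where g: "g \<in> polys_in UNIV - P" and gen: "\<forall>x\<in>zeros_on UNIV. g x \<noteq> 0 \<longrightarrow>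
    (\<forall>w. \<exists>v\<in>tangent_at P x. \<forall>i\<in>B. v $ i = w $ i) \<and>
    (\<forall>v\<in>tangent_at P x. (\<forall>i\<in>B. v $ i = 0) \<longrightarrow> (\<forall>i\<in>UNIV. v $ i = 0))"
    using tower_tangent[OF assms] unfolding PR by (rule bexE)
  have "vec.dim (tangent_at P x) = card B" if x: "x \<in> zeros_on UNIV" "g x \<noteq> 0" for x
  proof -
    let ?T = "tangent_at P x"
    define \<phi> :: "complex^'m \<Rightarrow> complex^'m" where "\<phi> v = (\<chi> i. if i \<in> B then v $ i else 0)" for v
    have lin: "Vector_Spaces.linear (*s) (*s) \<phi>"
      by (intro Vector_Spaces.linear_iff[THEN iffD2])
        (auto simp: \<phi>_def vec_eq_iff vec.vector_space_axioms)
    have sub: "vec.subspace ?T" using P_sub by (rule subspace_tangent_at)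
    have inj: "inj_on \<phi> ?T"
    proof (rule inj_onI)
      fix v w assume vw: "v \<in> ?T" "w \<in> ?T" "\<phi> v = \<phi> w"
      have "v - w \<in> ?T" using sub vw by (intro vec.subspace_diff)
      moreover have "\<forall>i\<in>B. (v - w) $ i = 0"
        using vw(3) by (auto simp: \<phi>_def vec_eq_iff) metis
      ultimately have "\<forall>i\<in>UNIV. (v - w) $ i = 0" using gen x by blast
      then show "v = w" by (simp add: vec_eq_iff)
    qed
    have img: "\<phi> ` ?T = {w. \<forall>i. i \<notin> B \<longrightarrow> w $ i = 0}"
    proof
      show "\<phi> ` ?T \<subseteq> {w. \<forall>i. i \<notin> B \<longrightarrow> w $ i = 0}" by (auto simp: \<phi>_def)
      show "{w. \<forall>i. i \<notin> B \<longrightarrow> w $ i = 0} \<subseteq> \<phi> ` ?T"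
      proof
        fix w :: "complex^'m" assume w: "w \<in> {w. \<forall>i. i \<notin> B \<longrightarrow> w $ i = 0}"
        obtain v where v: "v \<in> ?T" "\<forall>i\<in>B. v $ i = w $ i" using gen x by blast
        then have "\<phi> v = w" using w by (auto simp: \<phi>_def vec_eq_iff)
        then show "w \<in> \<phi> ` ?T" using v by blast
      qed
    qed
    have sp: "vec.span ?T = ?T" by (intro vec.span_subspace sub order_refl vec.span_superset)
    have "vec.dim (\<phi> ` ?T) = vec.dim ?T"
      by (rule vec.dim_image_eq[OF lin]) (simp only: sp inj)
    then show ?thesis by (simp add: img dim_substandard_cart)
  qed
  then have "\<forall>x\<in>zeros_on UNIV. g x \<noteq> 0 \<longrightarrow> vec.dim (tangent_at P x) = card B" by simp
  then show ?thesis using g by (rule bexI)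
qed

text \<open>Two generic conditions hold together at some zero, by the Nullstellensatz, and there
  both cardinalities are the dimension of the same tangent space. This does the work of the exchange
  lemma.\<close>

lemma tower_card_unique:
  assumes "tower UNIV B" "tower UNIV B'"
  shows "card B = card B'"
proof -
  obtain g where g: "g \<in> polys_in UNIV - P" "\<forall>x\<in>zeros_on UNIV. g x \<noteq> 0 \<longrightarrow> vec.dim (tangent_at P x) = card B"
    using tower_generic_dim[OF assms(1)] by (rule bexE)
  obtain h where h: "h \<in> polys_in UNIV - P" "\<forall>x\<in>zeros_on UNIV. h x \<noteq> 0 \<longrightarrow> vec.dim (tangent_at P x) = card B'"
    using tower_generic_dim[OF assms(2)] by (rule bexE)
  have "g * h \<in> polys_in UNIV" "g * h \<notin> P"
    using g(1) h(1) P_prime[of g h] by (auto simp: polys_in_mult)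
  then obtain x where "x \<in> zeros_on UNIV" "(g * h) x \<noteq> 0" using nullstellensatz by blast
  then show ?thesis using g(2) h(2) by auto
qed

section \<open>Transcendence degree, independent sets of coordinates and transcendence bases\<close>

definition trdeg :: nat where
  "trdeg = card (SOME B. tower UNIV B)"

lemma tower_card: "tower UNIV B \<Longrightarrow> card B = trdeg"
  unfolding trdeg_def using tower_card_unique someI_ex[OF exists_tower] by blast

lemma trdeg_generic_dim:
  obtains g where "g \<in> polys_in UNIV" "g \<notin> P"
    "\<And>x. x \<in> zeros_on UNIV \<Longrightarrow> g x \<noteq> 0 \<Longrightarrow> vec.dim (tangent_at P x) = trdeg"
proof -
  obtain B where B: "tower UNIV B" using exists_tower by blast
  obtain g where "g \<in> polys_in UNIV - P" "\<forall>x\<in>zeros_on UNIV. g x \<noteq> 0 \<longrightarrow> vec.dim (tangent_at P x) = card B"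
    using tower_generic_dim[OF B] by (rule bexE)
  then show ?thesis by (intro that[of g]) (auto simp: tower_card[OF B])
qed

text \<open>Algebraic independence of the classes of the coordinates: the polynomial ring in
  \<open>T\<close> embeds into the quotient by \<open>P\<close>.\<close>

definition indep :: "'m set \<Rightarrow> bool" where
  "indep T \<longleftrightarrow> P \<inter> polys_in T \<subseteq> {0}"

lemma tower_indep: "tower U B \<Longrightarrow> indep B"
proof (induction rule: tower.induct)
  case empty
  show ?case
    using polys_in_empty const_in_P by (auto simp: indep_def zero_fun_def)
next
  case (alg U B i)
  then show ?case by simp
next
  case (trans U B i)
  show ?case unfolding indep_def
  proof
    fix f assume f: "f \<in> P \<inter> polys_in (insert i B)"
    then have "f \<in> polys_in (insert i B)" by simp
    then obtain r where r: "coeffs_in (polys_in B) r" "f = poly r (coord_fun i)"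
      by (rule polys_in_insertE)
    have "coeffs_in (polys_in U) r"
      by (rule coeffs_in_mono[OF r(1) polys_in_mono[OF tower_subset[OF trans(1)]]])
    then have "coeffs_in P r"
      using trans(3) f r(2) by (auto simp: alg_def algebraic_over_def)
    then have rP: "coeff r k \<in> P" and rB: "coeff r k \<in> polys_in B" for k
      using r(1) by (simp_all add: coeffs_in_def)
    have "coeff r k = 0" for k
      using subsetD[OF trans.IH[unfolded indep_def] IntI[OF rP[of k] rB[of k]]] by (rule singletonD)
    then have "r = 0" by (intro poly_eqI) simp
    then show "f \<in> {0}" using r(2) by simp
  qed
qed

text \<open>A relation for a coordinate of \<open>T\<close> over earlier ones is an element of
  \<open>P\<close> in the variables \<open>T\<close>, so it is zero as a function; specialising the
  coefficients shows that they are all zero.\<close>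

lemma indep_tower:
  assumes "indep T"
  shows "tower T T"
proof -
  have "tower S S" if "finite S" "S \<subseteq> T" for S
    using that
  proof (induction rule: finite_induct)
    case (insert i S)
    have "\<not> alg S i"
    proof
      assume "alg S i"
      then obtain q where q: "coeffs_in (polys_in S) q" "\<not> coeffs_in P q" "poly q (coord_fun i) \<in> P"
        by (auto simp: alg_def algebraic_over_def)
      have "poly q (coord_fun i) \<in> polys_in T"
        using poly_coord_in[OF q(1), of i] polys_in_mono[of "insert i S" T] insert.prems by blast
      then have z: "poly q (coord_fun i) = 0" using assms q(3) by (auto simp: indep_def)
      have "poly (eval_poly x q) t = 0" for x t
        using poly_upd_coord[OF q(1) insert(2), of x t] z by simp
      then have "eval_poly x q = 0" for x using poly_all_0_iff_0 by blast
      then have "coeff q k x = 0" for k x by (metis coeff_0 coeff_eval_poly)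
      then have "coeff q k = 0" for k by (simp add: fun_eq_iff)
      then show False using q(2) P_zero by (simp add: coeffs_in_def)
    qed
    then show ?case using insert by (intro tower.trans) auto
  qed (rule tower.empty)
  then show ?thesis by simp
qed

lemma indep_card_le: "indep T \<Longrightarrow> card T \<le> trdeg"
  using tower_extend[OF indep_tower] tower_card card_mono finite by metis

lemma alg_self: "i \<in> T \<Longrightarrow> alg T i"
proof -
  assume i: "i \<in> T"
  have "coeffs_in (polys_in T) [:- coord_fun i, 1:]"
    using subringD[OF subring_polys_in[of T]] polys_in_coord[OF i]
    by (auto simp: coeffs_in_pCons coeffs_in_ring[OF subring_polys_in])
  moreover have "poly [:- coord_fun i, 1:] (coord_fun i) = 0" by simp
  moreover have "\<not> coeffs_in P [:- coord_fun i, 1:]"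
    using P_one by (auto simp: coeffs_in_pCons)
  ultimately show ?thesis unfolding alg_def algebraic_over_def using P_zero by metis
qed

text \<open>The basis of a tower is known to make each further coordinate algebraic only over its
  predecessors. Algebraicity over the basis itself follows from maximality: an independent set with
  one more element would exceed \<open>trdeg\<close>.\<close>

lemma exists_transcendence_basis:
  obtains T where "indep T" "card T = trdeg" "\<And>i. alg T i"
proof -
  obtain B where B: "tower UNIV B" using exists_tower by blast
  have iB: "indep B" using B by (rule tower_indep)
  have "alg B i" for i
  proof (cases "i \<in> B")
    case True
    then show ?thesis by (rule alg_self)
  next
    case False
    show ?thesis
    proof (rule ccontr)
      assume "\<not> alg B i"
      then have "tower (insert i B) (insert i B)"
        using indep_tower[OF iB] False by (intro tower.trans)
      then have "card (insert i B) \<le> trdeg" by (intro indep_card_le tower_indep)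
      then show False using False tower_card[OF B] by simp
    qed
  qed
  then show ?thesis using that iB tower_card[OF B] by blast
qed

text \<open>Removing the coordinates outside \<open>T\<close> one at a time, each by
  \<open>algebraic_element_divides_base\<close>, turns \<open>f\<close> into a multiple that depends
  on \<open>T\<close> alone and is still outside \<open>P\<close>.\<close>

lemma algebraic_basis_elimination:
  assumes "\<And>i. alg T i" "f \<in> polys_in UNIV" "f \<notin> P"
  obtains u h where "u \<in> polys_in UNIV" "h \<in> polys_in T" "h \<notin> P" "u * f - h \<in> P"
proof -
  have "\<exists>u\<in>polys_in UNIV. \<exists>h\<in>polys_in T - P. u * f - h \<in> P"
    if "finite D" "f \<in> polys_in (T \<union> D)" "f \<notin> P" for D f
    using that
  proof (induction D arbitrary: f rule: finite_induct)
    case empty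
    have a: "1 * f - f \<in> P" by (simp only: mult_1_left diff_self P_zero)
    have b: "f \<in> polys_in T - P" using empty by simp
    show ?case
      by (rule bexI[where x = 1], rule bexI[where x = f])
        (rule a, rule b, rule subringD(1)[OF subring_polys_in])
  next
    case (insert i D)
    have e: "T \<union> insert i D = insert i (T \<union> D)" by simp
    have "f \<in> polys_in (insert i (T \<union> D))" using insert.prems(1) by (simp only: e)
    then obtain g where g: "coeffs_in (polys_in (T \<union> D)) g" "f = poly g (coord_fun i)"
      by (rule polys_in_insertE)
    have al: "algebraic_over (polys_in (T \<union> D)) (coord_fun i)"
      using alg_mono[OF assms(1)[of i], of "T \<union> D"] by (simp add: alg_def)
    have gn: "poly g (coord_fun i) \<notin> P" using insert.prems(2) g(2) by simp
    obtain u b where ub: "coeffs_in (polys_in (T \<union> D)) u" "b \<in> polys_in (T \<union> D)" "b \<notin> P"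
      "poly u (coord_fun i) * poly g (coord_fun i) - b \<in> P"
      by (rule algebraic_element_divides_base[OF subring_polys_in polys_in_sub polys_in_coord_UNIV al g(1) gn])
    obtain u' h where uh: "u' \<in> polys_in UNIV" "h \<in> polys_in T - P" "u' * b - h \<in> P"
      using insert.IH[OF ub(2,3)] by blast
    let ?u = "poly u (coord_fun i)"
    have uR: "?u \<in> polys_in UNIV" using poly_coord_in[OF ub(1), of i] polys_in_sub by blast
    have "u' * (?u * f - b) + (u' * b - h) \<in> P"
      using ub(4) uh g(2) by (intro P_add P_mult) auto
    moreover have "u' * (?u * f - b) + (u' * b - h) = (u' * ?u) * f - h"
      by (rule elimination_identity)
    ultimately have "(u' * ?u) * f - h \<in> P" by (simp only:)
    then show ?case
      by - (rule bexI[where x = "u' * ?u"], rule bexI[where x = h], assumption,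
        rule uh(2), rule polys_in_mult[OF uh(1) uR])
  qed
  from this[of UNIV f] assms(2,3) have "\<exists>u\<in>polys_in UNIV. \<exists>h\<in>polys_in T - P. u * f - h \<in> P"
    by simp
  then obtain u h where "u \<in> polys_in UNIV" "h \<in> polys_in T - P" "u * f - h \<in> P"
    by (elim bexE)
  then show ?thesis by (intro that[of u h]) simp_all
qed

end

text \<open>A basis \<open>T\<close> for \<open>P'\<close> is independent modulo the smaller
  \<open>P\<close>. Were it a basis for \<open>P\<close> too, some \<open>f\<close> in
  \<open>P'\<close> outside \<open>P\<close> would divide, modulo \<open>P\<close>, an
  \<open>h\<close> outside \<open>P\<close> in the variables \<open>T\<close>; but \<open>h\<close>
  lies in \<open>P'\<close>, against independence.\<close>

lemma trdeg_strict_antimono: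
  assumes "polynomial_prime P" "polynomial_prime P'" "P \<subset> P'"
  shows "polynomial_prime.trdeg P' < polynomial_prime.trdeg P"
proof -
  interpret P: polynomial_prime P by fact
  interpret P': polynomial_prime P' by fact
  obtain T where T: "P'.indep T" "card T = P'.trdeg"
    using P'.exists_transcendence_basis by metis
  have i: "P.indep T" using T(1) assms(3) by (auto simp: P.indep_def P'.indep_def)
  have "card T \<noteq> P.trdeg"
  proof
    assume eq: "card T = P.trdeg"
    have al: "P.alg T i" if "i \<notin> T" for i
    proof (rule ccontr)
      assume "\<not> P.alg T i"
      then have "P.tower (insert i T) (insert i T)"
        using P.indep_tower[OF i] that by (intro P.tower.trans)
      then have "card (insert i T) \<le> P.trdeg" by (intro P.indep_card_le P.tower_indep)
      then show False using that eq by simp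
    qed
    have al: "P.alg T i" for i
    proof (cases "i \<in> T")
      case True
      then show ?thesis by (rule P.alg_self)
    qed (use al in blast)
    obtain f where f: "f \<in> P'" "f \<notin> P" using assms(3) by blast
    then have fR: "f \<in> polys_in UNIV" using P'.P_sub by blast
    obtain u h where uh: "u \<in> polys_in UNIV" "h \<in> polys_in T" "h \<notin> P" "u * f - h \<in> P"
      by (rule P.algebraic_basis_elimination[OF al fR f(2)])
    have "u * f \<in> P'" "u * f - h \<in> P'" using uh f assms(3) P'.P_mult by auto
    then have "h \<in> P'" using P'.P_cong by blast
    then have "h = 0" using uh(2) T(1) by (auto simp: P'.indep_def)
    then show False using uh(3) P.P_zero by simp
  qed
  then show ?thesis using P.indep_card_le[OF i] T(2) by simp
qed

section \<open>Noetherian rings of polynomial functions\<close>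

definition ideal_in :: "'r::comm_ring_1 set \<Rightarrow> 'r set \<Rightarrow> bool" where
  "ideal_in R I \<longleftrightarrow> I \<subseteq> R \<and> 0 \<in> I \<and> (\<forall>a\<in>I. \<forall>b\<in>I. a + b \<in> I) \<and> (\<forall>a\<in>R. \<forall>b\<in>I. a * b \<in> I)"

lemma ideal_inD:
  assumes "ideal_in R I"
  shows "I \<subseteq> R" "0 \<in> I" "a \<in> I \<Longrightarrow> b \<in> I \<Longrightarrow> a + b \<in> I" "a \<in> R \<Longrightarrow> b \<in> I \<Longrightarrow> a * b \<in> I"
  using assms by (auto simp: ideal_in_def)

lemma ideal_in_diff:
  assumes "ideal_in R I" "subring R" "a \<in> I" "b \<in> I"
  shows "a - b \<in> I"
proof -
  have "(-1) * b \<in> I" using assms subringD[OF assms(2)] by (intro ideal_inD(4)[OF assms(1)])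
  then have "a + (-1) * b \<in> I" using assms(3) by (intro ideal_inD(3)[OF assms(1)])
  then show ?thesis by simp
qed

definition noetherian :: "'r::comm_ring_1 set \<Rightarrow> bool" where
  "noetherian R \<longleftrightarrow> (\<forall>I :: nat \<Rightarrow> 'r set. (\<forall>n. ideal_in R (I n)) \<and> incseq I \<longrightarrow> (\<exists>N. \<forall>n\<ge>N. I n = I N))"

lemma noetherianD:
  assumes "noetherian R" "\<And>n. ideal_in R (I n)" "incseq I"
  shows "\<exists>N. \<forall>n\<ge>N. I n = I N"
  using assms(1)[unfolded noetherian_def] assms(2,3) by blast

text \<open>\<open>R\<close> will be generated over \<open>B\<close> by \<open>x\<close> and need
  not be a polynomial ring over \<open>B\<close>; so the leading coefficients are those of all
  polynomials whose value at \<open>x\<close> lies in \<open>A\<close>. In degree below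
  \<open>d\<close> the contributed coefficient is 0.\<close>

definition lead_ideal :: "'r::comm_ring_1 set \<Rightarrow> 'r \<Rightarrow> 'r set \<Rightarrow> nat \<Rightarrow> 'r set" where
  "lead_ideal B x A d = {coeff g d | g. coeffs_in B g \<and> degree g \<le> d \<and> poly g x \<in> A}"

lemma lead_ideal_ideal:
  assumes B: "subring B" and R: "B \<subseteq> R" and A: "ideal_in R A"
  shows "ideal_in B (lead_ideal B x A d)"
  unfolding ideal_in_def
proof (intro conjI ballI)
  show "lead_ideal B x A d \<subseteq> B" by (auto simp: lead_ideal_def coeffs_in_def)
  have "coeffs_in B 0" "poly 0 x \<in> A" using coeffs_in_ring(1)[OF B] ideal_inD(2)[OF A] by auto
  then show "0 \<in> lead_ideal B x A d" by (force simp: lead_ideal_def)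
next
  fix a b assume "a \<in> lead_ideal B x A d" "b \<in> lead_ideal B x A d"
  then obtain g h where "coeffs_in B g" "degree g \<le> d" "poly g x \<in> A" "a = coeff g d"
    "coeffs_in B h" "degree h \<le> d" "poly h x \<in> A" "b = coeff h d"
    by (auto simp: lead_ideal_def)
  then have "coeffs_in B (g + h)" "degree (g + h) \<le> d" "poly (g + h) x \<in> A" "a + b = coeff (g + h) d"
    using B A by (auto intro: coeffs_in_ring degree_add_le ideal_inD)
  then show "a + b \<in> lead_ideal B x A d" unfolding lead_ideal_def by blast
next
  fix a b assume a: "a \<in> B" and "b \<in> lead_ideal B x A d"
  then obtain h where "coeffs_in B h" "degree h \<le> d" "poly h x \<in> A" "b = coeff h d"
    by (auto simp: lead_ideal_def)
  then have "coeffs_in B (smult a h)" "degree (smult a h) \<le> d" "poly (smult a h) x \<in> A"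
    "a * b = coeff (smult a h) d"
    using B A R a by (auto intro: coeffs_in_ring ideal_inD order_trans[OF degree_smult_le])
  then show "a * b \<in> lead_ideal B x A d" unfolding lead_ideal_def by blast
qed

lemma lead_ideal_mono: "A \<subseteq> A' \<Longrightarrow> lead_ideal B x A d \<subseteq> lead_ideal B x A' d"
  by (auto simp: lead_ideal_def)

lemma lead_ideal_Suc:
  assumes B: "subring B" and A: "ideal_in R A" and x: "x \<in> R"
  shows "lead_ideal B x A d \<subseteq> lead_ideal B x A (Suc d)"
proof
  fix a assume "a \<in> lead_ideal B x A d"
  then obtain g where g: "coeffs_in B g" "degree g \<le> d" "poly g x \<in> A" "a = coeff g d"
    by (auto simp: lead_ideal_def)
  have "coeffs_in B (pCons 0 g)" using g(1) subringD(2)[OF B] by (simp add: coeffs_in_pCons)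
  moreover have "degree (pCons 0 g) \<le> Suc d" using g(2) degree_pCons_le[of 0 g] by linarith
  moreover have "poly (pCons 0 g) x \<in> A" using ideal_inD(4)[OF A x g(3)] by simp
  moreover have "a = coeff (pCons 0 g) (Suc d)" using g(4) by simp
  ultimately show "a \<in> lead_ideal B x A (Suc d)" unfolding lead_ideal_def by blast
qed

text \<open>Subtracting a polynomial with the same top coefficient and value in \<open>A\<close>
  lowers the degree, so every value in \<open>A'\<close> reaches \<open>A\<close> by
  induction.\<close>

lemma lead_ideal_eq_imp_eq:
  assumes B: "subring B" and R: "subring R" "R = {poly g x | g. coeffs_in B g}"
    and A: "ideal_in R A" "ideal_in R A'" "A \<subseteq> A'"
    and eq: "\<And>d. lead_ideal B x A' d \<subseteq> lead_ideal B x A d"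
  shows "A' = A"
proof -
  have "poly g x \<in> A" if "coeffs_in B g" "poly g x \<in> A'" for g
    using that
  proof (induction "degree g" arbitrary: g rule: less_induct)
    case less
    have "lead_coeff g \<in> lead_ideal B x A' (degree g)"
      using less.prems by (auto simp: lead_ideal_def)
    then have "lead_coeff g \<in> lead_ideal B x A (degree g)" using eq by blast
    then obtain h where h: "coeffs_in B h" "degree h \<le> degree g" "poly h x \<in> A"
      "lead_coeff g = coeff h (degree g)"
      unfolding lead_ideal_def by blast
    have gh: "coeffs_in B (g - h)" using less.prems(1) h(1) B by (intro coeffs_in_ring)
    have "poly (g - h) x \<in> A"
    proof (cases "g - h = 0")
      case True
      then show ?thesis using ideal_inD(2)[OF A(1)] by simp
    next
      case False
      have le: "degree (g - h) \<le> degree g" using h(2) by (intro degree_diff_le) auto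
      have "coeff (g - h) (degree g) = 0" using h(4) by (simp only: coeff_diff diff_self)
      then have "degree (g - h) \<noteq> degree g"
        using False leading_coeff_0_iff[of "g - h"] by metis
      with le have lt: "degree (g - h) < degree g" by simp
      have "poly g x - poly h x \<in> A'"
        using less.prems(2) h(3) A(3) by (intro ideal_in_diff[OF A(2) R(1)]) auto
      then show ?thesis using less.hyps[OF lt gh] by simp
    qed
    then have "poly (g - h) x + poly h x \<in> A" using h(3) by (intro ideal_inD(3)[OF A(1)])
    then show ?case by simp
  qed
  then have "A' \<subseteq> A" using ideal_inD(1)[OF A(2)] R(2) by blast
  then show ?thesis using A(3) by blast
qed

text \<open>The leading ideals grow both in the index \<open>n\<close> of the chain and in the
  degree \<open>d\<close>. The diagonal stabilises at some \<open>N\<close>, which settles all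
  degrees above \<open>N\<close>; below, finitely many chains remain, each stable from some
  \<open>M d\<close> on.\<close>

theorem hilbert_basis:
  assumes B: "subring B" "noetherian B" and R: "subring R" "R = {poly g x | g. coeffs_in B g}"
    and BR: "B \<subseteq> R" and x: "x \<in> R"
  shows "noetherian R"
  unfolding noetherian_def
proof (intro allI impI)
  fix A :: "nat \<Rightarrow> 'a set" assume A': "(\<forall>n. ideal_in R (A n)) \<and> incseq A"
  have A: "ideal_in R (A n)" for n using A' by simp
  have inc: "A m \<subseteq> A n" if "m \<le> n" for m n using A' that by (simp add: monoD)
  let ?L = "\<lambda>n d. lead_ideal B x (A n) d"
  have Lid: "ideal_in B (?L n d)" for n d by (rule lead_ideal_ideal[OF B(1) BR A])
  have Ln: "?L m d \<subseteq> ?L n d" if "m \<le> n" for m n d using inc[OF that] by (rule lead_ideal_mono)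
  have Ld: "?L n d \<subseteq> ?L n e" if "d \<le> e" for n d e
    using that by (induction rule: dec_induct) (auto dest: subsetD[OF lead_ideal_Suc[OF B(1) A x]])
  have stable: "\<exists>N. \<forall>n\<ge>N. I n = I N" if "\<And>n. ideal_in B (I n)" "\<And>m n. m \<le> n \<Longrightarrow> I m \<subseteq> I n"
    for I :: "nat \<Rightarrow> 'a set"
  proof -
    have "incseq I" using that(2) by (intro monoI)
    then show ?thesis by (intro noetherianD[OF B(2)] that(1))
  qed
  have "\<exists>N. \<forall>n\<ge>N. ?L n n = ?L N N"
    
    by (rule stable[of "\<lambda>n. ?L n n"], rule Lid, rule order_trans[OF Ln Ld])
  then obtain N where N: "\<forall>n\<ge>N. ?L n n = ?L N N" ..
  have "\<exists>M. \<forall>n\<ge>M. ?L n d = ?L M d" for d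
    by (rule stable[of "\<lambda>n. ?L n d"], rule Lid, rule Ln)
  then obtain M where M: "\<And>d. \<forall>n\<ge>M d. ?L n d = ?L (M d) d" by metis
  define K where "K = Max (insert N (M ` {..N}))"
  have KN: "N \<le> K" by (simp add: K_def)
  have KM: "M d \<le> K" if "d \<le> N" for d using that unfolding K_def by (intro Max_ge) auto
  have "A n = A K" if n: "n \<ge> K" for n
  proof (rule lead_ideal_eq_imp_eq[OF B(1) R A A inc[OF n]])
    fix d
    show "?L n d \<subseteq> ?L K d"
    proof (cases "d \<le> N")
      case True
      then show ?thesis using M[of d, rule_format, of n] M[of d, rule_format, of K] KM[OF True] n by simp
    next
      case False
      \<comment> \<open>For large degree, the diagonal term beyond both \<open>n\<close> and
        \<open>d\<close> bounds the left side from above, and its stable value \<open>?L N N\<close>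
        is already contained in the right side.\<close>
      have "?L n d \<subseteq> ?L (max n d) (max n d)"
        by (rule order_trans[OF Ln[OF max.cobounded1] Ld[OF max.cobounded2]])
      also have "\<dots> = ?L N N" using N[rule_format, of "max n d"] False by simp
      also have "\<dots> \<subseteq> ?L K d" using order_trans[OF Ln[OF KN, of N] Ld[of N d K]] False by simp
      finally show ?thesis .
    qed
  qed
  then show "\<exists>N. \<forall>n\<ge>N. A n = A N" by blast
qed

lemma poly_functions_insert:
  "poly_functions (insert g X) = {poly q g | q. coeffs_in (poly_functions X) q}"
proof (intro equalityI subsetI)
  fix f assume "f \<in> poly_functions (insert g X)"
  then obtain q where "coeffs_in (poly_functions X) q" "f = poly q g" by (rule poly_functions_insertE)
  then show "f \<in> {poly q g | q. coeffs_in (poly_functions X) q}" by blast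
next
  fix f assume "f \<in> {poly q g | q. coeffs_in (poly_functions X) q}"
  then obtain q where q: "coeffs_in (poly_functions X) q" "f = poly q g" by blast
  have "coeffs_in (poly_functions (insert g X)) q"
    by (rule coeffs_in_mono[OF q(1) poly_functions_mono]) blast
  then show "f \<in> poly_functions (insert g X)"
    unfolding q(2) by (intro poly_in_subring subring_poly_functions poly_functions.coord) auto
qed

lemma noetherian_constants: "noetherian (poly_functions {} :: ('a \<Rightarrow> complex) set)"
  unfolding noetherian_def
proof (intro allI impI)
  fix I :: "nat \<Rightarrow> ('a \<Rightarrow> complex) set"
  assume I': "(\<forall>n. ideal_in (poly_functions {}) (I n)) \<and> incseq I"
  have I: "ideal_in (poly_functions {}) (I n)" for n using I' by simp
  have inc: "I m \<subseteq> I n" if "m \<le> n" for m n using I' that by (simp add: monoD)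
  have const: "\<exists>c. f = (\<lambda>_. c)" if "f \<in> poly_functions {}" for f :: "'a \<Rightarrow> complex"
    using that by induction (auto simp: fun_eq_iff)
  show "\<exists>N. \<forall>n\<ge>N. I n = I N"
  proof (cases "\<forall>n. I n \<subseteq> {0}")
    case True
    then have "I n = {0}" for n using ideal_inD(2)[OF I, of n] by auto
    then show ?thesis by simp
  next
    case False
    then obtain N f where f: "f \<in> I N" "f \<noteq> 0" by auto
    then obtain c where c: "f = (\<lambda>_. c)" using const ideal_inD(1)[OF I] by blast
    with f(2) have "c \<noteq> 0" by (auto simp: zero_fun_def)
    have "poly_functions {} \<subseteq> I n" if "n \<ge> N" for n
    proof
      fix g :: "'a \<Rightarrow> complex" assume "g \<in> poly_functions {}"
      then obtain b where b: "g = (\<lambda>_. b)" using const by blast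
      have "f \<in> I n" using f(1) inc[OF that] by blast
      then have "(\<lambda>_. b / c) * f \<in> I n" by (intro ideal_inD(4)[OF I] poly_functions.const)
      moreover have "(\<lambda>_. b / c) * f = g" using \<open>c \<noteq> 0\<close> by (simp add: b c times_fun_def)
      ultimately show "g \<in> I n" by simp
    qed
    then have "I n = poly_functions {}" if "n \<ge> N" for n
      using that ideal_inD(1)[OF I[of n]] by blast
    then show ?thesis by (intro exI[of _ N]) simp
  qed
qed

theorem noetherian_poly_functions: "finite X \<Longrightarrow> noetherian (poly_functions X)"
proof (induction rule: finite_induct)
  case (insert g X)
  show ?case
    by (rule hilbert_basis[OF subring_poly_functions insert.IH subring_poly_functions poly_functions_insert])
      (auto intro: subsetD[OF poly_functions_mono, rotated] poly_functions.coord)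
qed (rule noetherian_constants)

section \<open>Primes disjoint from a multiplicative set, and primes of transcendence degree at most
  one less\<close>

lemma noetherian_maximal:
  assumes R: "noetherian R" and F: "\<And>I. I \<in> F \<Longrightarrow> ideal_in R I" "F \<noteq> {}"
  obtains M where "M \<in> F" "\<And>J. J \<in> F \<Longrightarrow> M \<subseteq> J \<Longrightarrow> J = M"
proof -
  have "\<exists>M\<in>F. \<forall>J\<in>F. M \<subseteq> J \<longrightarrow> J = M"
  proof (rule ccontr)
    assume "\<not> ?thesis"
    then have "\<forall>M\<in>F. \<exists>J. J \<in> F \<and> M \<subset> J" by blast
    from bchoice[OF this] obtain s where s': "\<forall>M\<in>F. s M \<in> F \<and> M \<subset> s M" ..
    have s: "s M \<in> F \<and> M \<subset> s M" if "M \<in> F" for M using s' that by (rule bspec)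
    obtain M0 where M0: "M0 \<in> F" using F(2) by blast
    define I where "I = (\<lambda>n. (s ^^ n) M0)"
    have IF: "I n \<in> F" for n by (induction n) (use M0 s in \<open>auto simp: I_def\<close>)
    have step: "I n \<subset> I (Suc n)" for n using s[OF IF[of n]] by (simp add: I_def)
    then have "incseq I" by (intro incseq_SucI psubset_imp_subset)
    then have "\<exists>N. \<forall>n\<ge>N. I n = I N"
      by (intro noetherianD[OF R] F(1) IF)
    then obtain N where N: "\<forall>n\<ge>N. I n = I N" ..
    have "I (Suc N) = I N" by (rule N[rule_format]) simp
    then show False using step[of N] by blast
  qed
  then show ?thesis using that by blast
qed

text \<open>An ideal maximal among those disjoint from a multiplicative set is prime: adjoining
  either of two elements outside it would make it meet \<open>S\<close>, and the product of the two
  elements so found lies in \<open>S\<close> and, if the product of the adjoined ones is in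
  \<open>P\<close>, also in \<open>P\<close>.\<close>

lemma noetherian_prime_avoiding:
  assumes R: "subring R" "noetherian R" and A: "ideal_in R A"
    and S: "1 \<in> S" "\<And>a b. a \<in> S \<Longrightarrow> b \<in> S \<Longrightarrow> a * b \<in> S" "A \<inter> S = {}"
  obtains P where "prime_ideal_in R P" "A \<subseteq> P" "P \<inter> S = {}"
proof -
  obtain P where P: "P \<in> {J. ideal_in R J \<and> A \<subseteq> J \<and> J \<inter> S = {}}"
    and max: "\<And>J. J \<in> {J. ideal_in R J \<and> A \<subseteq> J \<and> J \<inter> S = {}} \<Longrightarrow> P \<subseteq> J \<Longrightarrow> J = P"
    by (rule noetherian_maximal[OF R(2), of "{J. ideal_in R J \<and> A \<subseteq> J \<and> J \<inter> S = {}}"])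
      (use A S(3) in auto)
  then have Pid: "ideal_in R P" and AP: "A \<subseteq> P" and PS: "P \<inter> S = {}" by auto
  note PD = ideal_inD[OF Pid]
  have meets: "\<exists>p\<in>P. \<exists>r\<in>R. p + a * r \<in> S" if a: "a \<in> R" "a \<notin> P" for a
  proof -
    let ?J = "{p + a * r | p r. p \<in> P \<and> r \<in> R}"
    have "ideal_in R ?J"
      unfolding ideal_in_def
    proof (intro conjI ballI)
      show "?J \<subseteq> R" using PD(1) a(1) subringD[OF R(1)] by auto
      show "0 \<in> ?J" using PD(2) subringD(2)[OF R(1)]
        by (intro CollectI exI[of _ 0] conjI) auto
    next
      fix u v assume "u \<in> ?J" "v \<in> ?J"
      then obtain p r p' r' where "u = p + a * r" "v = p' + a * r'" "p \<in> P" "p' \<in> P" "r \<in> R" "r' \<in> R"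
        by blast
      then have "u + v = (p + p') + a * (r + r')" "p + p' \<in> P" "r + r' \<in> R"
        using PD(3) subringD[OF R(1)] by (auto simp: algebra_simps)
      then show "u + v \<in> ?J" by blast
    next
      fix u v assume u: "u \<in> R" and "v \<in> ?J"
      then obtain p r where "v = p + a * r" "p \<in> P" "r \<in> R" by blast
      moreover from this have "u * v = u * p + a * (u * r)" by (simp add: algebra_simps)
      moreover have "u * p \<in> P" "u * r \<in> R"
        using PD(4)[OF u] subringD(5)[OF R(1) u] calculation by auto
      ultimately show "u * v \<in> ?J" by blast
    qed
    moreover have "P \<subseteq> ?J"
    proof
      fix p assume "p \<in> P"
      then have "p = p + a * 0" "p \<in> P" "0 \<in> R" using subringD(2)[OF R(1)] by auto
      then show "p \<in> ?J" by blast
    qed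
    moreover have "?J \<noteq> P"
    proof -
      have "a = 0 + a * 1" "0 \<in> P" "1 \<in> R" using PD(2) subringD(1)[OF R(1)] by auto
      then have "a \<in> ?J" by blast
      then show ?thesis using a(2) by blast
    qed
    ultimately have "?J \<inter> S \<noteq> {}" using max[of ?J] AP by blast
    then show ?thesis by blast
  qed
  have "prime_ideal_in R P"
  proof
    show "subring R" "P \<subseteq> R" "0 \<in> P" by (fact R(1), fact PD(1), fact PD(2))
    show "1 \<notin> P" using S(1) PS by blast
    show "a + b \<in> P" if "a \<in> P" "b \<in> P" for a b using that by (rule PD(3))
    show "a * b \<in> P" if "a \<in> R" "b \<in> P" for a b using that by (rule PD(4))
    show "a \<in> P \<or> b \<in> P" if ab: "a \<in> R" "b \<in> R" "a * b \<in> P" for a b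
    proof (rule ccontr)
      assume "\<not> ?thesis"
      then obtain p r q s where p: "p \<in> P" "r \<in> R" "p + a * r \<in> S" and q: "q \<in> P" "s \<in> R" "q + b * s \<in> S"
        using meets[OF ab(1)] meets[OF ab(2)] by blast
      have "(p + a * r) * (q + b * s) = (q + b * s) * p + ((a * r) * q + (r * s) * (a * b))"
        by (simp add: algebra_simps)
      also have "\<dots> \<in> P"
        using p q ab PD(1) subringD[OF R(1)] by (intro PD(3) PD(4)[of "q + b * s" p] PD(4)[of "a * r" q] PD(4)[of "r * s" "a * b"]) auto
      finally show False using S(2)[OF p(3) q(3)] PS by blast
    qed
  qed
  then show ?thesis using AP PS by (rule that)
qed

lemma finite_coords: "finite (coords :: (complex^'m \<Rightarrow> complex) set)"
  by (simp add: coords_def)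

lemma noetherian_polys_in: "noetherian (polys_in UNIV :: (complex^'m \<Rightarrow> complex) set)"
  unfolding polys_in_UNIV by (rule noetherian_poly_functions[OF finite_coords])

lemma polynomial_prime_avoiding:
  fixes A :: "(complex^'m \<Rightarrow> complex) set"
  assumes "ideal_in (polys_in UNIV) A" "1 \<in> S" "\<And>a b. a \<in> S \<Longrightarrow> b \<in> S \<Longrightarrow> a * b \<in> S" "A \<inter> S = {}"
  shows "\<exists>P. polynomial_prime P \<and> A \<subseteq> P \<and> P \<inter> S = {}"
proof -
  obtain P where "prime_ideal_in (polys_in UNIV) P" "A \<subseteq> P" "P \<inter> S = {}"
    by (rule noetherian_prime_avoiding[OF subring_polys_in noetherian_polys_in assms])
  then show ?thesis by (intro exI[of _ P]) (simp add: polynomial_prime_def)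
qed

text \<open>The zero set is cut by the hyperplane where coordinate \<open>i\<close> of a
  transcendence basis \<open>T\<close> equals a constant \<open>c\<close>. A prime over this section
  that contains no nonzero polynomial in the rest \<open>T0\<close> of the basis keeps
  \<open>T0\<close> independent, so the degree drops by at most one.\<close>

lemma exists_larger_prime:
  fixes P :: "(complex^'m \<Rightarrow> complex) set"
  assumes "polynomial_prime P" "polynomial_prime.trdeg P > 0"
  obtains P' where "polynomial_prime P'" "P \<subset> P'"
    "polynomial_prime.trdeg P \<le> Suc (polynomial_prime.trdeg P')"
proof -
  interpret P: polynomial_prime P by fact
  obtain T where T: "P.indep T" "card T = P.trdeg" using P.exists_transcendence_basis by metis
  then obtain i where i: "i \<in> T" using assms(2) by fastforce
  define T0 where "T0 = T - {i}"
  have T0: "insert i T0 = T" "i \<notin> T0" using i by (auto simp: T0_def)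
  have zT: "x \<in> P.zeros_on T" for x using T(1) by (auto simp: P.zeros_on_def P.indep_def)
  have one: "1 \<in> (polys_in UNIV :: (complex^'m \<Rightarrow> complex) set)"
    by (rule subringD(1)[OF subring_polys_in])
  obtain h where h: "h \<in> polys_in T" "h \<notin> P" and hext: "\<And>x. x \<in> P.zeros_on T \<Longrightarrow> h x \<noteq> 0 \<Longrightarrow>
       \<exists>x'\<in>P.zeros_on UNIV. (\<forall>j\<in>T. x' $ j = x $ j) \<and> 1 x' \<noteq> (0::complex)"
    by (rule P.extend_zero[OF one P.P_one subset_UNIV[of T]], rule that) blast+
  have "h \<in> polys_in UNIV" using h(1) P.polys_in_sub by blast
  then obtain x0 where x0: "x0 \<in> P.zeros_on UNIV" "h x0 \<noteq> 0" using P.nullstellensatz h(2) by blast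
  \<comment> \<open>With this constant the lifting condition \<open>h\<close>, restricted to the
    hyperplane, is not identically zero, so a general point of the \<open>T0\<close> coordinates
    still lifts to a zero on the hyperplane.\<close>
  define c where "c = x0 $ i"
  have "h \<in> polys_in (insert i T0)" using h(1) by (simp only: T0(1))
  then obtain r where r: "coeffs_in (polys_in T0) r" "h = poly r (coord_fun i)"
    by (rule polys_in_insertE)
  define h0 where "h0 = poly r (\<lambda>_. c)"
  have h0: "h0 \<in> polys_in T0"
    unfolding h0_def by (rule poly_in_subring[OF subring_polys_in r(1) polys_in_const])
  have h0x: "h0 x = h (upd_coord x i c)" for x
    using poly_upd_coord[OF r(1) T0(2), of x c] unfolding r(2) h0_def by (simp only: poly_fun_apply)
  have "upd_coord x0 i c = x0" by (simp add: vec_eq_iff c_def)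
  then have h0n: "h0 \<noteq> 0" using x0(2) h0x[of x0] by auto
  let ?l = "coord_fun i - (\<lambda>_. c) :: complex^'m \<Rightarrow> complex"
  have lT: "?l \<in> polys_in T" using i by (intro subringD(6)[OF subring_polys_in] polys_in_coord) auto
  then have lR: "?l \<in> polys_in UNIV" using P.polys_in_sub by blast
  let ?A = "{p + ?l * r | p r. p \<in> P \<and> r \<in> polys_in UNIV}"
  note sr = subringD[OF subring_polys_in[of UNIV]]
  have A: "ideal_in (polys_in UNIV) ?A"
    unfolding ideal_in_def
  proof (intro conjI ballI)
    show "?A \<subseteq> polys_in UNIV"
    proof
      fix f assume "f \<in> ?A"
      then obtain p r where "f = p + ?l * r" "p \<in> P" "r \<in> polys_in UNIV" by blast
      then show "f \<in> polys_in UNIV"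
        using P.P_sub lR by (simp only:) (intro sr(4,5), auto)
    qed
    have "0 = 0 + ?l * 0" "0 \<in> P" "0 \<in> polys_in UNIV" using P.P_zero sr(2) by auto
    then show "0 \<in> ?A" by blast
  next
    fix u v assume "u \<in> ?A" "v \<in> ?A"
    then obtain p r p' r' where "u = p + ?l * r" "v = p' + ?l * r'" "p \<in> P" "p' \<in> P"
      "r \<in> polys_in UNIV" "r' \<in> polys_in UNIV"
      by blast
    moreover have "(p + ?l * r) + (p' + ?l * r') = (p + p') + ?l * (r + r')"
      by (simp only: distrib_left add.assoc add.left_commute)
    ultimately show "u + v \<in> ?A"
      using P.P_add[of p p'] sr(4)[of r r'] by blast
  next
    fix u v :: "complex^'m \<Rightarrow> complex" assume u: "u \<in> polys_in UNIV" and "v \<in> ?A"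
    then obtain p r where "v = p + ?l * r" "p \<in> P" "r \<in> polys_in UNIV" by blast
    moreover have "u * (p + ?l * r) = u * p + ?l * (u * r)"
      by (simp only: distrib_left mult.left_commute)
    ultimately show "u * v \<in> ?A"
      using P.P_mult[OF u, of p] sr(5)[OF u, of r] by blast
  qed
  let ?S = "polys_in T0 - {0}"
  have S1: "1 \<in> ?S" using subringD(1)[OF subring_polys_in] by simp
  have S2: "a * b \<in> ?S" if "a \<in> ?S" "b \<in> ?S" for a b
    using that polys_in_mult[of a T0 b] polys_in_domain[of a b] P.polys_in_sub[of T0] by blast
  \<comment> \<open>A polynomial in \<open>T0\<close> belonging to \<open>?A\<close> vanishes at
    every zero of \<open>P\<close> on the hyperplane, but such zeros lie over a general point of the
    \<open>T0\<close> coordinates.\<close>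
  have AS: "?A \<inter> ?S = {}"
  proof (rule ccontr)
    assume "?A \<inter> ?S \<noteq> {}"
    then obtain g p r where g: "g \<in> polys_in T0" "g \<noteq> 0" "g = p + ?l * r" "p \<in> P" by blast
    have "g * h0 \<noteq> 0"
      using polys_in_domain[of g h0] g h0 h0n P.polys_in_sub[of T0] by blast
    then obtain x where "(g * h0) x \<noteq> 0" by (auto simp: fun_eq_iff)
    then have gx: "g x \<noteq> 0" and "h0 x \<noteq> 0" by auto
    then have "h (upd_coord x i c) \<noteq> 0" by (simp only: h0x not_False_eq_True)
    from hext[OF zT this] obtain y where
      y: "y \<in> P.zeros_on UNIV" "\<forall>j\<in>T. y $ j = upd_coord x i c $ j" by blast
    have "g y = g x" using y(2) T0 by (intro polys_in_cong[OF g(1)]) auto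
    moreover have "p y = 0" using y(1) g(4) by (simp add: P.zeros_on_UNIV)
    moreover have "y $ i = c" using y(2) i by auto
    moreover have "g y = p y + (y $ i - c) * r y"
      by (simp only: g(3) plus_fun_apply times_fun_apply minus_apply)
    ultimately show False using gx by simp
  qed
  have "\<exists>P'. polynomial_prime P' \<and> ?A \<subseteq> P' \<and> P' \<inter> ?S = {}"
    by (rule polynomial_prime_avoiding[OF A S1 _ AS], rule S2)
  then obtain P' where P': "polynomial_prime P'" "?A \<subseteq> P'" "P' \<inter> ?S = {}"
    by (elim exE conjE)
  interpret P': polynomial_prime P' by fact
  have PA: "P \<subseteq> ?A"
  proof
    fix p assume "p \<in> P"
    then have "p = p + ?l * 0" "p \<in> P" "0 \<in> polys_in UNIV" using sr(2) by auto
    then show "p \<in> ?A" by blast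
  qed
  have "?l = 0 + ?l * 1" by simp
  then have lA: "?l \<in> ?A" using P.P_zero one by blast
  have lP: "?l \<notin> P"
  proof
    assume "?l \<in> P"
    then have "?l = 0" using lT T(1) by (auto simp: P.indep_def)
    then have "?l (upd_coord 0 i (c + 1)) = 0" by (simp only: zero_fun_apply)
    then show False by simp
  qed
  have "P \<subset> P'" using PA lA lP P'(2) by blast
  moreover have "P'.indep T0" using P'(3) by (auto simp: P'.indep_def)
  then have "card T0 \<le> P'.trdeg" by (rule P'.indep_card_le)
  then have "P.trdeg \<le> Suc P'.trdeg" using T(2) card_Suc_Diff1[of T i] i by (simp add: T0_def)
  ultimately show ?thesis using that P'(1) by blast
qed

section \<open>Krull dimension of Zariski closed sets\<close>

lemma topspace_zariski_topology [simp]: "topspace (zariski_topology X) = UNIV"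
proof -
  have "(\<lambda>_. 1) \<in> poly_functions X" by (rule poly_functions.const)
  then have "openin (zariski_topology X) UNIV"
    unfolding openin_zariski_topology by (intro exI[of _ "{\<lambda>_. 1}"]) auto
  then show ?thesis using openin_subset by blast
qed

lemma closedin_zariski_topology:
  "closedin (zariski_topology X) A \<longleftrightarrow> (\<exists>F \<subseteq> poly_functions X. A = {x. \<forall>f\<in>F. f x = 0})"
  by (simp add: closedin_def openin_zariski_topology Compl_eq_Diff_UNIV[symmetric])

lemma closedin_zariski_zero: "f \<in> poly_functions X \<Longrightarrow> closedin (zariski_topology X) {x. f x = 0}"
  unfolding closedin_zariski_topology by (intro exI[of _ "{f}"]) auto

lemma vanishing_ideal_alt: "vanishing_ideal W = {f \<in> polys_in UNIV. \<forall>x\<in>W. f x = 0}"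
  by (simp add: vanishing_ideal_def polys_in_UNIV)

lemma vanishing_ideal_antimono: "V \<subseteq> W \<Longrightarrow> vanishing_ideal W \<subseteq> vanishing_ideal V"
  by (auto simp: vanishing_ideal_alt)

lemma closed_eq_zeros:
  assumes "closedin zariski W"
  shows "W = {x. \<forall>f\<in>vanishing_ideal W. f x = 0}"
proof -
  obtain F where F: "F \<subseteq> poly_functions coords" "W = {x. \<forall>f\<in>F. f x = 0}"
    using assms unfolding closedin_zariski_topology by blast
  then have "F \<subseteq> vanishing_ideal W" by (auto simp: vanishing_ideal_def)
  then show ?thesis using F(2) by (auto simp: vanishing_ideal_def)
qed

lemma prime_ideal_of_functions:
  assumes "subring R" "\<exists>x. x \<in> W"
    and "\<And>f g. f \<in> R \<Longrightarrow> g \<in> R \<Longrightarrow> (\<And>x. x \<in> W \<Longrightarrow> f x * g x = 0) \<Longrightarrow>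
      (\<forall>x\<in>W. f x = 0) \<or> (\<forall>x\<in>W. g x = (0::complex))"
  shows "prime_ideal_in R {f \<in> R. \<forall>x\<in>W. f x = 0}"
proof
  note sr = subringD[OF assms(1)]
  show "subring R" by fact
  show "{f \<in> R. \<forall>x\<in>W. f x = 0} \<subseteq> R" by blast
  show "0 \<in> {f \<in> R. \<forall>x\<in>W. f x = 0}" using sr(2) by simp
  show "a + b \<in> {f \<in> R. \<forall>x\<in>W. f x = 0}" if "a \<in> {f \<in> R. \<forall>x\<in>W. f x = 0}" "b \<in> {f \<in> R. \<forall>x\<in>W. f x = 0}" for a b
    using that sr(4)[of a b] by simp
  show "a * b \<in> {f \<in> R. \<forall>x\<in>W. f x = 0}" if "a \<in> R" "b \<in> {f \<in> R. \<forall>x\<in>W. f x = 0}" for a b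
    using that sr(5)[of a b] by simp
  show "1 \<notin> {f \<in> R. \<forall>x\<in>W. f x = 0}" using assms(2) by auto
  show "a \<in> {f \<in> R. \<forall>x\<in>W. f x = 0} \<or> b \<in> {f \<in> R. \<forall>x\<in>W. f x = 0}"
    if ab: "a \<in> R" "b \<in> R" "a * b \<in> {f \<in> R. \<forall>x\<in>W. f x = 0}" for a b
  proof -
    have "a x * b x = 0" if "x \<in> W" for x
      using ab(3) that by (auto simp only: mem_Collect_eq times_fun_apply)
    then show ?thesis using assms(3)[OF ab(1,2)] ab(1,2) by simp
  qed
qed

lemma irreducible_prime:
  assumes "irreducible_in zariski W"
  shows "polynomial_prime (vanishing_ideal W)"
proof -
  have "prime_ideal_in (polys_in UNIV) {f \<in> polys_in UNIV. \<forall>x\<in>W. f x = 0}"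
  proof (rule prime_ideal_of_functions[OF subring_polys_in])
    show "\<exists>x. x \<in> W" using assms by (auto simp: irreducible_in_def)
    fix f g :: "complex^'a \<Rightarrow> complex"
    assume fg: "f \<in> polys_in UNIV" "g \<in> polys_in UNIV" "\<And>x. x \<in> W \<Longrightarrow> f x * g x = 0"
    have "W \<subseteq> {x. f x = 0} \<union> {x. g x = 0}" using fg(3) by auto
    moreover have "closedin zariski {x. f x = 0}" "closedin zariski {x. g x = 0}"
      using fg(1,2) by (auto simp: polys_in_UNIV intro: closedin_zariski_zero)
    ultimately have "W \<subseteq> {x. f x = 0} \<or> W \<subseteq> {x. g x = 0}"
      using assms unfolding irreducible_in_def by blast
    then show "(\<forall>x\<in>W. f x = 0) \<or> (\<forall>x\<in>W. g x = 0)" by blast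
  qed
  then show ?thesis by (simp add: polynomial_prime_def vanishing_ideal_alt)
qed

lemma prime_irreducible:
  assumes "polynomial_prime P" "vanishing_ideal W = P"
  shows "irreducible_in zariski W"
  unfolding irreducible_in_def
proof (intro conjI allI impI)
  interpret polynomial_prime P by fact
  have sep: "\<exists>f\<in>polys_in UNIV. (\<forall>x\<in>A. f x = 0) \<and> f \<notin> P" if "closedin zariski A" "\<not> W \<subseteq> A" for A
  proof -
    obtain F where F: "F \<subseteq> poly_functions coords" "A = {x. \<forall>f\<in>F. f x = 0}"
      using \<open>closedin zariski A\<close> unfolding closedin_zariski_topology by blast
    then obtain x f where xf: "x \<in> W" "f \<in> F" "f x \<noteq> 0" using \<open>\<not> W \<subseteq> A\<close> by blast
    have "f \<in> polys_in UNIV" using F(1) xf(2) by (auto simp: polys_in_UNIV)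
    moreover have "\<forall>x\<in>A. f x = 0" using F(2) xf(2) by simp
    moreover have "f \<notin> P" using xf assms(2) by (auto simp: vanishing_ideal_alt)
    ultimately show ?thesis by (intro bexI[of _ f]) simp_all
  qed
  show "W \<subseteq> topspace zariski" by simp
  show "W \<noteq> {}"
  proof
    assume "W = {}"
    then have "1 \<in> P" using assms(2) subringD(1)[OF subring_polys_in] by (auto simp: vanishing_ideal_alt)
    then show False using P_one by simp
  qed
  fix A B assume AB: "closedin zariski A" "closedin zariski B" "W \<subseteq> A \<union> B"
  show "W \<subseteq> A \<or> W \<subseteq> B"
  proof (rule ccontr)
    assume "\<not> ?thesis"
    then obtain f g where f: "f \<in> polys_in UNIV" "\<forall>x\<in>A. f x = 0" "f \<notin> P"
      and g: "g \<in> polys_in UNIV" "\<forall>x\<in>B. g x = 0" "g \<notin> P"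
      using sep[OF AB(1)] sep[OF AB(2)] by metis
    have "f * g \<in> vanishing_ideal W"
      using f g AB(3) polys_in_mult[of f UNIV g] by (auto simp: vanishing_ideal_alt)
    then show False using P_prime[OF f(1) g(1)] f(3) g(3) assms(2) by blast
  qed
qed

lemma zeros_vanishing_ideal:
  assumes "polynomial_prime P"
  shows "vanishing_ideal {x. \<forall>f\<in>P. f x = 0} = P"
proof -
  interpret polynomial_prime P by fact
  show ?thesis using vanishing_on_zeros by (simp add: vanishing_ideal_alt zeros_on_UNIV)
qed

lemma zeros_closed: "polynomial_prime P \<Longrightarrow> closedin zariski {x. \<forall>f\<in>P. f x = 0}"
  unfolding closedin_zariski_topology polys_in_UNIV[symmetric]
  using prime_ideal_in.P_sub by (intro exI[of _ P]) (auto simp: polynomial_prime_def)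

definition zariski_dim :: "(complex^'m) set \<Rightarrow> nat" where
  "zariski_dim W = polynomial_prime.trdeg (vanishing_ideal W)"

lemma chain_of_primes:
  assumes "polynomial_prime P" "r \<le> polynomial_prime.trdeg P"
  shows "\<exists>C. (\<forall>i\<le>r. closedin zariski (C i) \<and> irreducible_in zariski (C i) \<and> C i \<subseteq> {x. \<forall>f\<in>P. f x = 0}) \<and>
    (\<forall>i<r. C i \<subset> C (Suc i))"
  using assms
proof (induction r arbitrary: P)
  case 0
  then show ?case
    using zeros_closed[OF 0(1)] prime_irreducible[OF 0(1) zeros_vanishing_ideal[OF 0(1)]]
    by (intro exI[of _ "\<lambda>_. {x. \<forall>f\<in>P. f x = 0}"]) auto
next
  case (Suc r)
  let ?Z = "\<lambda>P. {x. \<forall>f\<in>P. f x = 0}"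
  have "polynomial_prime.trdeg P > 0" using Suc.prems(2) by simp
  then obtain P' where P': "polynomial_prime P'" "P \<subset> P'"
    "polynomial_prime.trdeg P \<le> Suc (polynomial_prime.trdeg P')"
    by (rule exists_larger_prime[OF Suc.prems(1)])
  then have "r \<le> polynomial_prime.trdeg P'" using Suc.prems(2) by simp
  then obtain C where C: "\<forall>i\<le>r. closedin zariski (C i) \<and> irreducible_in zariski (C i) \<and> C i \<subseteq> ?Z P'"
    "\<forall>i<r. C i \<subset> C (Suc i)"
    using Suc.IH[OF P'(1)] by blast
  have "?Z P' \<subset> ?Z P"
  proof
    show "?Z P' \<subseteq> ?Z P" using P'(2) by blast
    show "?Z P' \<noteq> ?Z P"
    proof
      assume "?Z P' = ?Z P"
      then have "vanishing_ideal (?Z P') = vanishing_ideal (?Z P)" by (rule arg_cong)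
      then have "P' = P"
        by (simp only: zeros_vanishing_ideal[OF P'(1)] zeros_vanishing_ideal[OF Suc.prems(1)])
      then show False using P'(2) by simp
    qed
  qed
  then have "C r \<subset> ?Z P" and sub: "\<forall>i\<le>r. C i \<subseteq> ?Z P" using C(1) by blast+
  define C' where "C' = C(Suc r := ?Z P)"
  have "closedin zariski (C' i) \<and> irreducible_in zariski (C' i) \<and> C' i \<subseteq> ?Z P" if "i \<le> Suc r" for i
  proof (cases "i = Suc r")
    case True
    then show ?thesis using zeros_closed[OF Suc.prems(1)]
        prime_irreducible[OF Suc.prems(1) zeros_vanishing_ideal[OF Suc.prems(1)]] by (simp add: C'_def)
  next
    case False
    then show ?thesis using that C(1) sub by (simp add: C'_def)
  qed
  moreover have "C' i \<subset> C' (Suc i)" if "i < Suc r" for i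
    using that C(2) \<open>C r \<subset> ?Z P\<close> by (cases "i = r") (auto simp: C'_def)
  ultimately show ?case by (intro exI[of _ C']) simp
qed

lemma krull_dim_le:
  assumes X: "irreducible_in zariski X" and W: "W \<subseteq> X"
  shows "krull_dim zariski W \<le> enat (zariski_dim X)"
  unfolding krull_dim_def
proof (rule SUP_least)
  fix k assume "k \<in> {k. \<exists>C. (\<forall>i\<le>k. closedin (subtopology zariski W) (C i) \<and> irreducible_in zariski (C i)) \<and>
    (\<forall>i<k. C i \<subset> C (Suc i))}"
  then obtain C where C: "\<And>i. i \<le> k \<Longrightarrow> closedin (subtopology zariski W) (C i)"
    "\<And>i. i \<le> k \<Longrightarrow> irreducible_in zariski (C i)" "\<And>i. i < k \<Longrightarrow> C i \<subset> C (Suc i)" by auto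
  have less: "zariski_dim (C i) < zariski_dim (C (Suc i))" if i: "i < k" for i
  proof -
    have "vanishing_ideal (C (Suc i)) \<subseteq> vanishing_ideal (C i)"
      using C(3)[OF i] by (intro vanishing_ideal_antimono) blast
    moreover have "vanishing_ideal (C (Suc i)) \<noteq> vanishing_ideal (C i)"
    proof
      assume eq: "vanishing_ideal (C (Suc i)) = vanishing_ideal (C i)"
      \<comment> \<open>If the ideals agreed, the closed \<open>D\<close> that cuts
        \<open>C i\<close> out of \<open>W\<close> would contain the next member as well.\<close>
      obtain D where D: "closedin zariski D" "C i = D \<inter> W"
        using C(1)[of i] i by (auto simp: closedin_subtopology)
      obtain F where F: "F \<subseteq> poly_functions coords" "D = {x. \<forall>f\<in>F. f x = 0}"
        using D(1) unfolding closedin_zariski_topology by blast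
      have "F \<subseteq> vanishing_ideal (C i)" using F D(2) by (auto simp: vanishing_ideal_def)
      then have "F \<subseteq> vanishing_ideal (C (Suc i))" using eq by simp
      then have "C (Suc i) \<subseteq> D" using F(2) by (auto simp: vanishing_ideal_def)
      moreover have "C (Suc i) \<subseteq> W" using C(1)[of "Suc i"] i closedin_subset by fastforce
      ultimately show False using C(3)[OF i] D(2) by blast
    qed
    ultimately show ?thesis
      unfolding zariski_dim_def using C(2) i
      by (intro trdeg_strict_antimono irreducible_prime) auto
  qed
  have "i \<le> zariski_dim (C i)" if "i \<le> k" for i
    using that
  proof (induction i)
    case (Suc i)
    then show ?case using less[of i] by simp
  qed simp
  then have "k \<le> zariski_dim (C k)" by simp
  also have "\<dots> \<le> zariski_dim X"
  proof (cases "vanishing_ideal X = vanishing_ideal (C k)")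
    case True
    then show ?thesis by (simp add: zariski_dim_def)
  next
    case False
    have "C k \<subseteq> X" using C(1)[of k] closedin_subset W by fastforce
    then have "vanishing_ideal X \<subset> vanishing_ideal (C k)"
      using False vanishing_ideal_antimono by blast
    then show ?thesis
      unfolding zariski_dim_def using irreducible_prime[OF X] irreducible_prime[OF C(2)[of k]]
      by (intro less_imp_le trdeg_strict_antimono) auto
  qed
  finally show "enat k \<le> enat (zariski_dim X)" by simp
qed

theorem krull_dim_eq:
  assumes X: "irreducible_in zariski X" "closedin zariski X"
  shows "krull_dim zariski X = enat (zariski_dim X)"
proof (rule antisym)
  show "krull_dim zariski X \<le> enat (zariski_dim X)" by (rule krull_dim_le[OF X(1) order_refl])
  obtain C where C: "\<forall>i\<le>zariski_dim X. closedin zariski (C i) \<and> irreducible_in zariski (C i) \<and>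
      C i \<subseteq> {x. \<forall>f\<in>vanishing_ideal X. f x = 0}" "\<forall>i<zariski_dim X. C i \<subset> C (Suc i)"
    using chain_of_primes[OF irreducible_prime[OF X(1)] order_refl] unfolding zariski_dim_def by blast
  then have "\<forall>i\<le>zariski_dim X. closedin (subtopology zariski X) (C i) \<and> irreducible_in zariski (C i)"
    using closed_eq_zeros[OF X(2)] by (auto simp: closedin_closed_subtopology[OF X(2)])
  then show "enat (zariski_dim X) \<le> krull_dim zariski X"
    unfolding krull_dim_def using C(2) by (intro SUP_upper) blast
qed

lemma local_dim_eq:
  assumes X: "irreducible_in zariski X" "closedin zariski X" and x: "x \<in> X"
  shows "local_dim X x = enat (zariski_dim X)"
  unfolding local_dim_def
proof (rule antisym)
  show "(SUP W\<in>{W. irreducible_in zariski W \<and> x \<in> W \<and> W \<subseteq> X}. krull_dim zariski W) \<le> enat (zariski_dim X)"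
    by (rule SUP_least) (use krull_dim_le[OF X(1)] in blast)
  show "enat (zariski_dim X) \<le> (SUP W\<in>{W. irreducible_in zariski W \<and> x \<in> W \<and> W \<subseteq> X}. krull_dim zariski W)"
    unfolding krull_dim_eq[OF X, symmetric] using X x by (intro SUP_upper) blast
qed

lemma tangent_space_eq: "tangent_space X x = tangent_at (vanishing_ideal X) x"
  by (simp add: tangent_space_def tangent_at_def dir_deriv_def)

lemma smooth_points_eq:
  assumes "irreducible_in zariski X" "closedin zariski X"
  shows "smooth_points X = {x \<in> X. vec.dim (tangent_at (vanishing_ideal X) x) = zariski_dim X}"
  using local_dim_eq[OF assms] by (auto simp: smooth_points_def tangent_space_eq)

section \<open>Normal spaces and smooth points\<close>

lemma polys_in_sum_fun:
  "(\<And>i. i \<in> I \<Longrightarrow> f i \<in> poly_functions X) \<Longrightarrow> (\<lambda>x. \<Sum>i\<in>I. f i x) \<in> poly_functions X"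
  by (induction I rule: infinite_finite_induct) (auto intro: poly_functions.intros)

lemma polys_in_prod_fun:
  "(\<And>i. i \<in> I \<Longrightarrow> f i \<in> poly_functions X) \<Longrightarrow> (\<lambda>x. \<Prod>i\<in>I. f i x) \<in> poly_functions X"
  by (induction I rule: infinite_finite_induct) (auto intro: poly_functions.intros)

lemma poly_functions_det:
  assumes "\<And>i j. (\<lambda>x. A x $ i $ j) \<in> poly_functions X"
  shows "(\<lambda>x. det (A x)) \<in> poly_functions X"
  unfolding det_def
  by (intro polys_in_sum_fun poly_functions.mult poly_functions.const polys_in_prod_fun assms)

lemma poly_functions_minus:
  "f \<in> poly_functions X \<Longrightarrow> g \<in> poly_functions X \<Longrightarrow> (\<lambda>x. f x - g x) \<in> poly_functions X"
  using subringD(6)[OF subring_poly_functions, of f X g] by (simp only: fun_diff_def)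

lemma poly_functions_compose:
  assumes "f \<in> polys_in T" "\<And>i. i \<in> T \<Longrightarrow> (\<lambda>x. \<phi> x $ i) \<in> poly_functions Y"
  shows "(\<lambda>x. f (\<phi> x)) \<in> poly_functions Y"
  using assms(1) by (induction rule: polys_in_induct)
    (auto simp: plus_fun_def times_fun_def intro: assms(2) poly_functions.intros)

lemma card_compl: "card (- J) = CARD('n::finite) - card (J :: 'n set)"
  by (simp add: Compl_eq_Diff_UNIV card_Diff_subset)

text \<open>A basis of \<open>G\<close> is completed by standard vectors. With these placed in their
  own rows, the basis of \<open>G\<close> fills the rest \<open>J\<close>; a single square
  determinant then records the independence.\<close>

lemma exists_coordinate_frame:
  fixes G :: "(complex^'n) set"
  assumes "vec.subspace G"
  obtains J b where "card J = vec.dim G" "\<forall>j\<in>J. b j \<in> G" "G \<subseteq> vec.span (b ` J)"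
    "det (\<chi> j. if j \<in> J then b j else axis j 1) \<noteq> 0"
proof -
  obtain B where B: "B \<subseteq> G" "vec.independent B" "G \<subseteq> vec.span B" "card B = vec.dim G"
    using vec.basis_exists by blast
  obtain D where D: "B \<subseteq> D" "D \<subseteq> B \<union> cart_basis" "vec.independent D" "B \<union> cart_basis \<subseteq> vec.span D"
    using vec.maximal_independent_subset_extend[of B "B \<union> cart_basis"] B(2) by blast
  have "vec.span cart_basis \<subseteq> vec.span D"
    using D(4) by (intro vec.span_minimal vec.subspace_span) blast
  then have spD: "vec.span D = UNIV" using span_cart_basis by auto
  have finD: "finite D" using D(3) by (rule vec.finiteI_independent)
  have "card D = vec.dim (vec.span D)" using vec.dim_eq_card_independent[OF D(3)] by simp
  then have cD: "card D = CARD('n)" unfolding spD by (simp add: card_cart_basis)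
  \<comment> \<open>The standard vectors that serve for the completion; \<open>J\<close> is the
    complement, of the same size as the basis \<open>B\<close> of \<open>G\<close>.\<close>
  define K where "K = {i. axis i 1 \<in> D - B}"
  have DB: "D - B = (\<lambda>i. axis i (1::complex)) ` K"
    using D(2) by (auto simp: K_def cart_basis_def)
  have "inj_on (\<lambda>i. axis i (1::complex)) K" by (auto simp: inj_on_def axis_eq_axis)
  then have "card (D - B) = card K" unfolding DB by (rule card_image)
  then have "card K = CARD('n) - card B" using D(1) finD cD by (simp add: card_Diff_subset finite_subset)
  moreover have "card B \<le> CARD('n)" using D(1) finD cD card_mono by metis
  ultimately have cJ: "card (- K) = card B" by (simp add: card_compl)
  have "finite B" using D(1) finD finite_subset by blast
  then obtain e where e: "bij_betw e (- K) B" using cJ finite_same_card_bij[of "- K" B] by auto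
  define A :: "complex^'n^'n" where "A = (\<chi> j. if j \<in> - K then e j else axis j 1)"
  have "rows A = D"
  proof
    have "A $ j \<in> D" for j
    proof (cases "j \<in> K")
      case True
      then show ?thesis by (simp add: A_def K_def)
    next
      case False
      then have "e j \<in> B" using e by (auto simp: bij_betw_def)
      then show ?thesis using False D(1) by (auto simp: A_def)
    qed
    then show "rows A \<subseteq> D" by (auto simp: rows_def row_def vec_lambda_eta)
    show "D \<subseteq> rows A"
    proof
      fix y assume y: "y \<in> D"
      have "\<exists>j. A $ j = y"
      proof (cases "y \<in> B")
        case True
        then obtain j where "j \<in> - K" "e j = y" using e by (auto simp: bij_betw_def)
        then show ?thesis by (intro exI[of _ j]) (simp add: A_def)
      next
        case False
        then obtain j where "j \<in> K" "y = axis j 1" using y DB by blast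
        then show ?thesis by (intro exI[of _ j]) (simp add: A_def)
      qed
      then show "y \<in> rows A" by (auto simp: rows_def row_def vec_lambda_eta)
    qed
  qed
  then have "\<exists>C. C ** A = mat 1" using matrix_left_invertible_span_rows_gen[of A] spD by simp
  then have "invertible A" by (metis invertible_def matrix_left_right_inverse)
  then have "det A \<noteq> 0" by (simp add: invertible_det_nz)
  moreover have "card (- K) = vec.dim G" using cJ B(4) by simp
  moreover have "\<forall>j\<in>- K. e j \<in> G" using e B(1) by (auto simp: bij_betw_def)
  moreover have "e ` (- K) = B" using e by (simp add: bij_betw_def)
  ultimately show ?thesis using that[of "- K" e] B(3) unfolding A_def by simp
qed

lemma grad_linear:
  assumes "f \<in> polys_in UNIV" "g \<in> polys_in UNIV"
  shows "grad (f + g) x = grad f x + grad g x" "grad ((\<lambda>_. c) * f) x = c *s grad f x"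
  by (simp_all only: vec_eq_iff grad_nth dir_deriv_add[OF assms] vector_add_component
      dir_deriv_mult[OF polys_in_const assms(1)] dir_deriv_const vector_smult_component
      mult_zero_right add_0_right simp_thms)

lemma subspace_gradients: "vec.subspace {grad f x | f. f \<in> vanishing_ideal X}"
  unfolding vec.subspace_def
proof (intro conjI ballI allI)
  have sr: "subring (polys_in UNIV :: (complex^'a \<Rightarrow> complex) set)" by (rule subring_polys_in)
  have "grad 0 x = 0" by (simp add: vec_eq_iff grad_nth)
  then show "0 \<in> {grad f x | f. f \<in> vanishing_ideal X}"
    using subringD(2)[OF sr] by (intro CollectI exI[of _ 0]) (simp add: vanishing_ideal_alt)
  fix y assume "y \<in> {grad f x | f. f \<in> vanishing_ideal X}"
  then obtain f where f: "y = grad f x" "f \<in> vanishing_ideal X" by blast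
  then have fR: "f \<in> polys_in UNIV" by (simp add: vanishing_ideal_alt)
  {
    fix c
    have "(\<lambda>_. c) * f \<in> vanishing_ideal X"
      using f(2) polys_in_mult[OF polys_in_const fR] by (simp add: vanishing_ideal_alt)
    then show "c *s y \<in> {grad f x | f. f \<in> vanishing_ideal X}"
      using grad_linear(2)[OF fR fR, of c x] f(1) by (metis (mono_tags, lifting) mem_Collect_eq)
  }
  fix z assume "z \<in> {grad f x | f. f \<in> vanishing_ideal X}"
  then obtain g where g: "z = grad g x" "g \<in> vanishing_ideal X" by blast
  then have gR: "g \<in> polys_in UNIV" by (simp add: vanishing_ideal_alt)
  have "f + g \<in> vanishing_ideal X"
    using f(2) g(2) polys_in_add[OF fR gR] by (simp add: vanishing_ideal_alt)
  then show "y + z \<in> {grad f x | f. f \<in> vanishing_ideal X}"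
    using grad_linear(1)[OF fR gR, of x] f(1) g(1) by (metis (mono_tags, lifting) mem_Collect_eq)
qed

lemma bilin_sum: "bilin y v = (\<Sum>i\<in>UNIV. y $ i * v $ i)"
  by (simp add: bilin_def)

lemma bilin_add: "bilin (x + y) v = bilin x v + bilin y v"
  and bilin_scale: "bilin (c *s x) v = c * bilin x v"
  and bilin_diff: "bilin (x - y) v = bilin x v - bilin y v"
  by (simp_all add: bilin_sum algebra_simps sum.distrib sum_distrib_left sum_subtractf)

lemma bilin_commute: "bilin x y = bilin y x"
  by (simp add: bilin_sum mult.commute)

lemma dir_deriv_eq_bilin: "f \<in> polys_in UNIV \<Longrightarrow> dir_deriv x v f = bilin (grad f x) v"
  by (simp add: dir_deriv_eq_grad bilin_sum mult.commute)

lemma grad_in_normal_space: "f \<in> vanishing_ideal X \<Longrightarrow> grad f x \<in> normal_space X x"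
  by (auto simp: normal_space_def tangent_space_eq tangent_at_def vanishing_ideal_alt dir_deriv_eq_bilin)

lemma subspace_normal_space: "vec.subspace (normal_space X x)"
  unfolding vec.subspace_def normal_space_def
  by (simp add: bilin_add bilin_scale) (simp add: bilin_sum)

text \<open>Filling the rows outside \<open>J\<close> with standard vectors makes the matrix square,
  so independence of the chosen gradients holds where one polynomial, its determinant, is nonzero.
  The standard rows also leave the coordinates in \<open>J\<close> free on each normal
  space.\<close>

definition frame_matrix :: "'n set \<Rightarrow> ('n \<Rightarrow> complex^'n \<Rightarrow> complex) \<Rightarrow> complex^'n \<Rightarrow> complex^'n^'n" where
  "frame_matrix J w x = (\<chi> j. if j \<in> J then grad (w j) x else axis j 1)"

lemma frame_matrix_poly:
  assumes "\<forall>j. w j \<in> vanishing_ideal X"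
  shows "(\<lambda>x. frame_matrix J w x $ j $ i) \<in> polys_in UNIV"
proof (cases "j \<in> J")
  case True
  then show ?thesis using spec[OF assms(1), of j] by (simp add: frame_matrix_def vanishing_ideal_alt grad_polys_in)
qed (simp add: frame_matrix_def)

lemma frame_det_poly:
  assumes "\<forall>j. w j \<in> vanishing_ideal X"
  shows "(\<lambda>x. det (frame_matrix J w x)) \<in> polys_in UNIV"
  unfolding polys_in_UNIV
  by (rule poly_functions_det) (rule frame_matrix_poly[OF assms, unfolded polys_in_UNIV])

definition frame_kernel :: "'n set \<Rightarrow> complex^'n^'n \<Rightarrow> (complex^'n) set" where
  "frame_kernel J M = {v. \<forall>j\<in>J. (M *v v) $ j = 0}"

lemma frame_kernel_dim:
  fixes M :: "complex^'n^'n"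
  assumes "det M \<noteq> 0"
  shows "vec.subspace (frame_kernel J M)" "vec.dim (frame_kernel J M) = card (- J)"
proof -
  have lin: "Vector_Spaces.linear (*s) (*s) ((*v) M)" by simp
  show sub: "vec.subspace (frame_kernel J M)"
    unfolding vec.subspace_def frame_kernel_def
    by (simp add: matrix_vector_right_distrib vector_scalar_commute)
  have "invertible M" using assms by (simp add: invertible_det_nz)
  then obtain A where A: "M ** A = mat 1" "A ** M = mat 1" by (auto simp: invertible_def)
  have MA: "M *v (A *v w) = w" "A *v (M *v w) = w" for w
    using A by (simp_all add: matrix_vector_mul_assoc)
  have "(*v) M ` frame_kernel J M = {w. \<forall>j. j \<notin> - J \<longrightarrow> w $ j = 0}"
  proof
    show "(*v) M ` frame_kernel J M \<subseteq> {w. \<forall>j. j \<notin> - J \<longrightarrow> w $ j = 0}" by (auto simp: frame_kernel_def)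
    show "{w. \<forall>j. j \<notin> - J \<longrightarrow> w $ j = 0} \<subseteq> (*v) M ` frame_kernel J M"
    proof
      fix w :: "complex^'n" assume "w \<in> {w. \<forall>j. j \<notin> - J \<longrightarrow> w $ j = 0}"
      then have "A *v w \<in> frame_kernel J M" by (simp add: frame_kernel_def MA)
      then show "w \<in> (*v) M ` frame_kernel J M" using MA(1)[of w] by (intro image_eqI[of _ _ "A *v w"]) simp_all
    qed
  qed
  moreover have "vec.dim ((*v) M ` frame_kernel J M) = vec.dim (frame_kernel J M)"
  proof (rule vec.dim_image_eq[OF lin])
    show "inj_on ((*v) M) (vec.span (frame_kernel J M))"
      by (rule inj_on_inverseI[of _ "(*v) A"]) (rule MA(2))
  qed
  ultimately have "vec.dim (frame_kernel J M) = vec.dim {w :: complex^'n. \<forall>j. j \<notin> - J \<longrightarrow> w $ j = 0}"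
    by metis
  then show "vec.dim (frame_kernel J M) = card (- J)" by (simp only: dim_substandard_cart)
qed

lemma frame_matrix_mult:
  "j \<in> J \<Longrightarrow> (frame_matrix J w x *v v) $ j = bilin (grad (w j) x) v"
  by (simp add: frame_matrix_def matrix_vector_mult_def bilin_sum)

lemma tangent_subset_frame_kernel:
  assumes "\<forall>j. w j \<in> vanishing_ideal X"
  shows "tangent_at (vanishing_ideal X) x \<subseteq> frame_kernel J (frame_matrix J w x)"
proof
  fix v assume v: "v \<in> tangent_at (vanishing_ideal X) x"
  have "dir_deriv x v (w j) = 0" for j using v spec[OF assms(1), of j] by (simp add: tangent_at_def)
  moreover have "w j \<in> polys_in UNIV" for j using spec[OF assms(1), of j] by (simp add: vanishing_ideal_alt)
  ultimately show "v \<in> frame_kernel J (frame_matrix J w x)"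
    by (simp add: frame_kernel_def frame_matrix_mult dir_deriv_eq_bilin[symmetric])
qed

text \<open>A coordinate frame for the space of all gradients at \<open>x\<close>. Its rows in
  \<open>J\<close> span that space, so their common kernel is the whole tangent space.\<close>

lemma exists_frame:
  fixes X :: "(complex^'n) set"
  obtains J w where "\<forall>j. w j \<in> vanishing_ideal X" "det (frame_matrix J w x) \<noteq> 0"
    "card J + vec.dim (tangent_at (vanishing_ideal X) x) = CARD('n)"
proof -
  let ?G = "{grad f x | f. f \<in> vanishing_ideal X}"
  obtain J b where J: "card J = vec.dim ?G" "\<forall>j\<in>J. b j \<in> ?G" "?G \<subseteq> vec.span (b ` J)"
    "det (\<chi> j. if j \<in> J then b j else axis j 1) \<noteq> 0"
    by (rule exists_coordinate_frame[OF subspace_gradients[of x X]])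
  have "\<forall>j. \<exists>f. f \<in> vanishing_ideal X \<and> (j \<in> J \<longrightarrow> b j = grad f x)"
  proof
    fix j
    have "0 \<in> vanishing_ideal X"
      using subringD(2)[OF subring_polys_in[of UNIV]] by (simp add: vanishing_ideal_alt)
    then show "\<exists>f. f \<in> vanishing_ideal X \<and> (j \<in> J \<longrightarrow> b j = grad f x)"
      using J(2) by (cases "j \<in> J") auto
  qed
  then obtain w where w: "\<forall>j. w j \<in> vanishing_ideal X" "\<And>j. j \<in> J \<Longrightarrow> b j = grad (w j) x"
    unfolding choice_iff by blast
  have fm: "frame_matrix J w x = (\<chi> j. if j \<in> J then b j else axis j 1)"
    using w(2) by (simp add: frame_matrix_def vec_eq_iff)
  have det: "det (frame_matrix J w x) \<noteq> 0" unfolding fm by (rule J(4))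
  have "frame_kernel J (frame_matrix J w x) \<subseteq> tangent_at (vanishing_ideal X) x"
  proof
    fix v assume v: "v \<in> frame_kernel J (frame_matrix J w x)"
    have "vec.subspace {y. bilin y v = 0}"
      unfolding vec.subspace_def by (simp add: bilin_add bilin_scale) (simp add: bilin_sum)
    moreover have "b ` J \<subseteq> {y. bilin y v = 0}"
      using v w(2) by (auto simp: frame_kernel_def frame_matrix_mult)
    ultimately have "?G \<subseteq> {y. bilin y v = 0}" using J(3) vec.span_minimal by blast
    then show "v \<in> tangent_at (vanishing_ideal X) x"
      by (auto simp: tangent_at_def vanishing_ideal_alt dir_deriv_eq_bilin)
  qed
  then have "tangent_at (vanishing_ideal X) x = frame_kernel J (frame_matrix J w x)"
    using tangent_subset_frame_kernel[OF w(1)] by blast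
  then have "vec.dim (tangent_at (vanishing_ideal X) x) = card (- J)"
    using frame_kernel_dim(2)[OF det] by simp
  then have "card J + vec.dim (tangent_at (vanishing_ideal X) x) = CARD('n)"
    using card_mono[of UNIV J] by (simp add: card_compl)
  then show ?thesis using that[of w J] w(1) det by blast
qed

text \<open>Semicontinuity: where the chosen gradients stay independent, the tangent space lies in a
  kernel of fixed dimension.\<close>

lemma tangent_dim_le:
  fixes X :: "(complex^'n) set"
  assumes "\<forall>j. w j \<in> vanishing_ideal X" "det (frame_matrix J w x) \<noteq> 0"
  shows "card J + vec.dim (tangent_at (vanishing_ideal X) x) \<le> CARD('n)"
proof -
  have "vec.dim (tangent_at (vanishing_ideal X) x) \<le> card (- J)"
    using vec.dim_subset[OF tangent_subset_frame_kernel[OF assms(1), of x J]]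
      frame_kernel_dim(2)[OF assms(2)] by simp
  then show ?thesis using card_mono[of UNIV J] by (simp add: card_compl)
qed

text \<open>By the dimension hypothesis the tangent space fills the kernel of the rows in
  \<open>J\<close>, and the annihilator of that kernel is the span of these rows.\<close>

lemma normal_space_frame:
  fixes X :: "(complex^'n) set"
  assumes w: "\<forall>j. w j \<in> vanishing_ideal X" and det: "det (frame_matrix J w x) \<noteq> 0"
    and dim: "card J + vec.dim (tangent_at (vanishing_ideal X) x) = CARD('n)"
  shows "y \<in> normal_space X x \<longleftrightarrow>
    (\<exists>c. (\<forall>j. j \<notin> J \<longrightarrow> c $ j = 0) \<and> y = transpose (frame_matrix J w x) *v c)"
proof -
  let ?M = "frame_matrix J w x" and ?T = "tangent_at (vanishing_ideal X) x"
  have subT: "vec.subspace ?T" by (rule subspace_tangent_at) (auto simp: vanishing_ideal_alt)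
  have "vec.dim (frame_kernel J ?M) \<le> vec.dim ?T"
    using frame_kernel_dim(2)[OF det, of J] dim by (simp add: card_compl)
  then have T: "?T = frame_kernel J ?M"
    by (intro vec.subspace_dim_equal subT frame_kernel_dim(1)[OF det] tangent_subset_frame_kernel[OF w])
  have tr: "bilin (transpose ?M *v c) v = bilin c (?M *v v)" for c v
  proof -
    have "bilin (transpose ?M *v c) v = (\<Sum>i\<in>UNIV. \<Sum>j\<in>UNIV. ?M $ j $ i * c $ j * v $ i)"
      by (simp add: bilin_sum matrix_vector_mult_def transpose_def sum_distrib_right)
    also have "\<dots> = (\<Sum>j\<in>UNIV. \<Sum>i\<in>UNIV. ?M $ j $ i * c $ j * v $ i)" by (rule sum.swap)
    also have "\<dots> = bilin c (?M *v v)"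
      by (simp add: bilin_sum matrix_vector_mult_def sum_distrib_left mult_ac)
    finally show ?thesis .
  qed
  show ?thesis
  proof
    assume y: "y \<in> normal_space X x"
    have "invertible ?M" using det by (simp add: invertible_det_nz)
    then obtain A where A: "?M ** A = mat 1" "A ** ?M = mat 1" by (auto simp: invertible_def)
    define c where "c = transpose A *v y"
    have "transpose ?M *v c = y"
      by (simp only: c_def matrix_vector_mul_assoc matrix_transpose_mul[symmetric] A(2)
          transpose_mat matrix_vector_mul_lid)
    moreover have "c $ k = 0" if k: "k \<notin> J" for k
    proof -
      \<comment> \<open>Row \<open>k\<close> is outside \<open>J\<close>, so this vector is tangent,
        and pairing \<open>y\<close> with it isolates the coefficient \<open>c $ k\<close>.\<close>
      let ?v = "A *v axis k 1"
      have Mv: "?M *v ?v = axis k 1" using A(1) by (simp add: matrix_vector_mul_assoc)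
      then have "?v \<in> ?T" using k by (auto simp: T frame_kernel_def axis_def)
      then have "bilin y ?v = 0" using y by (simp add: normal_space_def tangent_space_eq)
      moreover have "bilin y ?v = bilin c (?M *v ?v)"
        using tr[of c ?v] \<open>transpose ?M *v c = y\<close> by simp
      moreover have "bilin c (axis k 1) = c $ k"
        by (simp add: bilin_sum axis_def if_distrib[of "\<lambda>t. _ * t"] cong: if_cong)
      ultimately show ?thesis by (simp only: Mv)
    qed
    ultimately show "\<exists>c. (\<forall>j. j \<notin> J \<longrightarrow> c $ j = 0) \<and> y = transpose ?M *v c" by metis
  next
    assume "\<exists>c. (\<forall>j. j \<notin> J \<longrightarrow> c $ j = 0) \<and> y = transpose ?M *v c"
    then obtain c where c: "\<forall>j. j \<notin> J \<longrightarrow> c $ j = 0" "y = transpose ?M *v c" by blast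
    have "bilin y v = 0" if "v \<in> ?T" for v
    proof -
      have z: "c $ j * (?M *v v) $ j = 0" for j
        using that c(1) by (cases "j \<in> J") (auto simp: T frame_kernel_def)
      show ?thesis unfolding c(2) tr unfolding bilin_sum by (intro sum.neutral ballI z)
    qed
    then show "y \<in> normal_space X x" by (simp add: normal_space_def tangent_space_eq)
  qed
qed

text \<open>Extends one normal vector to the field \<open>grad f\<close>, which is normal to
  \<open>X\<close> at every point; this makes it possible to move points of the correspondence from
  fibre to fibre.\<close>

lemma normal_space_eq_gradients:
  fixes X :: "(complex^'n) set"
  assumes "y \<in> normal_space X x"
  obtains f where "f \<in> vanishing_ideal X" "y = grad f x"
proof -
  obtain J w where w: "\<forall>j. w j \<in> vanishing_ideal X" and det: "det (frame_matrix J w x) \<noteq> 0"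
    and dim: "card J + vec.dim (tangent_at (vanishing_ideal X) x) = CARD('n)"
    by (rule exists_frame)
  obtain c where c: "\<forall>j. j \<notin> J \<longrightarrow> c $ j = 0" "y = transpose (frame_matrix J w x) *v c"
    using normal_space_frame[OF w det dim] assms by blast
  have "y = (\<Sum>j\<in>UNIV. c $ j *s frame_matrix J w x $ j)"
    unfolding c(2) vec_eq_iff by (simp add: matrix_vector_mult_def transpose_def mult.commute)
  also have "\<dots> \<in> {grad f x | f. f \<in> vanishing_ideal X}"
  proof (intro vec.subspace_sum subspace_gradients)
    fix j
    show "c $ j *s frame_matrix J w x $ j \<in> {grad f x | f. f \<in> vanishing_ideal X}"
    proof (cases "j \<in> J")
      case True
      have "grad (w j) x \<in> {grad f x | f. f \<in> vanishing_ideal X}" using w by blast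
      then show ?thesis using True
        by (simp only: frame_matrix_def vec_lambda_beta if_True vec.subspace_scale[OF subspace_gradients])
    next
      case False
      then show ?thesis using c(1) vec.subspace_0[OF subspace_gradients[of x X]] by simp
    qed
  qed
  finally show ?thesis using that by blast
qed

text \<open>A frame at \<open>x\<close> bounds the tangent dimension on a nonempty open set by its
  value at \<open>x\<close>, and that set contains a general point, where the value is the
  transcendence degree.\<close>

lemma tangent_dim_ge:
  assumes X: "irreducible_in zariski X" "closedin zariski X" and x: "x \<in> X"
  shows "zariski_dim X \<le> vec.dim (tangent_at (vanishing_ideal X) x)"
proof -
  interpret polynomial_prime "vanishing_ideal X" by (rule irreducible_prime[OF X(1)])
  obtain J w where w: "\<forall>j. w j \<in> vanishing_ideal X" and det: "det (frame_matrix J w x) \<noteq> 0"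
    and dim: "card J + vec.dim (tangent_at (vanishing_ideal X) x) = CARD('a)"
    by (rule exists_frame)
  obtain g where g: "g \<in> polys_in UNIV" "g \<notin> vanishing_ideal X"
    "\<And>x. x \<in> zeros_on UNIV \<Longrightarrow> g x \<noteq> 0 \<Longrightarrow> vec.dim (tangent_at (vanishing_ideal X) x) = trdeg"
    by (rule trdeg_generic_dim, rule that) blast+
  let ?D = "\<lambda>x. det (frame_matrix J w x)"
  have D: "?D \<in> polys_in UNIV" by (rule frame_det_poly[OF w])
  have "?D \<notin> vanishing_ideal X" using x det by (auto simp: vanishing_ideal_alt)
  then have "?D * g \<notin> vanishing_ideal X" using P_prime D g by blast
  then obtain z where z: "z \<in> zeros_on UNIV" "(?D * g) z \<noteq> 0"
    using nullstellensatz polys_in_mult[OF D g(1)] by blast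
  then have "?D z \<noteq> 0" "g z \<noteq> 0" by auto
  then show ?thesis
    using tangent_dim_le[OF w \<open>?D z \<noteq> 0\<close>] g(3)[OF z(1)] dim by (simp add: zariski_dim_def)
qed

text \<open>The Jacobian criterion with a local frame of the normal bundle: where the determinant is
  nonzero, the frame bounds the tangent dimension from above and \<open>tangent_dim_ge\<close> from
  below, so smoothness and the description of normals spread from \<open>x\<close> to a
  neighbourhood.\<close>

lemma smooth_frame:
  fixes X :: "(complex^'n) set"
  assumes X: "irreducible_in zariski X" "closedin zariski X" and x: "x \<in> smooth_points X"
  obtains J w where "\<forall>j. w j \<in> vanishing_ideal X" "det (frame_matrix J w x) \<noteq> 0"
    "card J + zariski_dim X = CARD('n)"
    "\<forall>z\<in>X. det (frame_matrix J w z) \<noteq> 0 \<longrightarrow> z \<in> smooth_points X \<and>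
      (\<forall>y. y \<in> normal_space X z \<longleftrightarrow>
        (\<exists>c. (\<forall>j. j \<notin> J \<longrightarrow> c $ j = 0) \<and> y = transpose (frame_matrix J w z) *v c))"
proof -
  obtain J w where w: "\<forall>j. w j \<in> vanishing_ideal X" and det: "det (frame_matrix J w x) \<noteq> 0"
    and dim: "card J + vec.dim (tangent_at (vanishing_ideal X) x) = CARD('n)"
    by (rule exists_frame)
  have card: "card J + zariski_dim X = CARD('n)" using dim x by (simp add: smooth_points_eq[OF X])
  have dz: "vec.dim (tangent_at (vanishing_ideal X) z) = zariski_dim X"
    if "z \<in> X" "det (frame_matrix J w z) \<noteq> 0" for z
    using tangent_dim_le[OF w that(2)] tangent_dim_ge[OF X that(1)] card by simp
  show ?thesis
  proof (rule that[OF w det card], intro ballI impI conjI allI)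
    fix z assume z: "z \<in> X" "det (frame_matrix J w z) \<noteq> 0"
    then show "z \<in> smooth_points X" using dz by (simp add: smooth_points_eq[OF X])
    fix y
    show "y \<in> normal_space X z \<longleftrightarrow>
      (\<exists>c. (\<forall>j. j \<notin> J \<longrightarrow> c $ j = 0) \<and> y = transpose (frame_matrix J w z) *v c)"
      by (rule normal_space_frame[OF w z(2)]) (simp add: dz[OF z] card)
  qed
qed

section \<open>Pulling back towers along coordinate projections\<close>

definition proj_coords :: "('n \<Rightarrow> 'm) \<Rightarrow> complex^'m \<Rightarrow> complex^'n" where
  "proj_coords \<sigma> p = (\<chi> i. p $ \<sigma> i)"

lemma proj_coords_nth [simp]: "proj_coords \<sigma> p $ i = p $ \<sigma> i"
  by (simp add: proj_coords_def)

lemma polys_in_proj_coords: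
  "f \<in> polys_in U \<Longrightarrow> (\<lambda>p. f (proj_coords \<sigma> p)) \<in> polys_in (\<sigma> ` U)"
  unfolding polys_in_def[of "\<sigma> ` U"]
  by (rule poly_functions_compose) (auto intro: poly_functions.coord)

lemma polys_in_proj_coordsE:
  assumes "g \<in> polys_in (\<sigma> ` U)"
  obtains f where "f \<in> polys_in U" "g = (\<lambda>p. f (proj_coords \<sigma> p))"
proof -
  from assms have "\<exists>f\<in>polys_in U. g = (\<lambda>p. f (proj_coords \<sigma> p))"
  proof (induction rule: polys_in_induct)
    case (coord i)
    then obtain j where "j \<in> U" "i = \<sigma> j" by blast
    then show ?case by (intro bexI[of _ "coord_fun j"]) (auto intro: polys_in_coord)
  next
    case (const c)
    show ?case by (intro bexI[of _ "\<lambda>_. c"]) auto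
  next
    case (add f g)
    then obtain f' g' where "f' \<in> polys_in U" "g' \<in> polys_in U"
      "f = (\<lambda>p. f' (proj_coords \<sigma> p))" "g = (\<lambda>p. g' (proj_coords \<sigma> p))" by blast
    then show ?case by (intro bexI[of _ "f' + g'"] polys_in_add) (auto simp: plus_fun_def)
  next
    case (mult f g)
    then obtain f' g' where "f' \<in> polys_in U" "g' \<in> polys_in U"
      "f = (\<lambda>p. f' (proj_coords \<sigma> p))" "g = (\<lambda>p. g' (proj_coords \<sigma> p))" by blast
    then show ?case by (intro bexI[of _ "f' * g'"] polys_in_mult) (auto simp: times_fun_def)
  qed
  then show ?thesis using that by blast
qed

text \<open>The hypothesis says that \<open>P\<close> is the contraction of \<open>P'\<close> along
  the pullback, so relations over the two rings correspond coefficient by coefficient.\<close>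

lemma alg_proj_coords:
  fixes P :: "(complex^'n \<Rightarrow> complex) set" and P' :: "(complex^'m \<Rightarrow> complex) set"
  assumes "polynomial_prime P" "polynomial_prime P'"
    and PP: "\<And>f. f \<in> polys_in UNIV \<Longrightarrow> f \<in> P \<longleftrightarrow> (\<lambda>p. f (proj_coords \<sigma> p)) \<in> P'"
  shows "polynomial_prime.alg P' (\<sigma> ` U) (\<sigma> i) \<longleftrightarrow> polynomial_prime.alg P U i"
proof -
  interpret P: polynomial_prime P by fact
  interpret P': polynomial_prime P' by fact
  let ?\<Phi> = "\<lambda>f p. f (proj_coords \<sigma> p)"
  have Phi0: "?\<Phi> 0 = 0" by (simp add: zero_fun_def)
  have cm: "coeff (map_poly ?\<Phi> r) k = ?\<Phi> (coeff r k)" for r k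
    by (rule coeff_map_poly) (rule Phi0)
  have poly: "poly (map_poly ?\<Phi> r) (coord_fun (\<sigma> i)) = ?\<Phi> (poly r (coord_fun i))" for r
  proof
    fix p
    have "eval_poly p (map_poly ?\<Phi> r) = eval_poly (proj_coords \<sigma> p) r"
      by (intro poly_eqI) (simp only: coeff_eval_poly cm)
    then show "poly (map_poly ?\<Phi> r) (coord_fun (\<sigma> i)) p = ?\<Phi> (poly r (coord_fun i)) p"
      by (simp add: poly_fun_apply)
  qed
  have rel: "(coeffs_in (polys_in (\<sigma> ` U)) (map_poly ?\<Phi> r) \<and> \<not> coeffs_in P' (map_poly ?\<Phi> r) \<and>
      poly (map_poly ?\<Phi> r) (coord_fun (\<sigma> i)) \<in> P') \<longleftrightarrow> (\<not> coeffs_in P r \<and> poly r (coord_fun i) \<in> P)"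
    if r: "coeffs_in (polys_in U) r" for r
  proof -
    have cU: "coeff r k \<in> polys_in U" for k using r by (simp add: coeffs_in_def)
    have cR: "coeff r k \<in> polys_in UNIV" for k using cU P.polys_in_sub by blast
    have pR: "poly r (coord_fun i) \<in> polys_in UNIV"
      using poly_coord_in[OF r, of i] P.polys_in_sub by blast
    have c\<Phi>: "?\<Phi> (coeff r k) \<in> polys_in (\<sigma> ` U)" for k by (rule polys_in_proj_coords[OF cU])
    show ?thesis
      unfolding poly coeffs_in_def cm by (simp only: c\<Phi> PP[OF cR] PP[OF pR] simp_thms)
  qed
  show ?thesis
  proof
    assume "P.alg U i"
    then obtain r where r: "coeffs_in (polys_in U) r" "\<not> coeffs_in P r" "poly r (coord_fun i) \<in> P"
      by (auto simp: P.alg_def P.algebraic_over_def)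
    then show "P'.alg (\<sigma> ` U) (\<sigma> i)"
      unfolding P'.alg_def P'.algebraic_over_def using rel[OF r(1)] by blast
  next
    assume "P'.alg (\<sigma> ` U) (\<sigma> i)"
    then obtain q where q: "coeffs_in (polys_in (\<sigma> ` U)) q" "\<not> coeffs_in P' q"
      "poly q (coord_fun (\<sigma> i)) \<in> P'"
      by (auto simp: P'.alg_def P'.algebraic_over_def)
    have "\<exists>f. f \<in> polys_in U \<and> coeff q k = ?\<Phi> f" for k
    proof -
      have "coeff q k \<in> polys_in (\<sigma> ` U)" using q(1) by (simp add: coeffs_in_def)
      then show ?thesis by (rule polys_in_proj_coordsE) blast
    qed
    then obtain c where c: "\<And>k. c k \<in> polys_in U" "\<And>k. coeff q k = ?\<Phi> (c k)" by metis
    define r where "r = (\<Sum>k\<le>degree q. monom (c k) k)"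
    have cr: "coeff r k = (if k \<le> degree q then c k else 0)" for k
      by (auto simp: r_def coeff_sum)
    have r: "coeffs_in (polys_in U) r"
      using c(1) subringD(2)[OF subring_polys_in[of U]] by (simp add: coeffs_in_def cr)
    have "map_poly ?\<Phi> r = q"
    proof (rule poly_eqI)
      fix k
      show "coeff (map_poly ?\<Phi> r) k = coeff q k"
      proof (cases "k \<le> degree q")
        case True
        then show ?thesis by (simp only: cm cr c(2) if_True)
      next
        case False
        then have "coeff q k = 0" by (intro coeff_eq_0) simp
        then show ?thesis using False Phi0 by (simp only: cm cr if_False)
      qed
    qed
    then have "\<not> coeffs_in P r \<and> poly r (coord_fun i) \<in> P" using rel[OF r] q by simp
    then show "P.alg U i" unfolding P.alg_def P.algebraic_over_def using r by blast
  qed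
qed

text \<open>Starts a tower of the correspondence with a complete tower of one of its projections:
  \<open>Z\<close> through the first factor, the data locus through the second.\<close>

lemma tower_proj_coords:
  fixes P :: "(complex^'n \<Rightarrow> complex) set" and P' :: "(complex^'m \<Rightarrow> complex) set"
  assumes P: "polynomial_prime P" and P': "polynomial_prime P'" and "inj \<sigma>"
    and PP: "\<And>f. f \<in> polys_in UNIV \<Longrightarrow> f \<in> P \<longleftrightarrow> (\<lambda>p. f (proj_coords \<sigma> p)) \<in> P'"
    and "polynomial_prime.tower P U B"
  shows "polynomial_prime.tower P' (\<sigma> ` U) (\<sigma> ` B)"
  using assms(5)
proof (induction rule: polynomial_prime.tower.induct[OF P, consumes 1, case_names empty alg trans])
  case empty
  show ?case using polynomial_prime.tower.empty[OF P'] by simp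
next
  case (alg U B i)
  have "\<sigma> i \<notin> \<sigma> ` U" using alg(2) \<open>inj \<sigma>\<close> by (auto dest: injD)
  then show ?case
    using polynomial_prime.tower.alg[OF P' alg(4)] alg(3) alg_proj_coords[OF P P' PP] by simp
next
  case (trans U B i)
  have "\<sigma> i \<notin> \<sigma> ` U" using trans(2) \<open>inj \<sigma>\<close> by (auto dest: injD)
  then show ?case
    using polynomial_prime.tower.trans[OF P' trans(4)] trans(3) alg_proj_coords[OF P P' PP] by simp
qed


section \<open>The ED correspondence over the smooth part\<close>

text \<open>Pairs become vectors indexed by a sum type, so that the theory of primes in one
  coordinate space applies to the product.\<close>

definition join :: "complex^'n \<Rightarrow> complex^'n \<Rightarrow> complex^('n + 'n)" where
  "join x u = (\<chi> k. case k of Inl i \<Rightarrow> x $ i | Inr i \<Rightarrow> u $ i)"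

lemma join_nth [simp]: "join x u $ Inl i = x $ i" "join x u $ Inr i = u $ i"
  by (simp_all add: join_def)

lemma proj_coords_join [simp]: "proj_coords Inl (join x u) = x" "proj_coords Inr (join x u) = u"
  by (simp_all add: vec_eq_iff)

lemma polys_in_join:
  assumes "f \<in> polys_in UNIV" "\<And>i. (\<lambda>x. a x $ i) \<in> poly_functions Y" "\<And>i. (\<lambda>x. b x $ i) \<in> poly_functions Y"
  shows "(\<lambda>x. f (join (a x) (b x))) \<in> poly_functions Y"
proof (rule poly_functions_compose[OF assms(1)])
  fix k
  show "(\<lambda>x. join (a x) (b x) $ k) \<in> poly_functions Y"
    using assms(2,3) by (cases k) simp_all
qed

definition ED_points :: "(complex^'n) set \<Rightarrow> (complex^'n) set \<Rightarrow> (complex^('n + 'n)) set" where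
  "ED_points X Z = {join x u | x u. x \<in> smooth_points X \<inter> Z \<and> u - x \<in> normal_space X x}"

lemma ED_pointsI:
  "x \<in> smooth_points X \<Longrightarrow> x \<in> Z \<Longrightarrow> u - x \<in> normal_space X x \<Longrightarrow> join x u \<in> ED_points X Z"
  unfolding ED_points_def by blast

lemma ED_points_diagonal: "x \<in> smooth_points X \<Longrightarrow> x \<in> Z \<Longrightarrow> join x x \<in> ED_points X Z"
  using vec.subspace_0[OF subspace_normal_space[of X x]] by (intro ED_pointsI) simp_all

lemma vanishing_ideal_ED_points:
  "f \<in> vanishing_ideal (ED_points X Z) \<longleftrightarrow> f \<in> polys_in UNIV \<and>
    (\<forall>x u. x \<in> smooth_points X \<longrightarrow> x \<in> Z \<longrightarrow> u - x \<in> normal_space X x \<longrightarrow> f (join x u) = 0)"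
  by (auto simp: vanishing_ideal_alt ED_points_def)

locale ED_pair =
  fixes X Z :: "(complex^'n) set"
  assumes X: "irreducible_in zariski X" "closedin zariski X"
    and Z: "irreducible_in zariski Z" "closedin zariski Z"
    and ZX: "Z \<subseteq> X"
    and smooth_point: "\<not> Z \<subseteq> singular_points X"
begin

abbreviation P\<^sub>E :: "(complex^('n + 'n) \<Rightarrow> complex) set" where
  "P\<^sub>E \<equiv> vanishing_ideal (ED_points X Z)"

lemma prime_Z: "polynomial_prime (vanishing_ideal Z)"
  by (rule irreducible_prime[OF Z(1)])

lemma exists_smooth: "\<exists>x. x \<in> smooth_points X \<and> x \<in> Z"
  using smooth_point ZX by (auto simp: singular_points_def)

lemma smooth_in_X: "smooth_points X \<subseteq> X"
  by (auto simp: smooth_points_def)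

lemma not_in_vanishing_ideal:
  "f \<in> polys_in UNIV \<Longrightarrow> x \<in> W \<Longrightarrow> f x \<noteq> 0 \<Longrightarrow> f \<notin> vanishing_ideal W"
  by (auto simp: vanishing_ideal_alt)

lemma not_in_vanishing_idealE:
  assumes "f \<in> polys_in UNIV" "f \<notin> vanishing_ideal W"
  obtains x where "x \<in> W" "f x \<noteq> 0"
  using assms by (auto simp: vanishing_ideal_alt)

text \<open>Two points of the correspondence can be moved, within the family \<open>x \<mapsto> (x, x + grad w x)\<close>,
  into a common fibre, which is an affine space.\<close>

lemma prime_ED: "polynomial_prime P\<^sub>E"
proof -
  interpret Z: polynomial_prime "vanishing_ideal Z" by (rule prime_Z)
  have "prime_ideal_in (polys_in UNIV) {f \<in> polys_in UNIV. \<forall>p\<in>ED_points X Z. f p = 0}"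
  proof (rule prime_ideal_of_functions[OF subring_polys_in])
    obtain x where "x \<in> smooth_points X" "x \<in> Z" using exists_smooth by blast
    then have "join x x \<in> ED_points X Z" by (rule ED_points_diagonal)
    then show "\<exists>p. p \<in> ED_points X Z" by blast
  next
    fix f g :: "complex^('n + 'n) \<Rightarrow> complex"
    assume f: "f \<in> polys_in UNIV" and g: "g \<in> polys_in UNIV"
      and fg: "\<And>p. p \<in> ED_points X Z \<Longrightarrow> f p * g p = 0"
    show "(\<forall>p\<in>ED_points X Z. f p = 0) \<or> (\<forall>p\<in>ED_points X Z. g p = 0)"
    proof (rule ccontr)
      assume "\<not> ?thesis"
      then obtain x1 u1 x2 u2 where 1: "x1 \<in> smooth_points X" "x1 \<in> Z" "u1 - x1 \<in> normal_space X x1"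
        "f (join x1 u1) \<noteq> 0" and 2: "x2 \<in> smooth_points X" "x2 \<in> Z" "u2 - x2 \<in> normal_space X x2"
        "g (join x2 u2) \<noteq> 0"
        by (auto simp: ED_points_def)
      obtain w1 where w1: "w1 \<in> vanishing_ideal X" "u1 - x1 = grad w1 x1"
        by (rule normal_space_eq_gradients[OF 1(3)])
      obtain w2 where w2: "w2 \<in> vanishing_ideal X" "u2 - x2 = grad w2 x2"
        by (rule normal_space_eq_gradients[OF 2(3)])
      have wR: "w1 \<in> polys_in UNIV" "w2 \<in> polys_in UNIV" using w1 w2 by (auto simp: vanishing_ideal_alt)
      obtain J w where w: "\<forall>j. w j \<in> vanishing_ideal X" and det: "det (frame_matrix J w x1) \<noteq> 0"
        and sm: "\<forall>z\<in>X. det (frame_matrix J w z) \<noteq> 0 \<longrightarrow> z \<in> smooth_points X \<and>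
          (\<forall>y. y \<in> normal_space X z \<longleftrightarrow>
            (\<exists>c. (\<forall>j. j \<notin> J \<longrightarrow> c $ j = 0) \<and> y = transpose (frame_matrix J w z) *v c))"
        by (rule smooth_frame[OF X 1(1)])
      define D where "D = (\<lambda>x. det (frame_matrix J w x))"
      define F where "F = (\<lambda>x. f (join x (x + grad w1 x)))"
      define G where "G = (\<lambda>x. g (join x (x + grad w2 x)))"
      have D: "D \<in> polys_in UNIV" unfolding D_def by (rule frame_det_poly[OF w])
      have comp0: "(\<lambda>x. x $ i) \<in> poly_functions coords" for i :: 'n
        using polys_in_coord_UNIV[of i] by (simp only: polys_in_UNIV)
      have comp: "(\<lambda>x. (x + grad v x) $ i) \<in> poly_functions coords" if "v \<in> polys_in UNIV"
        for i :: 'n and v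
        unfolding vector_add_component
        by (rule poly_functions.add[OF comp0 grad_polys_in[OF that, unfolded polys_in_UNIV]])
      have F: "F \<in> polys_in UNIV"
        unfolding F_def by (subst polys_in_UNIV, rule polys_in_join[OF f], rule comp0, rule comp[OF wR(1)])
      have G: "G \<in> polys_in UNIV"
        unfolding G_def by (subst polys_in_UNIV, rule polys_in_join[OF g], rule comp0, rule comp[OF wR(2)])
      have "D x1 \<noteq> 0" using det by (simp add: D_def)
      moreover have "x1 + (u1 - x1) = u1" "x2 + (u2 - x2) = u2" by simp_all
      then have "F x1 \<noteq> 0" "G x2 \<noteq> 0" using 1(4) 2(4) w1(2) w2(2) by (simp_all add: F_def G_def)
      ultimately have "D \<notin> vanishing_ideal Z" "F \<notin> vanishing_ideal Z" "G \<notin> vanishing_ideal Z"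
        using D F G 1(2) 2(2) not_in_vanishing_ideal by blast+
      then have n: "D * (F * G) \<notin> vanishing_ideal Z"
        using Z.P_prime[OF F G] Z.P_prime[OF D polys_in_mult[OF F G]] by blast
      obtain x where x: "x \<in> Z" "(D * (F * G)) x \<noteq> 0"
        by (rule not_in_vanishing_idealE[OF polys_in_mult[OF D polys_in_mult[OF F G]] n])
      then have nz: "D x \<noteq> 0" "F x \<noteq> 0" "G x \<noteq> 0" by auto
      have xs: "x \<in> smooth_points X" using sm nz(1) x(1) ZX by (auto simp: D_def)
      \<comment> \<open>At a common \<open>x\<close> where \<open>D\<close>, \<open>F\<close> and
        \<open>G\<close> are all nonzero, the line runs inside the fibre over \<open>x\<close> from
        a point with \<open>f\<close> nonzero, at parameter 0, to one with \<open>g\<close> nonzero,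
        at parameter 1.\<close>
      define a where "a = join x (x + grad w1 x)"
      define b where "b = join 0 (grad w2 x - grad w1 x)"
      have line: "a + t *s b \<in> ED_points X Z" for t
      proof -
        define y where "y = grad w1 x + t *s (grad w2 x - grad w1 x)"
        have "y \<in> normal_space X x"
          using grad_in_normal_space[OF w1(1), of x] grad_in_normal_space[OF w2(1), of x] unfolding y_def
          by (intro vec.subspace_add vec.subspace_scale vec.subspace_diff subspace_normal_space)
        then have "join x (x + y) \<in> ED_points X Z" using xs x(1) by (intro ED_pointsI) simp_all
        moreover have "a + t *s b = join x (x + y)"
          by (simp add: a_def b_def y_def vec_eq_iff join_def algebra_simps split: sum.split)
        ultimately show ?thesis by simp
      qed
      obtain p where p: "\<forall>t. f (a + t *s b) = poly p t" using poly_along_line[OF f] by blast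
      obtain q where q: "\<forall>t. g (a + t *s b) = poly q t" using poly_along_line[OF g] by blast
      have "a + 0 *s b = a" by simp
      then have "poly p 0 \<noteq> 0" using nz(2) p[rule_format, of 0] by (simp add: F_def a_def)
      moreover have "a + 1 *s b = join x (x + grad w2 x)"
        by (simp add: a_def b_def vec_eq_iff join_def split: sum.split)
      then have "poly q 1 \<noteq> 0" using nz(3) q[rule_format, of 1] by (simp add: G_def)
      moreover have "poly (p * q) t = 0" for t using fg[OF line[of t]] p q by simp
      then have "p * q = 0" using poly_all_0_iff_0 by blast
      ultimately show False by auto
    qed
  qed
  then show ?thesis by (simp add: polynomial_prime_def vanishing_ideal_alt)
qed

sublocale E: polynomial_prime "vanishing_ideal (ED_points X Z)"
  by (rule prime_ED)

text \<open>The diagonal points (x, x) show that the projection covers the smooth points of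
  \<open>X\<close> in \<open>Z\<close>, and the frame determinant \<open>?D\<close>, which is not
  identically zero on \<open>Z\<close>, takes care of the others.\<close>

lemma pullback_Z:
  assumes f: "f \<in> polys_in UNIV"
  shows "f \<in> vanishing_ideal Z \<longleftrightarrow> (\<lambda>p. f (proj_coords Inl p)) \<in> P\<^sub>E"
proof
  assume "f \<in> vanishing_ideal Z"
  then have "\<forall>x\<in>Z. f x = 0" by (simp add: vanishing_ideal_alt)
  moreover have "(\<lambda>p. f (proj_coords Inl p)) \<in> polys_in UNIV"
    by (rule subsetD[OF E.polys_in_sub polys_in_proj_coords[OF f]])
  ultimately show "(\<lambda>p. f (proj_coords Inl p)) \<in> P\<^sub>E"
    by (simp add: vanishing_ideal_ED_points)
next
  interpret Z: polynomial_prime "vanishing_ideal Z" by (rule prime_Z)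
  assume f0: "(\<lambda>p. f (proj_coords Inl p)) \<in> P\<^sub>E"
  obtain x0 where x0: "x0 \<in> smooth_points X" "x0 \<in> Z" using exists_smooth by blast
  obtain J w where w: "\<forall>j. w j \<in> vanishing_ideal X" and det: "det (frame_matrix J w x0) \<noteq> 0"
    and sm: "\<forall>z\<in>X. det (frame_matrix J w z) \<noteq> 0 \<longrightarrow> z \<in> smooth_points X \<and>
      (\<forall>y. y \<in> normal_space X z \<longleftrightarrow>
        (\<exists>c. (\<forall>j. j \<notin> J \<longrightarrow> c $ j = 0) \<and> y = transpose (frame_matrix J w z) *v c))"
    by (rule smooth_frame[OF X x0(1)])
  let ?D = "\<lambda>x. det (frame_matrix J w x)"
  have D: "?D \<in> polys_in UNIV" by (rule frame_det_poly[OF w])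
  have Dn: "?D \<notin> vanishing_ideal Z" using D x0(2) det not_in_vanishing_ideal by blast
  have "?D x * f x = 0" if x: "x \<in> Z" for x
  proof (cases "?D x = 0")
    case False
    then have "x \<in> smooth_points X" using sm x ZX by auto
    moreover have "x - x \<in> normal_space X x"
      using vec.subspace_0[OF subspace_normal_space[of X x]] by simp
    ultimately have "f (proj_coords Inl (join x x)) = 0"
      using f0 x unfolding vanishing_ideal_ED_points by blast
    then show ?thesis by simp
  qed simp
  then have "?D * f \<in> vanishing_ideal Z"
    using polys_in_mult[OF D f] by (auto simp: vanishing_ideal_alt)
  then show "f \<in> vanishing_ideal Z" using Z.P_prime[OF D f] Dn by blast
qed

text \<open>The tower adjoins x first, which contributes dim \<open>Z\<close>. Then the
  \<open>u $ j\<close> with \<open>j \<in> J\<close> are transcendental, since on the normal space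
  they can be prescribed freely. The remaining coordinates of u satisfy linear equations over these.
  The size of \<open>J\<close> is the codimension of \<open>X\<close>.\<close>

theorem trdeg_ED: "E.trdeg + zariski_dim X = zariski_dim Z + CARD('n)"
proof -
  interpret Z: polynomial_prime "vanishing_ideal Z" by (rule prime_Z)
  obtain x0 where x0: "x0 \<in> smooth_points X" "x0 \<in> Z" using exists_smooth by blast
  obtain J w where w: "\<forall>j. w j \<in> vanishing_ideal X" and det: "det (frame_matrix J w x0) \<noteq> 0"
    and card: "card J + zariski_dim X = CARD('n)"
    and sm: "\<forall>z\<in>X. det (frame_matrix J w z) \<noteq> 0 \<longrightarrow> z \<in> smooth_points X \<and>
      (\<forall>y. y \<in> normal_space X z \<longleftrightarrow>
        (\<exists>c. (\<forall>j. j \<notin> J \<longrightarrow> c $ j = 0) \<and> y = transpose (frame_matrix J w z) *v c))"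
    by (rule smooth_frame[OF X x0(1)])
  let ?M = "frame_matrix J w"
  have nrm: "y \<in> normal_space X x \<longleftrightarrow> (\<exists>c. (\<forall>j. j \<notin> J \<longrightarrow> c $ j = 0) \<and> y = transpose (?M x) *v c)"
    if "x \<in> X" "det (?M x) \<noteq> 0" for x y using sm that by blast
  let ?L = "range (Inl :: 'n \<Rightarrow> 'n + 'n)"
  define D where "D = (\<lambda>p :: complex^('n + 'n). det (?M (proj_coords Inl p)))"
  have Mp: "(\<lambda>p :: complex^('n+'n). ?M (proj_coords Inl p) $ j $ i) \<in> polys_in ?L" for i j
    by (rule polys_in_proj_coords[OF frame_matrix_poly[OF w]])
  have DL: "D \<in> polys_in ?L"
    unfolding D_def by (rule polys_in_proj_coords[OF frame_det_poly[OF w]])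
  then have DR: "D \<in> polys_in UNIV" using E.polys_in_sub by blast
  have "D (join x0 x0) \<noteq> 0" using det by (simp add: D_def)
  then have DnP: "D \<notin> P\<^sub>E" by (rule not_in_vanishing_ideal[OF DR ED_points_diagonal[OF x0]])
  \<comment> \<open>\<open>D\<close> is outside the prime, so points over its zeros may be
    ignored.\<close>
  have cancel: "f \<in> P\<^sub>E" if f: "f \<in> polys_in UNIV"
    "\<And>x u. x \<in> Z \<Longrightarrow> det (?M x) \<noteq> 0 \<Longrightarrow> u - x \<in> normal_space X x \<Longrightarrow> f (join x u) = 0" for f
  proof -
    have "D * f \<in> P\<^sub>E"
      using f(2) polys_in_mult[OF DR f(1)] by (auto simp: vanishing_ideal_ED_points D_def)
    then show ?thesis using E.P_prime[OF DR f(1)] DnP by blast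
  qed
  obtain BZ where BZ: "Z.tower UNIV BZ" using Z.exists_tower by blast
  have t0: "E.tower ?L (Inl ` BZ)"
    by (rule tower_proj_coords[OF prime_Z prime_ED inj_Inl pullback_Z BZ])
  have move: "\<exists>u'. u' - x \<in> normal_space X x \<and> (\<forall>i\<in>J. u' $ i = (if i = j then t else u $ i))"
    if x: "x \<in> Z" "det (?M x) \<noteq> 0" for x u :: "complex^'n" and j t
  proof -
    have "invertible (transpose (?M x))" using x(2) by (simp add: invertible_det_nz)
    then obtain A where A: "transpose (?M x) ** A = mat 1" by (auto simp: invertible_def)
    define y where "y = upd_coord u j t - x"
    define c where "c = A *v y"
    \<comment> \<open>Dropping the coefficients outside \<open>J\<close> makes the vector normal and
      alters it only in coordinates outside \<open>J\<close>, since the dropped rows are standard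
      vectors.\<close>
    define c' where "c' = (\<chi> k. if k \<in> J then c $ k else 0)"
    have y: "transpose (?M x) *v c = y" using A by (simp only: c_def matrix_vector_mul_assoc matrix_vector_mul_lid)
    have "(transpose (?M x) *v c') $ i = y $ i" if i: "i \<in> J" for i
    proof -
      have "(transpose (?M x) *v c') $ i = (\<Sum>k\<in>UNIV. ?M x $ k $ i * c' $ k)"
        unfolding matrix_vector_mult_def transpose_def by simp
      also have "\<dots> = (\<Sum>k\<in>UNIV. ?M x $ k $ i * c $ k)"
        using i by (intro sum.cong) (auto simp: c'_def frame_matrix_def axis_def)
      also have "\<dots> = (transpose (?M x) *v c) $ i"
        unfolding matrix_vector_mult_def transpose_def by simp
      finally show ?thesis unfolding y .
    qed
    moreover have "transpose (?M x) *v c' \<in> normal_space X x"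
    proof -
      have "\<forall>j. j \<notin> J \<longrightarrow> c' $ j = 0" by (simp add: c'_def)
      then show ?thesis using nrm[of x "transpose (?M x) *v c'"] x ZX by blast
    qed
    ultimately show ?thesis
      by (intro exI[of _ "x + transpose (?M x) *v c'"]) (auto simp: y_def)
  qed
  have t1: "E.tower (?L \<union> Inr ` S) (Inl ` BZ \<union> Inr ` S)" if "finite S" "S \<subseteq> J" for S
    using that
  proof (induction rule: finite_induct)
    case (insert j S)
    let ?U = "?L \<union> Inr ` S"
    have "\<not> E.alg ?U (Inr j)"
    proof
      assume "E.alg ?U (Inr j)"
      then obtain q where q: "coeffs_in (polys_in ?U) q" "\<not> coeffs_in P\<^sub>E q" "poly q (coord_fun (Inr j)) \<in> P\<^sub>E"
        unfolding E.alg_def E.algebraic_over_def by blast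
      have "coeff q k \<in> P\<^sub>E" for k
      proof (rule cancel)
        have cU: "coeff q k \<in> polys_in ?U" for k using q(1) by (simp add: coeffs_in_def)
        then show "coeff q k \<in> polys_in UNIV" using E.polys_in_sub by blast
        fix x u assume x: "x \<in> Z" "det (?M x) \<noteq> 0" "u - x \<in> normal_space X x"
        have "poly (eval_poly (join x u) q) t = 0" for t
        proof -
          obtain u' where u': "u' - x \<in> normal_space X x" "\<forall>i\<in>J. u' $ i = (if i = j then t else u $ i)"
            using move[OF x(1,2)] by blast
          have "x \<in> smooth_points X" using sm x ZX by blast
          then have "poly q (coord_fun (Inr j)) (join x u') = 0"
            using q(3) x(1) u'(1) by (simp only: vanishing_ideal_ED_points)
          moreover have "coeff q k (join x u') = coeff q k (join x u)" for k
            using u'(2) insert by (intro polys_in_cong[OF cU]) auto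
          then have "eval_poly (join x u') q = eval_poly (join x u) q"
            by (intro poly_eqI) (simp add: coeff_eval_poly)
          moreover have "join x u' $ Inr j = t" using u'(2) insert.prems by simp
          ultimately show ?thesis by (simp only: poly_fun_apply)
        qed
        then have "eval_poly (join x u) q = 0" using poly_all_0_iff_0 by blast
        then show "coeff q k (join x u) = 0" by (metis coeff_0 coeff_eval_poly)
      qed
      then show False using q(2) by (simp add: coeffs_in_def)
    qed
    moreover have "Inr j \<notin> ?U" using insert by auto
    ultimately have "E.tower (insert (Inr j) ?U) (insert (Inr j) (Inl ` BZ \<union> Inr ` S))"
      using insert by (intro E.tower.trans) auto
    then show ?case by simp
  qed (use t0 in simp)
  let ?U = "?L \<union> Inr ` J"
  have alg: "E.alg ?U k" if k: "k \<notin> ?U" for k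
  proof -
    obtain i where i: "k = Inr i" "i \<notin> J" using k by (cases k) auto
    \<comment> \<open>Cramer's rule: \<open>u - x\<close> is a combination of the rows in
      \<open>J\<close>, so putting its part on \<open>insert i J\<close> into row \<open>i\<close>
      makes the determinant vanish. \<open>Dl l\<close> is the coefficient of component
      \<open>l\<close> in this expansion.\<close>
    define R where "R = (\<lambda>l x. \<chi> k. if k = i then axis l 1 else ?M x $ k)"
    define Dl where "Dl = (\<lambda>l (p :: complex^('n+'n)). det (R l (proj_coords Inl p)))"
    have Dl: "Dl l \<in> polys_in ?U" for l
    proof -
      have "(\<lambda>p. R l (proj_coords Inl p) $ a $ b) \<in> polys_in ?L" for a b
        using Mp[of a b] by (cases "a = i") (simp_all add: R_def)
      then have "Dl l \<in> polys_in ?L"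
        unfolding Dl_def polys_in_def by (intro poly_functions_det)
      then show ?thesis using polys_in_mono[of ?L ?U] by blast
    qed
    have Dli: "Dl i = D"
      using i(2) by (auto simp: Dl_def D_def R_def frame_matrix_def fun_eq_iff intro!: arg_cong[of _ _ det] simp: vec_eq_iff)
    \<comment> \<open>Chosen so that \<open>c0 + D * u $ i\<close> is the sum of
      \<open>(u - x) $ l * Dl l\<close> over \<open>insert i J\<close>.\<close>
    define c0 where "c0 = (\<lambda>p. (\<Sum>l\<in>J. (p $ Inr l - p $ Inl l) * Dl l p) - p $ Inl i * D p)"
    have DU: "D \<in> polys_in ?U" using Dl[of i] Dli by simp
    have coordL: "coord_fun (Inl l) \<in> polys_in ?U" for l by (rule polys_in_coord) simp
    have coordR: "coord_fun (Inr l) \<in> polys_in ?U" if "l \<in> J" for l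
      using that by (intro polys_in_coord) simp
    have c0: "c0 \<in> polys_in ?U"
      unfolding c0_def polys_in_def
      by (intro poly_functions_minus polys_in_sum_fun poly_functions.mult
          Dl[unfolded polys_in_def] DU[unfolded polys_in_def]
          coordL[unfolded polys_in_def] coordR[unfolded polys_in_def])
    have q: "coeffs_in (polys_in ?U) [:c0, D:]"
      using c0 DU by (simp add: coeffs_in_pCons coeffs_in_ring[OF subring_polys_in])
    have "poly [:c0, D:] (coord_fun k) \<in> P\<^sub>E"
    proof (rule cancel)
      show "poly [:c0, D:] (coord_fun k) \<in> polys_in UNIV"
        using poly_coord_in[OF q, of k] E.polys_in_sub by blast
      fix x u assume x: "x \<in> Z" "det (?M x) \<noteq> 0" "u - x \<in> normal_space X x"
      obtain c where c: "\<forall>j. j \<notin> J \<longrightarrow> c $ j = 0" "u - x = transpose (?M x) *v c"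
        using nrm[of x "u - x"] x ZX by blast
      let ?y = "u - x"
      have yk: "?y $ a = (\<Sum>j\<in>J. c $ j * ?M x $ j $ a)" for a
      proof -
        have "?y $ a = (\<Sum>j\<in>UNIV. ?M x $ j $ a * c $ j)"
          unfolding c(2) matrix_vector_mult_def transpose_def by simp
        also have "\<dots> = (\<Sum>j\<in>J. ?M x $ j $ a * c $ j)"
          using c(1) by (intro sum.mono_neutral_right) auto
        finally show ?thesis by (simp add: mult.commute)
      qed
      define A where "A = (\<chi> k. if k = i then 0 else ?M x $ k)"
      \<comment> \<open>Only the components in \<open>insert i J\<close> are kept; the others are
        multiples of standard vectors that are themselves rows of the matrix, so \<open>v\<close>
        still lies in the span of the rows other than \<open>i\<close>.\<close>
      define v where "v = (\<Sum>l\<in>insert i J. ?y $ l *s (axis l 1 :: complex^'n))"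
      have v_eq: "v = (\<Sum>j\<in>J. c $ j *s row j A) - (\<Sum>l\<in>- insert i J. ?y $ l *s row l A)"
      proof -
        have "(\<Sum>j\<in>J. c $ j *s row j A) = ?y"
          unfolding vec_eq_iff
        proof
          fix a
          have "(\<Sum>j\<in>J. c $ j *s row j A) $ a = (\<Sum>j\<in>J. c $ j * ?M x $ j $ a)"
            using i(2) by (simp add: A_def row_def) (intro sum.cong, auto)
          then show "(\<Sum>j\<in>J. c $ j *s row j A) $ a = ?y $ a" by (simp only: yk)
        qed
        moreover have "(\<Sum>l\<in>- insert i J. ?y $ l *s row l A) = (\<Sum>l\<in>- insert i J. ?y $ l *s axis l 1)"
          by (intro sum.cong) (auto simp: A_def row_def frame_matrix_def vec_lambda_eta)
        moreover have "?y = (\<Sum>l\<in>UNIV. ?y $ l *s axis l 1)" by (rule basis_expansion[symmetric])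
        moreover have "(\<Sum>l\<in>UNIV. ?y $ l *s axis l 1) = v + (\<Sum>l\<in>- insert i J. ?y $ l *s (axis l 1 :: complex^'n))"
          unfolding v_def by (subst sum.union_disjoint[symmetric]) (auto intro: sum.cong)
        ultimately have e1: "?y = v + (\<Sum>l\<in>- insert i J. ?y $ l *s row l A)"
          and e2: "(\<Sum>j\<in>J. c $ j *s row j A) = ?y" by (simp_all only:)
        show ?thesis unfolding e2 by (rule eq_diff_eq[THEN iffD2]) (rule e1[symmetric])
      qed
      have "v \<in> vec.span {row j A | j. j \<noteq> i}"
        unfolding v_eq using i(2)
        by (intro vec.span_diff vec.span_sum vec.span_scale vec.span_base) auto
      then have "det (\<chi> k. if k = i then row i A + v else row k A) = det A" by (rule det_row_span)
      moreover have "row i A = 0" by (simp add: row_def A_def vec_eq_iff)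
      then have "det A = 0" by (rule det_zero_row)
      moreover have "(\<chi> k. if k = i then row i A + v else row k A) = (\<chi> k. if k = i then v else ?M x $ k)"
        using \<open>row i A = 0\<close> by (auto simp: vec_eq_iff A_def row_def)
      ultimately have "det (\<chi> k. if k = i then v else ?M x $ k) = 0" by simp
      moreover have "det (\<chi> k. if k = i then v else ?M x $ k) = (\<Sum>l\<in>insert i J. ?y $ l * Dl l (join x u))"
      proof -
        have "Dl l (join x u) = det (\<chi> k. if k = i then axis l 1 else ?M x $ k)" for l
          unfolding Dl_def proj_coords_join R_def by (rule refl)
        then show ?thesis
          unfolding v_def by (subst det_linear_row_sum) (simp_all add: det_row_mul)
      qed
      ultimately have "(\<Sum>l\<in>insert i J. ?y $ l * Dl l (join x u)) = 0" by simp
      then have "?y $ i * D (join x u) + (\<Sum>l\<in>J. ?y $ l * Dl l (join x u)) = 0"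
        using i(2) by (simp add: Dli)
      then show "poly [:c0, D:] (coord_fun k) (join x u) = 0"
        by (simp add: c0_def i(1) algebra_simps)
    qed
    moreover have "\<not> coeffs_in P\<^sub>E [:c0, D:]" using DnP by (simp add: coeffs_in_pCons)
    ultimately show ?thesis unfolding E.alg_def E.algebraic_over_def using q by blast
  qed
  have "E.tower UNIV (Inl ` BZ \<union> Inr ` J)"
    using E.tower_extend[OF t1[OF finite order_refl]] alg by blast
  then have "E.trdeg = card (Inl ` BZ \<union> Inr ` J :: ('n + 'n) set)" by (rule E.tower_card[symmetric])
  also have "\<dots> = card (Inl ` BZ :: ('n + 'n) set) + card (Inr ` J :: ('n + 'n) set)"
    by (rule card_Un_disjoint) auto
  also have "\<dots> = card BZ + card J" by (simp add: card_image)
  also have "card BZ = zariski_dim Z" unfolding zariski_dim_def by (rule Z.tower_card[OF BZ])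
  finally show ?thesis using card by simp
qed

end

section \<open>Elimination theory\<close>

lemma poly_functions_power: "f \<in> poly_functions X \<Longrightarrow> (\<lambda>x. f x ^ k) \<in> poly_functions X"
  by (induction k) (auto intro: poly_functions.intros)

text \<open>By Gaussian elimination: the lemma is applied to a matrix indexed by the monomials of a given
  degree, which do not form a type, so the library determinants are not available.\<close>

lemma nakayama:
  fixes r :: "'l \<Rightarrow> 'l \<Rightarrow> 'a \<Rightarrow> complex"
  assumes "finite A"
    and "q \<in> poly_functions Y" "q u0 \<noteq> 0"
    and "\<forall>a b. r a b \<in> poly_functions Y" "\<forall>a b. r a b u0 = 0"
  shows "\<exists>g\<in>poly_functions Y. g u0 \<noteq> 0 \<and>
    (\<forall>u m. (\<forall>a\<in>A. q u * m a = (\<Sum>b\<in>A. r a b u * m b)) \<longrightarrow> (\<forall>a\<in>A. g u * m a = 0))"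
  using assms
proof (induction A arbitrary: q r rule: finite_induct)
  case empty
  show ?case by (intro bexI[of _ "\<lambda>_. 1"] conjI) (auto intro: poly_functions.const)
next
  case (insert c A)
  \<comment> \<open>\<open>s\<close> is the pivot of row \<open>c\<close>, nonzero at
    \<open>u0\<close>. Multiplying the other rows by it and substituting for \<open>m c\<close>
    leaves a system of the same shape with \<open>q'\<close> and \<open>r'\<close>.\<close>
  define s where "s = (\<lambda>u. q u - r c c u)"
  define q' where "q' = (\<lambda>u. q u * s u)"
  define r' where "r' = (\<lambda>a b u. s u * r a b u + r a c u * r c b u)"
  have rY: "r a b \<in> poly_functions Y" for a b using insert.prems(3) by blast
  have s: "s \<in> poly_functions Y" unfolding s_def by (intro poly_functions_minus insert.prems(1) rY)
  have s0: "s u0 \<noteq> 0" using insert.prems(2,4) by (simp add: s_def)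
  have q': "q' \<in> poly_functions Y" unfolding q'_def by (intro poly_functions.mult insert.prems(1) s)
  have q'0: "q' u0 \<noteq> 0" using insert.prems(2) s0 by (simp add: q'_def)
  have r': "\<forall>a b. r' a b \<in> poly_functions Y"
    unfolding r'_def by (intro allI poly_functions.add poly_functions.mult rY s)
  have r'0: "\<forall>a b. r' a b u0 = 0" using insert.prems(4) by (simp add: r'_def)
  obtain g where g: "g \<in> poly_functions Y" "g u0 \<noteq> 0" and
    IH: "\<forall>u m. (\<forall>a\<in>A. q' u * m a = (\<Sum>b\<in>A. r' a b u * m b)) \<longrightarrow> (\<forall>a\<in>A. g u * m a = 0)"
    using insert.IH[OF q' q'0 r' r'0] by blast
  have "g u * s u * m a = 0"
    if eq: "\<forall>a\<in>insert c A. q u * m a = (\<Sum>b\<in>insert c A. r a b u * m b)" and a: "a \<in> insert c A" for u m a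
  proof -
    have sum: "q u * m a = r a c u * m c + (\<Sum>b\<in>A. r a b u * m b)" if "a \<in> insert c A" for a
      using eq[rule_format, OF that, unfolded sum.insert[OF insert.hyps(1,2)]] .
    have sc: "s u * m c = (\<Sum>b\<in>A. r c b u * m b)"
      using sum[of c] by (simp add: s_def algebra_simps)
    have "q' u * m b = (\<Sum>d\<in>A. r' b d u * m d)" if b: "b \<in> A" for b
    proof -
      have "q' u * m b = s u * (q u * m b)" by (simp add: q'_def)
      also have "\<dots> = s u * (\<Sum>d\<in>A. r b d u * m d) + r b c u * (s u * m c)"
        using sum[of b] b by (simp add: algebra_simps)
      also have "\<dots> = (\<Sum>d\<in>A. r' b d u * m d)"
        unfolding sc by (simp add: r'_def sum_distrib_left sum.distrib algebra_simps)
      finally show ?thesis .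
    qed
    then have z: "\<forall>b\<in>A. g u * m b = 0" using IH by blast
    have "g u * (s u * m c) = (\<Sum>b\<in>A. r c b u * (g u * m b))"
      unfolding sc by (simp add: sum_distrib_left algebra_simps)
    also have "\<dots> = 0" by (rule sum.neutral) (use z in \<open>metis mult_zero_right\<close>)
    finally have "g u * s u * m c = 0" by simp
    then show ?thesis using z a by auto
  qed
  then show ?case
    using g s s0 by (intro bexI[of _ "\<lambda>u. g u * s u"] poly_functions.mult) auto
qed

section \<open>Polynomials on the product, graded by the degree in the first argument\<close>

definition monomial :: "'n list \<Rightarrow> complex^'n \<Rightarrow> complex" where
  "monomial l x = prod_list (map (\<lambda>i. x $ i) l)"

lemma monomial_simps [simp]:
  "monomial [] x = 1" "monomial (i # l) x = x $ i * monomial l x"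
  "monomial (l @ l') x = monomial l x * monomial l' x"
  "monomial (replicate d i) x = x $ i ^ d"
  by (simp_all add: monomial_def)

lemma monomial_scale: "monomial l (t *s x) = t ^ length l * monomial l x"
  by (induction l) simp_all

lemma monomial_count: "monomial l x = (\<Prod>i\<in>UNIV. x $ i ^ count_list l i)"
proof (induction l)
  case (Cons j l)
  have "(\<Prod>i\<in>UNIV. x $ i ^ count_list (j # l) i) =
      (\<Prod>i\<in>UNIV. (if i = j then x $ i else 1) * x $ i ^ count_list l i)"
    by (intro prod.cong) auto
  also have "\<dots> = x $ j * (\<Prod>i\<in>UNIV. x $ i ^ count_list l i)"
    by (simp add: prod.distrib)
  finally show ?case using Cons by simp
qed simp

definition lists_of_length :: "nat \<Rightarrow> 'n list set" where
  "lists_of_length d = {l. length l = d}"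

lemma finite_lists_of_length: "finite (lists_of_length d :: 'n::finite list set)"
  using finite_lists_length_eq[of "UNIV :: 'n set" d] by (simp add: lists_of_length_def)

text \<open>Monomials are indexed by words in the variables, so a product of monomials is a
  concatenation and splits by \<open>take\<close> and \<open>drop\<close>. Different words may give
  the same monomial; only the existence of coefficients matters.\<close>

definition homogeneous_part :: "nat \<Rightarrow> ((complex^'n) \<times> (complex^'n) \<Rightarrow> complex) set" where
  "homogeneous_part d = {\<lambda>p. \<Sum>l\<in>lists_of_length d. r l (snd p) * monomial l (fst p) | r.
     \<forall>l. r l \<in> polys_in UNIV}"

lemma homogeneous_partI:
  "(\<And>l. r l \<in> polys_in UNIV) \<Longrightarrow>
    (\<lambda>p. \<Sum>l\<in>lists_of_length d. r l (snd p) * monomial l (fst p)) \<in> homogeneous_part d"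
  unfolding homogeneous_part_def by blast

lemma homogeneous_partE:
  assumes "h \<in> homogeneous_part d"
  obtains r where "\<And>l. r l \<in> polys_in UNIV"
    "\<And>x u. h (x, u) = (\<Sum>l\<in>lists_of_length d. r l u * monomial l x)"
proof -
  from assms obtain r where "\<forall>l. r l \<in> polys_in UNIV"
    "h = (\<lambda>p. \<Sum>l\<in>lists_of_length d. r l (snd p) * monomial l (fst p))"
    unfolding homogeneous_part_def by blast
  then show ?thesis by (intro that[of r]) simp_all
qed

lemma homogeneous_part_scale:
  assumes "h \<in> homogeneous_part d"
  shows "h (t *s x, u) = t ^ d * h (x, u)"
proof -
  obtain r where "\<And>x u. h (x, u) = (\<Sum>l\<in>lists_of_length d. r l u * monomial l x)"
    using homogeneous_partE[OF assms] by metis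
  then show ?thesis
    by (simp add: sum_distrib_left monomial_scale lists_of_length_def algebra_simps)
qed

lemma homogeneous_part_zero: "(\<lambda>_. 0) \<in> homogeneous_part d"
  using homogeneous_partI[of "\<lambda>_ _. 0" d] by simp

lemma homogeneous_part_add:
  assumes "h \<in> homogeneous_part d" "k \<in> homogeneous_part d"
  shows "(\<lambda>p. h p + k p) \<in> homogeneous_part d"
proof -
  obtain r where r: "\<And>l. r l \<in> polys_in UNIV" "\<And>x u. h (x, u) = (\<Sum>l\<in>lists_of_length d. r l u * monomial l x)"
    by (rule homogeneous_partE[OF assms(1)], rule that) blast+
  obtain s where s: "\<And>l. s l \<in> polys_in UNIV" "\<And>x u. k (x, u) = (\<Sum>l\<in>lists_of_length d. s l u * monomial l x)"
    by (rule homogeneous_partE[OF assms(2)], rule that) blast+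
  have "(\<lambda>p. h p + k p) = (\<lambda>p. \<Sum>l\<in>lists_of_length d. (r l + s l) (snd p) * monomial l (fst p))"
    using r(2) s(2) by (auto simp: fun_eq_iff algebra_simps sum.distrib)
  also have "\<dots> \<in> homogeneous_part d" by (intro homogeneous_partI polys_in_add r s)
  finally show ?thesis .
qed

lemma homogeneous_part_sum:
  "(\<And>i. i \<in> I \<Longrightarrow> h i \<in> homogeneous_part d) \<Longrightarrow> (\<lambda>p. \<Sum>i\<in>I. h i p) \<in> homogeneous_part d"
  by (induction I rule: infinite_finite_induct) (auto intro: homogeneous_part_zero homogeneous_part_add)

lemma homogeneous_part_mult:
  assumes "h \<in> homogeneous_part d" "k \<in> homogeneous_part e"
  shows "(\<lambda>p. h p * k p) \<in> homogeneous_part (d + e)"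
proof -
  obtain r where r: "\<And>l. r l \<in> polys_in UNIV" "\<And>x u. h (x, u) = (\<Sum>l\<in>lists_of_length d. r l u * monomial l x)"
    by (rule homogeneous_partE[OF assms(1)], rule that) blast+
  obtain s where s: "\<And>l. s l \<in> polys_in UNIV" "\<And>x u. k (x, u) = (\<Sum>l\<in>lists_of_length e. s l u * monomial l x)"
    by (rule homogeneous_partE[OF assms(2)], rule that) blast+
  let ?a = "\<lambda>x u l. r l u * monomial l x" and ?b = "\<lambda>x u l. s l u * monomial l x"
  have "h (x, u) * k (x, u) =
      (\<Sum>m\<in>lists_of_length (d + e). (r (take d m) * s (drop d m)) u * monomial m x)" for x u
  proof -
    have "h (x, u) * k (x, u) = (\<Sum>(l, l')\<in>lists_of_length d \<times> lists_of_length e. ?a x u l * ?b x u l')"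
      by (simp add: r(2) s(2) sum_product sum.cartesian_product)
    also have "\<dots> = (\<Sum>m\<in>lists_of_length (d + e). ?a x u (take d m) * ?b x u (drop d m))"
      by (rule sum.reindex_bij_witness[of _ "\<lambda>m. (take d m, drop d m)" "\<lambda>(l, l'). l @ l'"])
        (auto simp: lists_of_length_def)
    also have "\<dots> = (\<Sum>m\<in>lists_of_length (d + e). (r (take d m) * s (drop d m)) u * monomial m x)"
    proof (rule sum.cong[OF refl])
      fix m
      have "monomial m x = monomial (take d m) x * monomial (drop d m) x"
        by (simp flip: monomial_simps(3))
      then show "?a x u (take d m) * ?b x u (drop d m) = (r (take d m) * s (drop d m)) u * monomial m x"
        by simp
    qed
    finally show ?thesis .
  qed
  then have "(\<lambda>p. h p * k p) =
      (\<lambda>p. \<Sum>m\<in>lists_of_length (d + e). (r (take d m) * s (drop d m)) (snd p) * monomial m (fst p))"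
    by (intro ext) (metis prod.collapse)
  also have "\<dots> \<in> homogeneous_part (d + e)" by (intro homogeneous_partI polys_in_mult r s)
  finally show ?thesis .
qed

lemma homogeneous_part_snd: "f \<in> polys_in UNIV \<Longrightarrow> (\<lambda>p. f (snd p)) \<in> homogeneous_part 0"
  using homogeneous_partI[of "\<lambda>_. f" 0] by (simp add: lists_of_length_def)

lemma homogeneous_part_monomial: "(\<lambda>p. monomial l (fst p)) \<in> homogeneous_part (length l)"
proof -
  have "(\<lambda>p. monomial l (fst p)) =
    (\<lambda>p. \<Sum>m\<in>lists_of_length (length l). (\<lambda>_. if m = l then 1 else 0) (snd p) * monomial m (fst p))"
  proof (rule ext)
    fix p
    have "l \<in> lists_of_length (length l)" by (simp add: lists_of_length_def)
    then show "monomial l (fst p) =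
      (\<Sum>m\<in>lists_of_length (length l). (\<lambda>_. if m = l then 1 else 0) (snd p) * monomial m (fst p))"
      by (simp add: finite_lists_of_length if_distrib[of "\<lambda>c. c * _"] cong: if_cong)
  qed
  also have "\<dots> \<in> homogeneous_part (length l)" by (intro homogeneous_partI) simp
  finally show ?thesis .
qed

inductive_set graded :: "((complex^'n) \<times> (complex^'n) \<Rightarrow> complex) set" where
  part: "h \<in> homogeneous_part d \<Longrightarrow> h \<in> graded"
| add: "f \<in> graded \<Longrightarrow> g \<in> graded \<Longrightarrow> (\<lambda>p. f p + g p) \<in> graded"

lemma graded_mult:
  assumes "f \<in> graded" "g \<in> graded"
  shows "(\<lambda>p. f p * g p) \<in> graded"
  using assms(1)
proof induction
  case (part h d)
  show ?case using assms(2)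
  proof induction
    case (part k e)
    then show ?case using homogeneous_part_mult[OF \<open>h \<in> homogeneous_part d\<close>] graded.part by blast
  next
    case (add f g)
    then show ?case using graded.add[of "\<lambda>p. h p * f p" "\<lambda>p. h p * g p"] by (simp add: distrib_left)
  qed
next
  case (add f f')
  then show ?case using graded.add[of "\<lambda>p. f p * g p" "\<lambda>p. f' p * g p"] by (simp add: distrib_right)
qed

lemma poly_functions_graded: "f \<in> poly_functions coords2 \<Longrightarrow> f \<in> graded"
proof (induction rule: poly_functions.induct)
  case (coord f)
  then consider i where "f = (\<lambda>(x, u). x $ i)" | i where "f = (\<lambda>(x, u). u $ i)"
    unfolding coords2_def by blast
  then show ?case
  proof cases
    case 1
    then have "f = (\<lambda>p. monomial [i] (fst p))" by (simp add: fun_eq_iff)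
    then show ?thesis using homogeneous_part_monomial graded.part by blast
  next
    case 2
    then have "f = (\<lambda>p. coord_fun i (snd p))" by (simp add: fun_eq_iff)
    then show ?thesis using homogeneous_part_snd[OF polys_in_coord_UNIV] graded.part by blast
  qed
next
  case (const c)
  show ?case using homogeneous_part_snd[OF polys_in_const] graded.part by blast
next
  case (add f g)
  then show ?case by (intro graded.add)
next
  case (mult f g)
  then show ?case by (intro graded_mult)
qed

lemma graded_decomposition:
  assumes "f \<in> graded"
  shows "\<exists>K h. (\<forall>d. h d \<in> homogeneous_part d) \<and> (\<forall>d>K. h d = (\<lambda>_. 0)) \<and> f = (\<lambda>p. \<Sum>d\<le>K. h d p)"
  using assms
proof induction
  case (part h d)
  let ?h = "\<lambda>e. if e = d then h else (\<lambda>_. 0)"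
  have "h p = (\<Sum>e\<le>d. ?h e p)" for p
  proof -
    have "(\<Sum>e\<le>d. ?h e p) = (\<Sum>e\<le>d. if e = d then h p else 0)" by (intro sum.cong) auto
    then show ?thesis by simp
  qed
  then show ?case using part homogeneous_part_zero
    by (intro exI[of _ d] exI[of _ ?h]) auto
next
  case (add f g)
  then obtain K h K' h' where h: "\<forall>d. h d \<in> homogeneous_part d" "\<forall>d>K. h d = (\<lambda>_. 0)" "f = (\<lambda>p. \<Sum>d\<le>K. h d p)"
    and h': "\<forall>d. h' d \<in> homogeneous_part d" "\<forall>d>K'. h' d = (\<lambda>_. 0)" "g = (\<lambda>p. \<Sum>d\<le>K'. h' d p)"
    by blast
  let ?K = "max K K'"
  have "(\<Sum>d\<le>K. h d p) = (\<Sum>d\<le>?K. h d p)" for p using h(2) by (intro sum.mono_neutral_left) auto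
  moreover have "(\<Sum>d\<le>K'. h' d p) = (\<Sum>d\<le>?K. h' d p)" for p using h'(2) by (intro sum.mono_neutral_left) auto
  ultimately have "(\<lambda>p. f p + g p) = (\<lambda>p. \<Sum>d\<le>?K. h d p + h' d p)"
    by (simp add: h(3) h'(3) sum.distrib)
  moreover have "\<forall>d. (\<lambda>p. h d p + h' d p) \<in> homogeneous_part d"
    using h(1) h'(1) homogeneous_part_add by blast
  moreover have "\<forall>d>?K. (\<lambda>p. h d p + h' d p) = (\<lambda>_. 0)" using h(2) h'(2) by simp
  ultimately show ?case by (intro exI[of _ ?K] exI[of _ "\<lambda>d p. h d p + h' d p"]) simp
qed

lemma poly_eq_coeff:
  fixes a :: "nat \<Rightarrow> complex"
  assumes "\<And>t. (\<Sum>d\<le>K. t ^ d * a d) = poly p t"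
  shows "coeff p D = (if D \<le> K then a D else 0)"
proof -
  have "poly (\<Sum>d\<le>K. monom (a d) d) t = poly p t" for t
    using assms[of t] by (simp add: poly_sum poly_monom mult.commute)
  then have "p = (\<Sum>d\<le>K. monom (a d) d)" by (metis poly_eq_poly_eq_iff ext)
  then show ?thesis by (simp add: coeff_sum)
qed

text \<open>\<open>fst_homogeneous\<close> only states a scaling law. Comparing the coefficients in
  the scaling parameter identifies the function with its own component of degree
  \<open>k\<close>.\<close>

lemma fst_homogeneous_part:
  assumes "f \<in> poly_functions coords2" "\<And>t x u. f (t *s x, u) = t ^ k * f (x, u)"
  shows "f \<in> homogeneous_part k"
proof -
  obtain K h where h: "\<forall>d. h d \<in> homogeneous_part d" "\<forall>d>K. h d = (\<lambda>_. 0)" "f = (\<lambda>p. \<Sum>d\<le>K. h d p)"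
    using graded_decomposition[OF poly_functions_graded[OF assms(1)]] by blast
  have "f (x, u) = h k (x, u)" for x u
  proof -
    have "(\<Sum>d\<le>K. t ^ d * h d (x, u)) = poly (monom (f (x, u)) k) t" for t
    proof -
      have "(\<Sum>d\<le>K. t ^ d * h d (x, u)) = (\<Sum>d\<le>K. h d (t *s x, u))"
        by (intro sum.cong refl) (simp add: homogeneous_part_scale[OF h(1)[rule_format]])
      also have "\<dots> = f (t *s x, u)" by (simp add: h(3))
      finally show ?thesis by (simp add: assms(2) poly_monom mult.commute)
    qed
    then have "coeff (monom (f (x, u)) k) k = (if k \<le> K then h k (x, u) else 0)"
      by (rule poly_eq_coeff)
    then show ?thesis using h(2) by (auto split: if_splits)
  qed
  then have "f = h k" by (simp add: fun_eq_iff)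
  then show ?thesis using h(1) by simp
qed

lemma poly_functions2_slice: "f \<in> poly_functions coords2 \<Longrightarrow> (\<lambda>x. f (x, u)) \<in> polys_in UNIV"
proof (induction rule: poly_functions.induct)
  case (coord f)
  then show ?case by (auto simp: coords2_def)
next
  case (add f g)
  then show ?case using polys_in_add[of "\<lambda>x. f (x, u)" UNIV "\<lambda>x. g (x, u)"] by (simp add: plus_fun_def)
next
  case (mult f g)
  then show ?case using polys_in_mult[of "\<lambda>x. f (x, u)" UNIV "\<lambda>x. g (x, u)"] by (simp add: times_fun_def)
qed simp

lemma poly_functions2_fst: "f \<in> polys_in UNIV \<Longrightarrow> (\<lambda>p. f (fst p)) \<in> poly_functions coords2"
  and poly_functions2_snd: "f \<in> polys_in UNIV \<Longrightarrow> (\<lambda>p. f (snd p)) \<in> poly_functions coords2"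
proof -
  have "(\<lambda>p. fst p $ i) \<in> poly_functions coords2" "(\<lambda>p. snd p $ i) \<in> poly_functions coords2" for i :: 'a
    by (intro poly_functions.coord; force simp: coords2_def)+
  then show "f \<in> polys_in UNIV \<Longrightarrow> (\<lambda>p. f (fst p)) \<in> poly_functions coords2"
    "f \<in> polys_in UNIV \<Longrightarrow> (\<lambda>p. f (snd p)) \<in> poly_functions coords2"
    by (blast intro: poly_functions_compose)+
qed

section \<open>Projective Nullstellensatz and the main theorem of elimination theory\<close>

definition ideal_generated :: "(complex^'n \<Rightarrow> complex) set \<Rightarrow> (complex^'n \<Rightarrow> complex) set" where
  "ideal_generated F = {\<Sum>f\<in>G. c f * f | G c. finite G \<and> G \<subseteq> F \<and> (\<forall>f. c f \<in> polys_in UNIV)}"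

lemma ideal_generated_ideal:
  assumes F: "F \<subseteq> polys_in UNIV"
  shows "ideal_in (polys_in UNIV) (ideal_generated F)"
  unfolding ideal_in_def
proof (intro conjI ballI)
  note sr = subring_polys_in[of UNIV]
  show "ideal_generated F \<subseteq> polys_in UNIV"
    unfolding ideal_generated_def using F by (blast intro: subring_sum[OF sr] polys_in_mult)
  have "finite ({} :: (complex^'a \<Rightarrow> complex) set)" "(0::complex^'a \<Rightarrow> complex) \<in> polys_in UNIV"
    "0 = (\<Sum>f\<in>{}. 0 * (f :: complex^'a \<Rightarrow> complex))"
    using subringD(2)[OF sr] by auto
  then show "0 \<in> ideal_generated F" unfolding ideal_generated_def by fastforce
next
  fix a b assume "a \<in> ideal_generated F" "b \<in> ideal_generated F"
  then obtain G c G' c' where G: "finite G" "G \<subseteq> F" "\<forall>f. c f \<in> polys_in UNIV" "a = (\<Sum>f\<in>G. c f * f)"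
    and G': "finite G'" "G' \<subseteq> F" "\<forall>f. c' f \<in> polys_in UNIV" "b = (\<Sum>f\<in>G'. c' f * f)"
    unfolding ideal_generated_def by blast
  define e where "e = (\<lambda>f. (if f \<in> G then c f else 0) + (if f \<in> G' then c' f else 0))"
  have z: "(0 :: complex^'a \<Rightarrow> complex) \<in> polys_in UNIV" by (rule subringD(2)[OF subring_polys_in])
  have e: "\<forall>f. e f \<in> polys_in UNIV"
    unfolding e_def using G(3) G'(3) z by (intro allI polys_in_add) simp_all
  have "a = (\<Sum>f\<in>G \<union> G'. (if f \<in> G then c f else 0) * f)"
    unfolding G(4) using G(1) G'(1) by (intro sum.mono_neutral_cong_left) auto
  moreover have "b = (\<Sum>f\<in>G \<union> G'. (if f \<in> G' then c' f else 0) * f)"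
    unfolding G'(4) using G(1) G'(1) by (intro sum.mono_neutral_cong_left) auto
  ultimately have "a + b = (\<Sum>f\<in>G \<union> G'. e f * f)"
    by (simp only: e_def distrib_right sum.distrib)
  then show "a + b \<in> ideal_generated F"
    unfolding ideal_generated_def using G G' e by blast
next
  fix a b :: "complex^'a \<Rightarrow> complex" assume a: "a \<in> polys_in UNIV" and "b \<in> ideal_generated F"
  then obtain G c where G: "finite G" "G \<subseteq> F" "\<forall>f. c f \<in> polys_in UNIV" "b = (\<Sum>f\<in>G. c f * f)"
    unfolding ideal_generated_def by blast
  have "a * b = (\<Sum>f\<in>G. (a * c f) * f)"
    unfolding G(4) by (simp only: sum_distrib_left mult.assoc)
  moreover have "\<forall>f. a * c f \<in> polys_in UNIV" using G(3) a polys_in_mult by blast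
  ultimately show "a * b \<in> ideal_generated F"
    unfolding ideal_generated_def using G(1,2)
    by (intro CollectI exI[of _ G] exI[of _ "\<lambda>f. a * c f"]) simp
qed

lemma ideal_generated_superset: "F \<subseteq> ideal_generated F"
proof
  fix f assume "f \<in> F"
  moreover have "f = (\<Sum>g\<in>{f}. (\<lambda>_. 1) g * g)" by simp
  moreover have "\<forall>g. (\<lambda>_ :: complex^'a \<Rightarrow> complex. 1) g \<in> polys_in UNIV"
    using subringD[OF subring_polys_in] by simp
  ultimately show "f \<in> ideal_generated F"
    unfolding ideal_generated_def
    by (intro CollectI exI[of _ "{f}"] exI[of _ "\<lambda>_. 1"]) simp
qed

lemma fun_power_apply: "(f ^ k) x = (f x) ^ k" for f :: "'a \<Rightarrow> complex"
  by (induction k) simp_all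

text \<open>If no power of a coordinate were in the ideal, a prime over the ideal avoiding these
  powers would have a zero with that coordinate nonzero. So powers of all coordinates lie in the
  ideal, and with them all long enough monomials.\<close>

lemma projective_nullstellensatz:
  assumes F: "F \<subseteq> polys_in UNIV" and triv: "\<And>x. (\<forall>f\<in>F. f x = 0) \<Longrightarrow> x = 0"
  shows "\<exists>D>0. \<forall>l. length l = D \<longrightarrow> monomial (l :: 'n list) \<in> (ideal_generated F :: (complex^'n \<Rightarrow> complex) set)"
proof -
  let ?A = "ideal_generated F"
  note A = ideal_generated_ideal[OF F]
  have "\<exists>k. coord_fun i ^ k \<in> ?A" for i
  proof (rule ccontr)
    assume no: "\<nexists>k. coord_fun i ^ k \<in> ?A"
    have "\<exists>P. polynomial_prime P \<and> ?A \<subseteq> P \<and> P \<inter> range (\<lambda>k. coord_fun i ^ k) = {}"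
    proof (rule polynomial_prime_avoiding[OF A])
      show "1 \<in> range (\<lambda>k. coord_fun i ^ k)" by (rule range_eqI[of _ _ 0]) simp
      show "a * b \<in> range (\<lambda>k. coord_fun i ^ k)"
        if "a \<in> range (\<lambda>k. coord_fun i ^ k)" "b \<in> range (\<lambda>k. coord_fun i ^ k)" for a b
      proof -
        from that obtain j k where "a = coord_fun i ^ j" "b = coord_fun i ^ k" by blast
        then have "a * b = coord_fun i ^ (j + k)" by (simp only: power_add)
        then show ?thesis by blast
      qed
      show "?A \<inter> range (\<lambda>k. coord_fun i ^ k) = {}" using no by blast
    qed
    then obtain P where P: "polynomial_prime P" "?A \<subseteq> P" "P \<inter> range (\<lambda>k. coord_fun i ^ k) = {}" by blast
    interpret polynomial_prime P by (rule P(1))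
    have "coord_fun i ^ 1 \<notin> P" using P(3) by blast
    then have "coord_fun i \<notin> P" by (simp only: power_one_right not_False_eq_True)
    then obtain x where x: "x \<in> zeros_on UNIV" "x $ i \<noteq> 0"
      using nullstellensatz[of "coord_fun i"] polys_in_coord_UNIV by blast
    have "\<forall>f\<in>F. f x = 0" using ideal_generated_superset P(2) x(1) by (auto simp: zeros_on_UNIV)
    then have "x = 0" by (rule triv)
    then show False using x(2) by simp
  qed
  then obtain k where k: "\<And>i. coord_fun i ^ k i \<in> ?A" by metis
  define K where "K = Max (range k)"
  have K: "k i \<le> K" for i unfolding K_def by (intro Max_ge) auto
  \<comment> \<open>Pigeonhole: in a word of this length some variable occurs at least
    \<open>K\<close> times. The summand 1 also makes the degree positive.\<close>
  have "monomial l \<in> ?A" if l: "length l = CARD('n) * K + 1" for l :: "'n list"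
  proof -
    have "\<exists>i. K \<le> count_list l i"
    proof (rule ccontr)
      assume "\<not> ?thesis"
      then have "count_list l i \<le> K" for i by (meson nat_le_linear)
      then have "sum (count_list l) UNIV \<le> CARD('n) * K"
        using sum_bounded_above[of UNIV "count_list l" K] by simp
      moreover have "sum (count_list l) UNIV = length l" by (rule sum_count_set) auto
      ultimately show False using l by simp
    qed
    then obtain i where i: "K \<le> count_list l i" by blast
    define e where "e = (\<lambda>j. if j = i then count_list l j - k i else count_list l j)"
    define g where "g = (\<lambda>x :: complex^'n. \<Prod>j\<in>UNIV. x $ j ^ e j)"
    have "g \<in> polys_in UNIV"
      unfolding g_def polys_in_UNIV
      by (intro polys_in_prod_fun poly_functions_power polys_in_coord_UNIV[unfolded polys_in_UNIV])
    then have "g * coord_fun i ^ k i \<in> ?A" by (rule ideal_inD(4)[OF A _ k])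
    moreover have "g * coord_fun i ^ k i = monomial l"
    proof
      fix x
      have "monomial l x = (\<Prod>j\<in>UNIV. x $ j ^ e j * (if j = i then x $ j ^ k i else 1))"
        unfolding monomial_count
      proof (rule prod.cong[OF refl])
        fix j
        have "k i \<le> count_list l i" using i K[of i] by simp
        then show "x $ j ^ count_list l j = x $ j ^ e j * (if j = i then x $ j ^ k i else 1)"
          by (simp add: e_def flip: power_add)
      qed
      also have "\<dots> = g x * x $ i ^ k i" by (simp add: g_def prod.distrib)
      finally show "(g * coord_fun i ^ k i) x = monomial l x"
        by (simp only: times_fun_apply fun_power_apply)
    qed
    ultimately show ?thesis by simp
  qed
  then show ?thesis by (intro exI[of _ "CARD('n) * K + 1"]) simp
qed

text \<open>At \<open>u0\<close> every monomial of a suitable degree \<open>D\<close> lies in the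
  ideal of the equations. Lifting such a representation to all u expresses the monomial, on the
  common zeros, through monomials of degree \<open>D\<close> with coefficients that vanish at
  \<open>u0\<close>; by \<open>nakayama\<close> the monomials then vanish wherever some
  \<open>g\<close> with \<open>g u0\<close> nonzero does not.\<close>

theorem elimination:
  fixes F :: "((complex^'n) \<times> (complex^'n) \<Rightarrow> complex) set"
  assumes F: "F \<subseteq> fst_homogeneous" and triv: "\<And>x. (\<forall>f\<in>F. f (x, u0) = 0) \<Longrightarrow> x = 0"
  obtains g where "g \<in> polys_in UNIV" "g u0 \<noteq> 0"
    "\<And>u x. g u \<noteq> 0 \<Longrightarrow> \<forall>f\<in>F. f (x, u) = 0 \<Longrightarrow> x = 0"
proof -
  let ?s = "\<lambda>f :: (complex^'n) \<times> (complex^'n) \<Rightarrow> complex. \<lambda>x. f (x, u0)"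
  have FR: "f \<in> poly_functions coords2" if "f \<in> F" for f using F that by (auto simp: fst_homogeneous_def)
  have "\<forall>f\<in>F. \<exists>k. f \<in> homogeneous_part k"
    using F fst_homogeneous_part unfolding fst_homogeneous_def by blast
  then obtain deg where deg: "\<forall>f\<in>F. f \<in> homogeneous_part (deg f)" by metis
  have sF: "?s ` F \<subseteq> polys_in UNIV"
    by (rule image_subsetI) (rule poly_functions2_slice[OF FR])
  have "x = 0" if "\<forall>f\<in>?s ` F. f x = 0" for x
    by (intro triv ballI) (rule that[rule_format, OF imageI])
  then have "\<exists>D>0. \<forall>l. length l = D \<longrightarrow> monomial (l :: 'n list) \<in> ideal_generated (?s ` F)"
    by (rule projective_nullstellensatz[OF sF])
  then obtain D where D: "D > 0"
    and D': "\<forall>l :: 'n list. length l = D \<longrightarrow> monomial l \<in> ideal_generated (?s ` F)" by blast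
  have rel: "\<exists>r. (\<forall>m. r m \<in> polys_in UNIV \<and> r m u0 = 0) \<and>
      (\<forall>x u. (\<forall>f\<in>F. f (x, u) = 0) \<longrightarrow> monomial l x = (\<Sum>m\<in>lists_of_length D. r m u * monomial m x))"
    if l: "length l = D" for l :: "'n list"
  proof -
    obtain G c where G: "finite G" "G \<subseteq> ?s ` F" "\<forall>f. c f \<in> polys_in UNIV" "monomial l = (\<Sum>f\<in>G. c f * f)"
      using D'[rule_format, OF l] unfolding ideal_generated_def by blast
    have "\<forall>g\<in>G. \<exists>f. f \<in> F \<and> g = ?s f" using G(2) by blast
    from bchoice[OF this] obtain \<phi> where \<phi>': "\<forall>g\<in>G. \<phi> g \<in> F \<and> g = ?s (\<phi> g)" ..
    have \<phi>: "\<phi> g \<in> F" "g x = \<phi> g (x, u0)" if "g \<in> G" for g x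
      using bspec[OF \<phi>' that] by (rule conjunct1) (rule fun_cong[OF conjunct2[OF bspec[OF \<phi>' that]]])
    have "\<exists>K h. (\<forall>d. h d \<in> homogeneous_part d) \<and> (\<forall>d>K. h d = (\<lambda>_. 0)) \<and>
        (\<lambda>p. c g (fst p)) = (\<lambda>p. \<Sum>d\<le>K. h d p)" for g
      using G(3) by (intro graded_decomposition poly_functions_graded poly_functions2_fst) simp
    then obtain K h where h: "\<And>g d. h g d \<in> homogeneous_part d" "\<And>g d. d > K g \<Longrightarrow> h g d = (\<lambda>_. 0)"
      "\<And>g. (\<lambda>p. c g (fst p)) = (\<lambda>p. \<Sum>d\<le>K g. h g d p)" by metis
    have ch: "c g x = (\<Sum>d\<le>K g. h g d (x, u))" for g x u
      using fun_cong[OF h(3)[of g], of "(x, u)"] by simp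
    define k where "k = (\<lambda>g. deg (\<phi> g))"
    have hom: "\<phi> g \<in> homogeneous_part (k g)" if "g \<in> G" for g
      using deg \<phi>(1)[OF that] by (simp add: k_def)
    define G' where "G' = {g\<in>G. k g \<le> D}"
    \<comment> \<open>The part of degree \<open>D\<close> in x of the representation, with the
      slices at \<open>u0\<close> replaced by the full equations \<open>\<phi> g\<close>. It
      vanishes on all common zeros and specialises to the monomial at \<open>u0\<close>.\<close>
    define S where "S = (\<lambda>p. \<Sum>g\<in>G'. h g (D - k g) p * \<phi> g p)"
    have S: "S \<in> homogeneous_part D"
      unfolding S_def
    proof (rule homogeneous_part_sum)
      fix g assume "g \<in> G'"
      then have "(\<lambda>p. h g (D - k g) p * \<phi> g p) \<in> homogeneous_part ((D - k g) + k g)"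
        using hom by (intro homogeneous_part_mult h(1)) (simp add: G'_def)
      then show "(\<lambda>p. h g (D - k g) p * \<phi> g p) \<in> homogeneous_part D"
        using \<open>g \<in> G'\<close> by (simp add: G'_def)
    qed
    have S0: "S (x, u0) = monomial l x" for x
    proof -
      \<comment> \<open>Rescaling x by t turns the grading into powers of t; the coefficient of
        degree \<open>D\<close> extracts the wanted part of the identity.\<close>
      define p where "p = (\<Sum>g\<in>G. \<Sum>d\<le>K g. monom (h g d (x, u0) * g x) (d + k g))"
      have gt: "g (t *s x) = t ^ k g * g x" if "g \<in> G" for g t
        using homogeneous_part_scale[OF hom[OF that], of t x u0] \<phi>(2)[OF that] by simp
      have "poly p t = poly (monom (monomial l x) D) t" for t
      proof -
        have "poly (monom (monomial l x) D) t = monomial l (t *s x)"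
          by (simp add: poly_monom monomial_scale l mult.commute)
        also have "\<dots> = (\<Sum>g\<in>G. c g (t *s x) * g (t *s x))"
          unfolding G(4) by (induction G rule: infinite_finite_induct) simp_all
        also have "\<dots> = (\<Sum>g\<in>G. \<Sum>d\<le>K g. t ^ (d + k g) * (h g d (x, u0) * g x))"
        proof (rule sum.cong[OF refl])
          fix g assume g: "g \<in> G"
          have "c g (t *s x) = (\<Sum>d\<le>K g. t ^ d * h g d (x, u0))"
            unfolding ch[of g "t *s x" u0] using homogeneous_part_scale[OF h(1)] by simp
          then have "c g (t *s x) * g (t *s x) = (\<Sum>d\<le>K g. t ^ d * h g d (x, u0)) * (t ^ k g * g x)"
            by (simp only: gt[OF g])
          also have "\<dots> = (\<Sum>d\<le>K g. t ^ (d + k g) * (h g d (x, u0) * g x))"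
            unfolding sum_distrib_right by (intro sum.cong refl) (simp add: power_add)
          finally show "c g (t *s x) * g (t *s x) = (\<Sum>d\<le>K g. t ^ (d + k g) * (h g d (x, u0) * g x))" .
        qed
        also have "\<dots> = poly p t" by (simp add: p_def poly_sum poly_monom mult.commute)
        finally show ?thesis by simp
      qed
      then have "p = monom (monomial l x) D" by (metis poly_eq_poly_eq_iff ext)
      then have "monomial l x = coeff p D" by simp
      also have "\<dots> = (\<Sum>g\<in>G. \<Sum>d\<le>K g. if d + k g = D then h g d (x, u0) * g x else 0)"
        by (simp add: p_def coeff_sum)
      also have "\<dots> = (\<Sum>g\<in>G. if k g \<le> D then h g (D - k g) (x, u0) * g x else 0)"
      proof (rule sum.cong[OF refl])
        fix g
        show "(\<Sum>d\<le>K g. if d + k g = D then h g d (x, u0) * g x else 0) =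
          (if k g \<le> D then h g (D - k g) (x, u0) * g x else 0)"
        proof (cases "k g \<le> D")
          case True
          have "(\<Sum>d\<le>K g. if d + k g = D then h g d (x, u0) * g x else 0) =
              (\<Sum>d\<le>K g. if d = D - k g then h g d (x, u0) * g x else 0)"
            using True by (intro sum.cong) auto
          also have "\<dots> = (if D - k g \<le> K g then h g (D - k g) (x, u0) * g x else 0)" by simp
          also have "\<dots> = h g (D - k g) (x, u0) * g x" using h(2)[of g "D - k g"] by simp
          finally show ?thesis using True by simp
        next
          case False
          then show ?thesis by (auto intro: sum.neutral)
        qed
      qed
      also have "\<dots> = (\<Sum>g\<in>G'. h g (D - k g) (x, u0) * g x)"
        unfolding G'_def by (rule sum.inter_filter[OF G(1), symmetric])
      also have "\<dots> = S (x, u0)"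
        unfolding S_def using \<phi>(2) by (intro sum.cong) (auto simp: G'_def)
      finally show ?thesis by simp
    qed
    obtain a where a: "\<And>m. a m \<in> polys_in UNIV" "\<And>x u. S (x, u) = (\<Sum>m\<in>lists_of_length D. a m u * monomial m x)"
      by (rule homogeneous_partE[OF S], rule that) blast+
    define \<delta> where "\<delta> = (\<lambda>m. if m = l then 1 else 0 :: complex)"
    have \<delta>: "(\<Sum>m\<in>lists_of_length D. \<delta> m * monomial m x) = monomial l x" for x
    proof -
      have "l \<in> lists_of_length D" using l by (simp add: lists_of_length_def)
      then show ?thesis
        by (simp add: \<delta>_def finite_lists_of_length if_distrib[of "\<lambda>c. c * _"] cong: if_cong)
    qed
    \<comment> \<open>On the common zeros \<open>S\<close> is 0, so the monomial
      \<open>S (x, u0)\<close> equals \<open>S (x, u0) - S (x, u)\<close>; these are its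
      coefficients, and they vanish at \<open>u0\<close> by construction.\<close>
    define r where "r = (\<lambda>m u. a m u0 - a m u)"
    have "r m \<in> polys_in UNIV" for m
      unfolding r_def polys_in_UNIV using a(1) unfolding polys_in_UNIV
      by (intro poly_functions_minus poly_functions.const)
    moreover have "r m u0 = 0" for m by (simp add: r_def)
    moreover have "monomial l x = (\<Sum>m\<in>lists_of_length D. r m u * monomial m x)"
      if "\<forall>f\<in>F. f (x, u) = 0" for x u
    proof -
      have "S (x, u) = 0"
        unfolding S_def using that \<phi>(1) by (intro sum.neutral) (auto simp: G'_def)
      then show ?thesis
        using S0[of x] a(2)[of x u] a(2)[of x u0]
        by (simp add: r_def left_diff_distrib sum_subtractf)
    qed
    ultimately show ?thesis by blast
  qed
  have "\<forall>l. \<exists>r. length l = D \<longrightarrow> (\<forall>m. r m \<in> polys_in UNIV \<and> r m u0 = 0) \<and>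
      (\<forall>x u. (\<forall>f\<in>F. f (x, u) = 0) \<longrightarrow> monomial l x = (\<Sum>m\<in>lists_of_length D. r m u * monomial m x))"
    using rel by blast
  from choice[OF this] obtain r0 where r0: "\<And>l. length l = D \<Longrightarrow> (\<forall>m. r0 l m \<in> polys_in UNIV \<and> r0 l m u0 = 0) \<and>
      (\<forall>x u. (\<forall>f\<in>F. f (x, u) = 0) \<longrightarrow> monomial l x = (\<Sum>m\<in>lists_of_length D. r0 l m u * monomial m x))"
    by blast
  define r where "r = (\<lambda>l m. if length l = D then r0 l m else (\<lambda>_. 0))"
  have r: "r l m \<in> poly_functions coords" "r l m u0 = 0" for l m
    using r0[of l] poly_functions.const[of 0 coords] by (auto simp: r_def polys_in_UNIV[symmetric])
  have "\<exists>g\<in>poly_functions coords. g u0 \<noteq> 0 \<and>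
    (\<forall>u m. (\<forall>a\<in>lists_of_length D. 1 * m a = (\<Sum>b\<in>lists_of_length D. r a b u * m b)) \<longrightarrow>
      (\<forall>a\<in>lists_of_length D. g u * m a = 0))"
    by (rule nakayama[OF finite_lists_of_length poly_functions.const[of 1]]) (simp_all add: r)
  then obtain g where g: "g \<in> poly_functions coords" "g u0 \<noteq> 0" and
    nak: "\<And>u m. (\<forall>a\<in>lists_of_length D. m a = (\<Sum>b\<in>lists_of_length D. r a b u * m b)) \<Longrightarrow>
      (\<forall>a\<in>lists_of_length D. g u * m a = 0)"
    by (simp only: mult_1_left) (elim bexE conjE, rule that, blast+)
  show ?thesis
  proof (rule that)
    show "g \<in> polys_in UNIV" using g(1) by (simp only: polys_in_UNIV)
    show "g u0 \<noteq> 0" by (rule g(2))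
    fix u x assume u: "g u \<noteq> 0" and x: "\<forall>f\<in>F. f (x, u) = 0"
    have "\<forall>l\<in>lists_of_length D. monomial l x = (\<Sum>m\<in>lists_of_length D. r l m u * monomial m x)"
      using r0 x by (simp add: r_def lists_of_length_def)
    then have z: "\<forall>l\<in>lists_of_length D. g u * monomial l x = 0" by (rule nak)
    have "x $ i = 0" for i
    proof -
      have "replicate D i \<in> lists_of_length D" by (simp add: lists_of_length_def)
      then have "g u * x $ i ^ D = 0" using z by force
      then show ?thesis using u D by simp
    qed
    then show "x = 0" by (simp add: vec_eq_iff)
  qed
qed

section \<open>Infinite closed sets\<close>

text \<open>A closed set minimal among the infinite ones is irreducible, as one of two closed pieces
  covering it must be infinite and hence everything. The topology and the map \<open>I\<close> to
  ideals are left abstract, for use both on affine space and on the projective bundle.\<close>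

lemma minimal_infinite_closed:
  assumes R: "noetherian R" and I: "\<And>A. closedin T A \<Longrightarrow> ideal_in R (I A)"
    and anti: "\<And>A B. closedin T A \<Longrightarrow> closedin T B \<Longrightarrow> B \<subseteq> A \<Longrightarrow> I A \<subseteq> I B"
    and inj: "\<And>A B. closedin T A \<Longrightarrow> closedin T B \<Longrightarrow> I A = I B \<Longrightarrow> A = B"
    and S: "closedin T S" "infinite S"
  obtains A where "closedin T A" "A \<subseteq> S" "infinite A" "irreducible_in T A"
proof -
  let ?F = "{A. closedin T A \<and> A \<subseteq> S \<and> infinite A}"
  have ne: "I ` ?F \<noteq> {}" using S by blast
  have "\<exists>M\<in>I ` ?F. \<forall>J\<in>I ` ?F. M \<subseteq> J \<longrightarrow> J = M"
  proof (rule noetherian_maximal[OF R _ ne])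
    show "ideal_in R J" if "J \<in> I ` ?F" for J
    proof -
      from that obtain A where "closedin T A" "J = I A" by blast
      then show ?thesis using I by simp
    qed
    fix M assume "M \<in> I ` ?F" "\<And>J. J \<in> I ` ?F \<Longrightarrow> M \<subseteq> J \<Longrightarrow> J = M"
    then show ?thesis by (intro bexI[where x = M] ballI impI)
  qed
  then obtain M where M: "M \<in> I ` ?F" and max: "\<forall>J\<in>I ` ?F. M \<subseteq> J \<longrightarrow> J = M" by (rule bexE)
  then obtain A where A: "A \<in> ?F" "M = I A" by blast
  then have cA: "closedin T A" and AS: "A \<subseteq> S" and infA: "infinite A" by auto
  have min: "B = A" if B: "closedin T B" "B \<subseteq> A" "infinite B" for B
  proof (rule inj[OF B(1) cA])
    have "I B \<in> I ` ?F" using B AS by blast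
    then show "I B = I A" using bspec[OF max, of "I B"] anti[OF cA B(1,2)] A(2) by simp
  qed
  have "irreducible_in T A"
    unfolding irreducible_in_def
  proof (intro conjI allI impI)
    show "A \<subseteq> topspace T" using closedin_subset[OF cA] .
    show "A \<noteq> {}" using infA by auto
    fix B C assume BC: "closedin T B" "closedin T C" "A \<subseteq> B \<union> C"
    have "A = (A \<inter> B) \<union> (A \<inter> C)" using BC(3) by blast
    then have "infinite (A \<inter> B) \<or> infinite (A \<inter> C)" using infA finite_UnI by metis
    then have "A \<inter> B = A \<or> A \<inter> C = A"
      using min[of "A \<inter> B"] min[of "A \<inter> C"] BC(1,2) cA by (auto intro: closedin_Int)
    then show "A \<subseteq> B \<or> A \<subseteq> C" by blast
  qed
  then show ?thesis using that cA AS infA by blast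
qed

lemma vanishing_ideal_ideal: "ideal_in (polys_in UNIV) (vanishing_ideal W)"
  using subringD[OF subring_polys_in[of UNIV]]
  by (simp add: ideal_in_def vanishing_ideal_alt) (simp add: polys_in_mult polys_in_add)

text \<open>On an infinite irreducible closed subset a transcendental coordinate would be unbounded;
  so every coordinate is algebraic over the constants and takes finitely many values.\<close>

lemma bounded_closed_finite:
  fixes Y :: "(complex^'n) set"
  assumes Y: "closedin zariski Y" and bdd: "bounded Y"
  shows "finite Y"
proof (rule ccontr)
  assume inf: "infinite Y"
  obtain A where A: "closedin zariski A" "A \<subseteq> Y" "infinite A" "irreducible_in zariski A"
  proof (rule minimal_infinite_closed[OF noetherian_polys_in vanishing_ideal_ideal _ _ Y inf])
    show "vanishing_ideal A \<subseteq> vanishing_ideal B" if "B \<subseteq> A" for A B :: "(complex^'n) set"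
      using that by (rule vanishing_ideal_antimono)
    show "A = B" if "closedin zariski A" "closedin zariski B" "vanishing_ideal A = vanishing_ideal B"
      for A B :: "(complex^'n) set"
      using closed_eq_zeros[OF that(1)] closed_eq_zeros[OF that(2)] that(3) by simp
  qed blast
  interpret polynomial_prime "vanishing_ideal A" by (rule irreducible_prime[OF A(4)])
  have zA: "zeros_on UNIV = A" unfolding zeros_on_UNIV using closed_eq_zeros[OF A(1)] by simp
  obtain M where M: "\<And>y. y \<in> A \<Longrightarrow> norm y \<le> M"
    using bdd A(2) unfolding bounded_iff by blast
  have one: "1 \<in> polys_in UNIV" by (rule subringD(1)[OF subring_polys_in])
  have alg: "alg {} i" for i
  proof (rule ccontr)
    assume na: "\<not> alg {} i"
    have i: "i \<notin> {}" by simp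
    obtain h where h: "h \<in> polys_in {}" "h \<notin> vanishing_ideal A"
      "\<And>x M. x \<in> zeros_on {} \<Longrightarrow> h x \<noteq> 0 \<Longrightarrow>
        \<exists>x'\<in>zeros_on UNIV. (\<forall>j\<in>{}. x' $ j = x $ j) \<and> 1 x' \<noteq> (0::complex) \<and> norm (x' $ i) > M"
      by (rule unbounded_extension[OF na i one P_one], rule that) blast+
    have "h \<noteq> 0" using h(2) P_zero by auto
    then obtain x where "h x \<noteq> 0" by (auto simp: fun_eq_iff)
    then obtain x' where x': "x' \<in> A" "norm (x' $ i) > M"
      using h(3)[of x M] by (auto simp: zeros_on_empty zA)
    then show False using M[OF x'(1)] Finite_Cartesian_Product.norm_nth_le[of x' i] by simp
  qed
  have "finite ((\<lambda>x. x $ i) ` A)" for i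
  proof -
    obtain q where q: "coeffs_in (polys_in {}) q" "\<not> coeffs_in (vanishing_ideal A) q"
      "poly q (coord_fun i) \<in> vanishing_ideal A"
      using alg[of i] unfolding alg_def algebraic_over_def by blast
    have "A \<noteq> {}" using A(3) by auto
    then obtain a where a: "a \<in> A" by blast
    have ev: "eval_poly x q = eval_poly a q" for x
    proof (rule poly_eqI)
      fix k
      have "coeff q k \<in> polys_in {}" using q(1) by (simp add: coeffs_in_def)
      then show "coeff (eval_poly x q) k = coeff (eval_poly a q) k"
        unfolding coeff_eval_poly by (rule polys_in_cong) simp
    qed
    obtain k where k: "coeff q k \<notin> vanishing_ideal A" using q(2) by (auto simp: coeffs_in_def)
    have "eval_poly a q \<noteq> 0"
    proof
      assume "eval_poly a q = 0"
      then have "coeff q k x = 0" for x by (metis coeff_0 coeff_eval_poly ev)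
      then have "coeff q k = 0" by (simp add: fun_eq_iff)
      then show False using k P_zero by simp
    qed
    then have "finite {t. poly (eval_poly a q) t = 0}" by (rule poly_roots_finite)
    moreover have "(\<lambda>x. x $ i) ` A \<subseteq> {t. poly (eval_poly a q) t = 0}"
    proof
      fix t assume "t \<in> (\<lambda>x. x $ i) ` A"
      then obtain x where x: "x \<in> A" "t = x $ i" by blast
      have "poly q (coord_fun i) x = 0" using q(3) x(1) by (simp add: vanishing_ideal_alt)
      then show "t \<in> {t. poly (eval_poly a q) t = 0}" using ev[of x] x(2) by (simp add: poly_fun_apply)
    qed
    ultimately show ?thesis using finite_subset by blast
  qed
  then have "finite (PiE UNIV (\<lambda>i. (\<lambda>x. x $ i) ` A))" by (intro finite_PiE) auto
  then have "finite (vec_lambda ` PiE UNIV (\<lambda>i. (\<lambda>x. x $ i) ` A))" by (rule finite_imageI)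
  moreover have "A \<subseteq> vec_lambda ` PiE UNIV (\<lambda>i. (\<lambda>x. x $ i) ` A)"
  proof
    fix x assume "x \<in> A"
    then have "(\<lambda>i. x $ i) \<in> PiE UNIV (\<lambda>i. (\<lambda>x. x $ i) ` A)" by auto
    then have "vec_lambda (\<lambda>i. x $ i) \<in> vec_lambda ` PiE UNIV (\<lambda>i. (\<lambda>x. x $ i) ` A)" by (rule imageI)
    then show "x \<in> vec_lambda ` PiE UNIV (\<lambda>i. (\<lambda>x. x $ i) ` A)" by (simp only: vec_lambda_eta)
  qed
  ultimately show False using A(3) finite_subset by blast
qed

section \<open>Closed subsets of the projective bundle\<close>

lemma topspace_zariski_proj: "topspace zariski_proj = proj_affine"
proof
  show "topspace zariski_proj \<subseteq> proj_affine"
    unfolding topspace_def by (auto simp: openin_zariski_proj)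
  have "(\<lambda>_. 1) \<in> fst_homogeneous"
    unfolding fst_homogeneous_def using poly_functions.const[of 1 coords2] by (auto intro!: exI[of _ 0])
  moreover have "proj_affine - proj_affine = proj_zero_locus {\<lambda>_. 1}" by (auto simp: proj_zero_locus_def)
  ultimately have "openin zariski_proj proj_affine" unfolding openin_zariski_proj by blast
  then show "proj_affine \<subseteq> topspace zariski_proj" by (rule openin_subset)
qed

lemma proj_zero_locus_subset: "proj_zero_locus F \<subseteq> proj_affine"
  unfolding proj_zero_locus_def proj_affine_def by blast

lemma closedin_zariski_proj:
  "closedin zariski_proj A \<longleftrightarrow> (\<exists>F \<subseteq> fst_homogeneous. A = proj_zero_locus F)"
proof
  assume "closedin zariski_proj A"
  then obtain F where "A \<subseteq> proj_affine" "F \<subseteq> fst_homogeneous" "proj_affine - (proj_affine - A) = proj_zero_locus F"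
    unfolding closedin_def openin_zariski_proj topspace_zariski_proj by blast
  then show "\<exists>F \<subseteq> fst_homogeneous. A = proj_zero_locus F" by (metis double_diff order_refl)
next
  assume "\<exists>F \<subseteq> fst_homogeneous. A = proj_zero_locus F"
  then obtain F where F: "F \<subseteq> fst_homogeneous" "A = proj_zero_locus F" by blast
  then have "A \<subseteq> proj_affine" using proj_zero_locus_subset by blast
  moreover from this have "proj_affine - (proj_affine - A) = proj_zero_locus F" using F(2) by blast
  ultimately show "closedin zariski_proj A"
    unfolding closedin_def openin_zariski_proj topspace_zariski_proj using F(1) by blast
qed

lemma finite_coords2: "finite (coords2 :: ((complex^'n) \<times> (complex^'n) \<Rightarrow> complex) set)"
  by (simp add: coords2_def)

text \<open>All polynomials vanishing on the nonzero representatives, not only homogeneous ones, so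
  that this is an ideal of a Noetherian ring; its homogeneous members already recover a closed
  set.\<close>

definition proj_ideal ::
    "((complex^'n) set \<times> (complex^'n)) set \<Rightarrow> ((complex^'n) \<times> (complex^'n) \<Rightarrow> complex) set" where
  "proj_ideal A = {f \<in> poly_functions coords2. \<forall>x u. x \<noteq> 0 \<longrightarrow> (proj_point x, u) \<in> A \<longrightarrow> f (x, u) = 0}"

lemma proj_ideal_ideal: "ideal_in (poly_functions coords2) (proj_ideal A)"
  using subringD[OF subring_poly_functions[of coords2]]
  unfolding ideal_in_def by (auto simp: proj_ideal_def)

lemma closed_eq_proj_zero_locus:
  assumes "closedin zariski_proj A"
  shows "A = proj_zero_locus (proj_ideal A \<inter> fst_homogeneous)"
proof -
  obtain F where F: "F \<subseteq> fst_homogeneous" "A = proj_zero_locus F"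
    using assms unfolding closedin_zariski_proj by blast
  have "F \<subseteq> proj_ideal A"
    using F proj_zero_locus_iff[OF F(1)] by (auto simp: proj_ideal_def fst_homogeneous_def)
  then show ?thesis
  proof (intro equalityI subsetI)
    fix p assume p: "p \<in> A"
    then obtain x u where "p = (proj_point x, u)" "x \<noteq> 0" unfolding F(2) proj_zero_locus_def by blast
    then show "p \<in> proj_zero_locus (proj_ideal A \<inter> fst_homogeneous)"
      using p by (auto simp: proj_zero_locus_def proj_ideal_def)
  next
    fix p assume FA: "F \<subseteq> proj_ideal A" and "p \<in> proj_zero_locus (proj_ideal A \<inter> fst_homogeneous)"
    then obtain x u where p: "p = (proj_point x, u)" "x \<noteq> 0"
      "\<forall>f\<in>proj_ideal A \<inter> fst_homogeneous. f (x, u) = 0" unfolding proj_zero_locus_def by blast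
    have "\<forall>f\<in>F. f (x, u) = 0" using p(3) FA F(1) by blast
    then have "p \<in> proj_zero_locus F" using p(1,2) unfolding proj_zero_locus_def by blast
    then show "p \<in> A" by (simp only: F(2))
  qed
qed

lemma infinite_proj_closed:
  assumes "closedin zariski_proj S" "infinite S"
  obtains A where "closedin zariski_proj A" "A \<subseteq> S" "infinite A" "irreducible_in zariski_proj A"
proof (rule minimal_infinite_closed[OF noetherian_poly_functions[OF finite_coords2] proj_ideal_ideal _ _ assms])
  show "proj_ideal A \<subseteq> proj_ideal B" if "B \<subseteq> A" for A B :: "((complex^'a) set \<times> (complex^'a)) set"
    using that unfolding proj_ideal_def by blast
  show "A = B" if "closedin zariski_proj A" "closedin zariski_proj B" "proj_ideal A = proj_ideal B"
    for A B :: "((complex^'a) set \<times> (complex^'a)) set"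
    using closed_eq_proj_zero_locus[OF that(1)] closed_eq_proj_zero_locus[OF that(2)] that(3) by simp
qed (rule that)

lemma poly_functions2_coord:
  "(\<lambda>p. fst p $ i) \<in> poly_functions coords2" "(\<lambda>p. snd p $ i) \<in> poly_functions coords2"
  using poly_functions2_fst[OF polys_in_coord_UNIV] poly_functions2_snd[OF polys_in_coord_UNIV] by blast+

definition fibre_equations :: "complex^'n \<Rightarrow> ((complex^'n) \<times> (complex^'n) \<Rightarrow> complex) set" where
  "fibre_equations u0 = range (\<lambda>i p. snd p $ i - u0 $ i)"

lemma fibre_equations_homogeneous: "fibre_equations u0 \<subseteq> fst_homogeneous"
proof
  fix f assume "f \<in> fibre_equations u0"
  then obtain i where f: "f = (\<lambda>p. snd p $ i - u0 $ i)" by (auto simp: fibre_equations_def)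
  have "f \<in> poly_functions coords2"
    unfolding f by (intro poly_functions_minus poly_functions2_coord poly_functions.const)
  then show "f \<in> fst_homogeneous" by (auto simp: fst_homogeneous_def f intro!: exI[of _ 0])
qed

lemma fibre_equations_iff: "(\<forall>f\<in>fibre_equations u0. f (x, u) = 0) \<longleftrightarrow> u = u0"
  by (auto simp: fibre_equations_def vec_eq_iff)

text \<open>The line is cut out by the 2 by 2 minors of the pair x, \<open>a\<close>, the second
  component by \<open>fibre_equations\<close>.\<close>

lemma closedin_proj_singleton:
  fixes a u0 :: "complex^'n"
  assumes a: "a \<noteq> 0"
  shows "closedin zariski_proj {(proj_point a, u0)}"
proof -
  let ?E = "(\<lambda>(i, j) (p :: (complex^'n) \<times> (complex^'n)). fst p $ i * a $ j - fst p $ j * a $ i) ` UNIV"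
  have E: "?E \<subseteq> fst_homogeneous"
  proof
    fix f assume "f \<in> ?E"
    then obtain i j where f: "f = (\<lambda>p. fst p $ i * a $ j - fst p $ j * a $ i)" by auto
    have "f \<in> poly_functions coords2"
      unfolding f by (intro poly_functions_minus poly_functions.mult poly_functions2_coord poly_functions.const)
    moreover have "\<forall>t x u. f (t *s x, u) = t ^ 1 * f (x, u)" by (simp add: f algebra_simps)
    ultimately show "f \<in> fst_homogeneous" unfolding fst_homogeneous_def by blast
  qed
  let ?F = "?E \<union> fibre_equations u0"
  have F: "?F \<subseteq> fst_homogeneous" using E fibre_equations_homogeneous by blast
  have line: "proj_point x = proj_point a" if x: "x \<noteq> 0" "\<forall>f\<in>?E. f (x, u) = 0" for x u
  proof -
    have ij: "x $ i * a $ j = x $ j * a $ i" for i j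
      using bspec[OF x(2), of "\<lambda>p. fst p $ i * a $ j - fst p $ j * a $ i"] by force
    obtain j where j: "a $ j \<noteq> 0" using a by (auto simp: vec_eq_iff)
    define t where "t = x $ j / a $ j"
    have xt: "x = t *s a"
      unfolding vec_eq_iff
    proof
      fix i
      show "x $ i = (t *s a) $ i" using ij[of i j] j by (simp add: t_def field_simps)
    qed
    then have t: "t \<noteq> 0" using x(1) by auto
    show ?thesis
    proof
      show "proj_point x \<subseteq> proj_point a" by (auto simp: proj_point_def xt)
      have "c *s a = (c / t) *s x" for c using t by (simp add: xt)
      then show "proj_point a \<subseteq> proj_point x" unfolding proj_point_def by blast
    qed
  qed
  have "{(proj_point a, u0)} = proj_zero_locus ?F"
  proof (intro equalityI subsetI)
    fix p assume "p \<in> {(proj_point a, u0)}"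
    moreover have "\<forall>f\<in>?F. f (a, u0) = 0"
      using fibre_equations_iff[of u0 a u0] by auto
    ultimately show "p \<in> proj_zero_locus ?F" using a unfolding proj_zero_locus_def by blast
  next
    fix p assume "p \<in> proj_zero_locus ?F"
    then obtain x u where p: "p = (proj_point x, u)" "x \<noteq> 0" "\<forall>f\<in>?F. f (x, u) = 0"
      unfolding proj_zero_locus_def by blast
    have "u = u0" using p(3) fibre_equations_iff[of u0 x u] by blast
    moreover have "proj_point x = proj_point a" using line[OF p(2)] p(3) by blast
    ultimately show "p \<in> {(proj_point a, u0)}" using p(1) by simp
  qed
  then show ?thesis unfolding closedin_zariski_proj using F by blast
qed

section \<open>Homogeneous equations of the correspondence and finiteness of its fibres\<close>

definition correspondence_equations ::
    "((complex^'n) \<times> (complex^'n)) set \<Rightarrow> ((complex^'n) \<times> (complex^'n) \<Rightarrow> complex) set" where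
  "correspondence_equations E = {f \<in> fst_homogeneous. \<forall>(x, u)\<in>E. x \<noteq> 0 \<longrightarrow> f (x, u) = 0}"

text \<open>The closure is the zero locus of some homogeneous functions, and each of these vanishes
  on the correspondence away from x = 0, so it is among the equations.\<close>

lemma in_proj_ED_corr:
  assumes x: "x \<noteq> 0" and eq: "\<forall>f\<in>correspondence_equations (ED_corr X X). f (x, u) = 0"
  shows "(proj_point x, u) \<in> proj_ED_corr X"
proof -
  let ?S = "(\<lambda>(x, u). (proj_point x, u)) ` (ED_corr X X \<inter> (- {0}) \<times> UNIV)"
  have S: "?S \<subseteq> topspace zariski_proj" unfolding topspace_zariski_proj by (auto simp: proj_affine_def)
  obtain F where F: "F \<subseteq> fst_homogeneous" "proj_ED_corr X = proj_zero_locus F"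
    using closedin_closure_of[of zariski_proj ?S] unfolding closedin_zariski_proj proj_ED_corr_def by blast
  have sub: "?S \<subseteq> proj_zero_locus F"
    using closure_of_subset[OF S] F(2) unfolding proj_ED_corr_def by simp
  have "F \<subseteq> correspondence_equations (ED_corr X X)"
  proof
    fix f assume f: "f \<in> F"
    have "f (y, v) = 0" if "(y, v) \<in> ED_corr X X" "y \<noteq> 0" for y v
    proof -
      have "(y, v) \<in> ED_corr X X \<inter> (- {0}) \<times> UNIV" using that by simp
      then have "(proj_point y, v) \<in> ?S" by (rule rev_image_eqI) simp
      then have "(proj_point y, v) \<in> proj_zero_locus F" using sub by blast
      then show ?thesis using proj_zero_locus_iff[OF F(1) that(2)] f by blast
    qed
    then show "f \<in> correspondence_equations (ED_corr X X)"
      using f F(1) by (auto simp: correspondence_equations_def)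
  qed
  then show ?thesis
    unfolding F(2) using proj_zero_locus_iff[OF F(1) x] eq by blast
qed

text \<open>An infinite fibre would contain an infinite irreducible closed set; together with one of
  its points this is a chain of length one, against dimension zero.\<close>

lemma finite_fibre:
  assumes u0: "u0 \<notin> positive_dim_fibres X"
  shows "finite {proj_point x | x. x \<noteq> 0 \<and> (\<forall>f\<in>correspondence_equations (ED_corr X X). f (x, u0) = 0)}"
    (is "finite ?L")
proof (rule ccontr)
  assume inf: "infinite ?L"
  let ?J = "correspondence_equations (ED_corr X X)"
  let ?F = "?J \<union> fibre_equations u0"
  let ?S = "proj_zero_locus ?F"
  have J: "?J \<subseteq> fst_homogeneous" unfolding correspondence_equations_def by blast
  have F: "?F \<subseteq> fst_homogeneous" using J fibre_equations_homogeneous by blast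
  have memS: "x \<noteq> 0 \<Longrightarrow> (proj_point x, u) \<in> ?S \<longleftrightarrow> (\<forall>f\<in>?J. f (x, u) = 0) \<and> u = u0" for x u
    using proj_zero_locus_iff[OF F, of x u] fibre_equations_iff[of u0 x u] by (simp add: ball_Un)
  have "?L \<times> {u0} \<subseteq> ?S" using memS by auto
  moreover have "infinite (?L \<times> {u0})" using finite_cartesian_productD1[of ?L "{u0}"] inf by blast
  ultimately have infS: "infinite ?S" using finite_subset by blast
  have clS: "closedin zariski_proj ?S" unfolding closedin_zariski_proj using F by blast
  obtain A where A: "closedin zariski_proj A" "A \<subseteq> ?S" "infinite A" "irreducible_in zariski_proj A"
    by (rule infinite_proj_closed[OF clS infS])
  let ?Phi = "{p \<in> proj_ED_corr X. snd p = u0}"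
  have S_Phi: "?S \<subseteq> ?Phi"
  proof
    fix p assume p: "p \<in> ?S"
    then obtain x u where xu: "p = (proj_point x, u)" "x \<noteq> 0" unfolding proj_zero_locus_def by blast
    have "(proj_point x, u) \<in> ?S" using p by (simp only: xu(1))
    then have eq: "\<forall>f\<in>?J. f (x, u) = 0" "u = u0" using memS[OF xu(2), of u] by blast+
    have "(proj_point x, u) \<in> proj_ED_corr X" by (rule in_proj_ED_corr[OF xu(2) eq(1)])
    then show "p \<in> ?Phi" using xu(1) eq(2) by simp
  qed
  have "A \<noteq> {}" using A(3) by auto
  then obtain a where a: "a \<in> A" by blast
  then have "a \<in> ?S" using A(2) by blast
  then obtain x u where xu: "a = (proj_point x, u)" "x \<noteq> 0" unfolding proj_zero_locus_def by blast
  have cla: "closedin zariski_proj {a}" unfolding xu(1) by (rule closedin_proj_singleton[OF xu(2)])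
  have irra: "irreducible_in zariski_proj {a}"
    unfolding irreducible_in_def using closedin_subset[OF cla] by blast
  have "{a} \<subset> A" using a A(3) by (metis finite.emptyI finite.insertI empty_subsetI insert_subset psubsetI)
  define C where "C = (\<lambda>i::nat. if i = 0 then {a} else A)"
  have "\<forall>i\<le>1. closedin (subtopology zariski_proj ?Phi) (C i) \<and> irreducible_in zariski_proj (C i)"
  proof (intro allI impI conjI)
    fix i :: nat
    have "closedin zariski_proj (C i)" "C i \<subseteq> ?Phi"
      using cla A(1,2) a S_Phi by (auto simp: C_def)
    then show "closedin (subtopology zariski_proj ?Phi) (C i)"
      by (auto simp: closedin_subtopology)
    show "irreducible_in zariski_proj (C i)" using irra A(4) by (simp add: C_def)
  qed
  moreover have "\<forall>i<1. C i \<subset> C (Suc i)" using \<open>{a} \<subset> A\<close> by (simp add: C_def)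
  ultimately have "enat 1 \<le> krull_dim zariski_proj ?Phi"
    unfolding krull_dim_def by (intro SUP_upper) blast
  then have "0 < krull_dim zariski_proj ?Phi" 
    by (rule order_less_le_trans[rotated]) (simp add: zero_enat_def)
  then show False using u0 by (simp add: positive_dim_fibres_def)
qed

section \<open>Hyperplanes that avoid finitely many lines\<close>

lemma bilin_poly: "(\<lambda>c. bilin c y) \<in> polys_in UNIV"
  unfolding bilin_sum polys_in_UNIV
  by (intro polys_in_sum_fun poly_functions.mult poly_functions.const polys_in_coord_UNIV[unfolded polys_in_UNIV])

text \<open>Each \<open>y\<close> gives a nonzero linear polynomial in \<open>c\<close>. The product
  of these is nonzero because polynomial functions form a domain, so it has a point of
  non-vanishing.\<close>

lemma exists_generic_linear_form:
  fixes Y :: "(complex^'n) set"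
  assumes "finite Y" "0 \<notin> Y"
  shows "\<exists>c. \<forall>y\<in>Y. bilin c y \<noteq> 0"
proof -
  have "\<exists>p\<in>polys_in UNIV. p \<noteq> 0 \<and> (\<forall>c. p c \<noteq> 0 \<longrightarrow> (\<forall>y\<in>Y. bilin c y \<noteq> 0))"
    using assms
  proof (induction rule: finite_induct)
    case empty
    show ?case
      by (intro bexI[of _ 1] conjI) (rule one_neq_zero, simp, rule subringD(1)[OF subring_polys_in])
  next
    case (insert y Y)
    then obtain p where p: "p \<in> polys_in UNIV" "p \<noteq> 0" "\<forall>c. p c \<noteq> 0 \<longrightarrow> (\<forall>y\<in>Y. bilin c y \<noteq> 0)"
      using insert.IH by blast
    let ?b = "\<lambda>c. bilin c y"
    obtain j where j: "y $ j \<noteq> 0" using insert.prems by (auto simp: vec_eq_iff)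
    have "bilin (axis j 1) y = y $ j"
      by (simp add: bilin_sum axis_def if_distrib[of "\<lambda>t. t * _"] cong: if_cong)
    then have nb: "?b \<noteq> 0" using j by (auto dest: fun_cong[where x = "axis j 1"])
    have pb: "p * ?b \<noteq> 0"
    proof
      assume "p * ?b = 0"
      from polys_in_domain[OF p(1) bilin_poly this] show False
        by (rule disjE) (rule notE[OF p(2)], assumption, rule notE[OF nb], assumption)
    qed
    have key: "\<forall>z\<in>insert y Y. bilin c z \<noteq> 0" if "(p * ?b) c \<noteq> 0" for c
    proof -
      have "p c \<noteq> 0" "bilin c y \<noteq> 0" using that by auto
      then show ?thesis using p(3) by simp
    qed
    show ?case
      by (rule bexI[where x = "p * ?b"], rule conjI, rule pb, intro allI impI, erule key,
          rule polys_in_mult[OF p(1) bilin_poly])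
  qed
  then obtain p :: "complex^'n \<Rightarrow> complex" where p: "p \<noteq> 0" "\<forall>c. p c \<noteq> 0 \<longrightarrow> (\<forall>y\<in>Y. bilin c y \<noteq> 0)"
    by (elim bexE conjE)
  from p(1) obtain c where "p c \<noteq> 0" by (auto simp: fun_eq_iff)
  then have "\<forall>y\<in>Y. bilin c y \<noteq> 0" using p(2) by simp
  then show ?thesis by (rule exI)
qed

lemma exists_hyperplane_avoiding_lines:
  fixes S :: "(complex^'n) set"
  assumes "finite {proj_point x | x. x \<noteq> 0 \<and> x \<in> S}"
  obtains c where "\<And>x. x \<in> S \<Longrightarrow> bilin c x = 0 \<Longrightarrow> x = 0"
proof -
  let ?L = "{proj_point x | x. x \<noteq> 0 \<and> x \<in> S}"
  have "\<forall>l\<in>?L. \<exists>x. x \<noteq> 0 \<and> l = proj_point x" by blast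
  from bchoice[OF this] obtain r where r: "\<forall>l\<in>?L. r l \<noteq> 0 \<and> l = proj_point (r l)" ..
  have "\<exists>c. \<forall>y\<in>r ` ?L. bilin c y \<noteq> 0"
  proof (rule exists_generic_linear_form)
    show "finite (r ` ?L)" using assms by (rule finite_imageI)
    show "0 \<notin> r ` ?L"
    proof
      assume "0 \<in> r ` ?L"
      then obtain l where "l \<in> ?L" "0 = r l" by (rule imageE) simp
      then show False using bspec[OF r, of l] by simp
    qed
  qed
  then obtain c where c: "\<forall>y\<in>r ` ?L. bilin c y \<noteq> 0" ..
  show ?thesis
  proof (rule that[of c], rule ccontr)
    fix x assume x: "x \<in> S" "bilin c x = 0" "x \<noteq> 0"
    then have l: "proj_point x \<in> ?L" by blast
    have "r (proj_point x) \<in> proj_point (r (proj_point x))"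
      unfolding proj_point_def by (rule range_eqI[of _ _ 1]) simp
    then have "r (proj_point x) \<in> proj_point x"
      by (simp only: conjunct2[OF bspec[OF r l], symmetric])
    then obtain t where "r (proj_point x) = t *s x" by (auto simp: proj_point_def)
    then have "bilin c (r (proj_point x)) = 0"
      using x(2) bilin_scale[of t x c] by (simp add: bilin_commute)
    then show False using bspec[OF c imageI[OF l]] by simp
  qed
qed

section \<open>Generic finiteness\<close>

lemma norm_vec_scale: "norm (c *s (x :: complex^'n)) = norm c * norm x"
  by (simp add: norm_vec_def norm_mult L2_set_right_distrib)

lemma continuous_polys_in: "f \<in> polys_in UNIV \<Longrightarrow> continuous_on A f"
proof (induction rule: polys_in_induct)
  case (add f g)
  then show ?case by (simp add: plus_fun_def continuous_on_add)
next
  case (mult f g)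
  then show ?case by (simp add: times_fun_def continuous_on_mult)
qed (auto intro: continuous_intros)

text \<open>On the unit vectors of the cone the linear form has a positive minimum modulus by
  compactness; a point of the slice, scaled to unit length, has value of modulus
  \<open>1 / norm z\<close>, so its norm is bounded by the inverse of this minimum.\<close>

lemma bounded_affine_slice:
  fixes u c :: "complex^'n"
  assumes F: "F \<subseteq> fst_homogeneous"
    and triv: "\<And>x. \<forall>f\<in>F. f (x, u) = 0 \<Longrightarrow> bilin c x = 0 \<Longrightarrow> x = 0"
  shows "bounded {z. bilin c z = 1 \<and> (\<forall>f\<in>F. f (z, u) = 0)}"
proof -
  let ?K = "sphere 0 1 \<inter> {x. \<forall>f\<in>F. f (x, u) = 0}"
  have "closed {x. \<forall>f\<in>F. f (x, u) = 0}"
  proof -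
    have "closed {x. f (x, u) = 0}" if "f \<in> F" for f
    proof -
      have "(\<lambda>x. f (x, u)) \<in> polys_in UNIV"
        using F that by (intro poly_functions2_slice) (auto simp: fst_homogeneous_def)
      then have "continuous_on UNIV (\<lambda>x. f (x, u))" by (rule continuous_polys_in)
      then show ?thesis by (intro closed_Collect_eq continuous_on_const)
    qed
    then have "closed (\<Inter>f\<in>F. {x. f (x, u) = 0})" by (intro closed_INT ballI)
    moreover have "(\<Inter>f\<in>F. {x. f (x, u) = 0}) = {x. \<forall>f\<in>F. f (x, u) = 0}" by blast
    ultimately show ?thesis by simp
  qed
  then have K: "compact ?K" by (intro compact_Int_closed compact_sphere)
  have cont: "continuous_on ?K (\<lambda>x. norm (bilin c x))"
  proof (intro continuous_on_norm)
    have "(\<lambda>x. bilin x c) \<in> polys_in UNIV" by (rule bilin_poly)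
    then show "continuous_on ?K (bilin c)"
      using continuous_polys_in[of "\<lambda>x. bilin x c"] by (simp add: bilin_commute[of c])
  qed
  have scaled: "complex_of_real (1 / norm z) *s z \<in> ?K" "z \<noteq> 0"
    if z: "bilin c z = 1" "\<forall>f\<in>F. f (z, u) = 0" for z
  proof -
    show z0: "z \<noteq> 0" using z(1) by (auto simp: bilin_sum)
    have "norm (complex_of_real (1 / norm z) *s z) = 1" using z0 by (simp add: norm_vec_scale norm_divide)
    moreover have "f (complex_of_real (1 / norm z) *s z, u) = 0" if "f \<in> F" for f
    proof -
      have "f \<in> fst_homogeneous" using F that by blast
      then obtain k where "\<forall>t x u. f (t *s x, u) = t ^ k * f (x, u)"
        unfolding fst_homogeneous_def by blast
      then show ?thesis using z(2) that by simp
    qed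
    ultimately show "complex_of_real (1 / norm z) *s z \<in> ?K" by simp
  qed
  show ?thesis
  proof (cases "?K = {}")
    case True
    then have "{z. bilin c z = 1 \<and> (\<forall>f\<in>F. f (z, u) = 0)} = {}" using scaled by blast
    then show ?thesis by (simp only: bounded_empty)
  next
    case False
    obtain w where w: "w \<in> ?K" "\<forall>y\<in>?K. norm (bilin c w) \<le> norm (bilin c y)"
      using continuous_attains_inf[OF K False cont] by blast
    have "w \<noteq> 0" using w(1) by auto
    then have "bilin c w \<noteq> 0" using triv[of w] w(1) by auto
    then have pos: "norm (bilin c w) > 0" by simp
    show ?thesis
      unfolding bounded_iff
    proof (intro exI[of _ "1 / norm (bilin c w)"] ballI)
      fix z assume "z \<in> {z. bilin c z = 1 \<and> (\<forall>f\<in>F. f (z, u) = 0)}"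
      then have z: "bilin c z = 1" "\<forall>f\<in>F. f (z, u) = 0" by auto
      have "norm (bilin c w) \<le> norm (bilin c (complex_of_real (1 / norm z) *s z))"
        using w(2) scaled(1)[OF z] by blast
      also have "\<dots> = 1 / norm z"
        using bilin_scale[of "complex_of_real (1 / norm z)" z c] z(1)
        by (simp add: bilin_commute[of c] norm_divide)
      finally show "norm z \<le> 1 / norm (bilin c w)"
        using pos scaled(2)[OF z] by (simp add: field_simps)
    qed
  qed
qed

section \<open>The data locus as closure of the projection, and finiteness over general data
  points\<close>

lemma vanishing_ideal_closure: "vanishing_ideal (zariski closure_of W) = vanishing_ideal W"
proof
  have "W \<subseteq> zariski closure_of W" by (rule closure_of_subset) simp
  then show "vanishing_ideal (zariski closure_of W) \<subseteq> vanishing_ideal W"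
    by (rule vanishing_ideal_antimono)
  show "vanishing_ideal W \<subseteq> vanishing_ideal (zariski closure_of W)"
  proof
    fix f assume f: "f \<in> vanishing_ideal W"
    then have "closedin zariski {x. f x = 0}" "W \<subseteq> {x. f x = 0}"
      by (auto simp: vanishing_ideal_def intro: closedin_zariski_zero)
    then have "zariski closure_of W \<subseteq> {x. f x = 0}" by (intro closure_of_minimal)
    then show "f \<in> vanishing_ideal (zariski closure_of W)"
      using f by (auto simp: vanishing_ideal_def)
  qed
qed

context ED_pair
begin

lemma ED_points_in_corr:
  assumes "x \<in> smooth_points X" "x \<in> Y" "u - x \<in> normal_space X x"
  shows "(x, u) \<in> ED_corr X Y"
proof -
  let ?S = "{(x, u). x \<in> smooth_points X \<inter> Y \<and> u - x \<in> normal_space X x}"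
  have "?S \<subseteq> zariski2 closure_of ?S" by (rule closure_of_subset) simp
  moreover have "(x, u) \<in> ?S" using assms by simp
  ultimately show ?thesis unfolding ED_corr_def by blast
qed

text \<open>Neither of the two closures changes which polynomials vanish, so the ideal is the
  contraction of \<open>P\<^sub>E\<close> along the projection to u.\<close>

lemma vanishing_ideal_data_locus:
  "f \<in> vanishing_ideal (ED_data_locus X Z) \<longleftrightarrow>
    f \<in> polys_in UNIV \<and> (\<lambda>p. f (proj_coords Inr p)) \<in> P\<^sub>E"
proof -
  have "f \<in> vanishing_ideal (snd ` ED_corr X Z) \<longleftrightarrow> (\<lambda>p. f (proj_coords Inr p)) \<in> P\<^sub>E"
    if f: "f \<in> polys_in UNIV"
  proof
    assume "f \<in> vanishing_ideal (snd ` ED_corr X Z)"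
    then have "f u = 0" if "(x, u) \<in> ED_corr X Z" for x u
      using that by (force simp: vanishing_ideal_alt)
    moreover have "(\<lambda>p. f (proj_coords Inr p)) \<in> polys_in UNIV"
      by (rule subsetD[OF E.polys_in_sub polys_in_proj_coords[OF f]])
    ultimately show "(\<lambda>p. f (proj_coords Inr p)) \<in> P\<^sub>E"
      using ED_points_in_corr[of _ Z] by (simp add: vanishing_ideal_ED_points) blast
  next
    assume f0: "(\<lambda>p. f (proj_coords Inr p)) \<in> P\<^sub>E"
    have "closedin zariski2 {p. f (snd p) = 0}"
      by (rule closedin_zariski_zero[OF poly_functions2_snd[OF f]])
    moreover have "{(x, u). x \<in> smooth_points X \<inter> Z \<and> u - x \<in> normal_space X x} \<subseteq> {p. f (snd p) = 0}"
      using f0 by (auto simp: vanishing_ideal_ED_points)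
    ultimately have "ED_corr X Z \<subseteq> {p. f (snd p) = 0}"
      unfolding ED_corr_def by (intro closure_of_minimal)
    then show "f \<in> vanishing_ideal (snd ` ED_corr X Z)" using f by (auto simp: vanishing_ideal_alt)
  qed
  then show ?thesis
    unfolding ED_data_locus_def vanishing_ideal_closure by (auto simp: vanishing_ideal_alt)
qed

lemma prime_data_locus: "polynomial_prime (vanishing_ideal (ED_data_locus X Z))"
proof -
  have pull: "(\<lambda>p. f (proj_coords Inr p)) \<in> polys_in UNIV" if "f \<in> polys_in UNIV"
    for f :: "complex^'n \<Rightarrow> complex"
    by (rule subsetD[OF E.polys_in_sub polys_in_proj_coords[OF that]])
  have "prime_ideal_in (polys_in UNIV) {f \<in> polys_in UNIV. \<forall>x\<in>ED_data_locus X Z. f x = 0}"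
  proof (rule prime_ideal_of_functions[OF subring_polys_in])
    obtain x where "x \<in> smooth_points X" "x \<in> Z" using exists_smooth by blast
    then have "(x, x) \<in> ED_corr X Z"
      using vec.subspace_0[OF subspace_normal_space[of X x]] by (intro ED_points_in_corr) simp_all
    then have "x \<in> snd ` ED_corr X Z" by (rule rev_image_eqI) simp
    moreover have "snd ` ED_corr X Z \<subseteq> ED_data_locus X Z"
      unfolding ED_data_locus_def by (rule closure_of_subset) simp
    ultimately show "\<exists>x. x \<in> ED_data_locus X Z" by blast
  next
    fix f g :: "complex^'n \<Rightarrow> complex"
    assume f: "f \<in> polys_in UNIV" and g: "g \<in> polys_in UNIV"
      and fg: "\<And>x. x \<in> ED_data_locus X Z \<Longrightarrow> f x * g x = 0"
    have "f * g \<in> vanishing_ideal (ED_data_locus X Z)"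
      using fg polys_in_mult[OF f g] by (auto simp: vanishing_ideal_alt)
    then have "(\<lambda>p. f (proj_coords Inr p)) * (\<lambda>p. g (proj_coords Inr p)) \<in> P\<^sub>E"
      by (simp add: vanishing_ideal_data_locus times_fun_def)
    then have "(\<lambda>p. f (proj_coords Inr p)) \<in> P\<^sub>E \<or> (\<lambda>p. g (proj_coords Inr p)) \<in> P\<^sub>E"
      by (rule E.P_prime[OF pull[OF f] pull[OF g]])
    then have "f \<in> vanishing_ideal (ED_data_locus X Z) \<or> g \<in> vanishing_ideal (ED_data_locus X Z)"
      using f g by (auto simp: vanishing_ideal_data_locus)
    then show "(\<forall>x\<in>ED_data_locus X Z. f x = 0) \<or> (\<forall>x\<in>ED_data_locus X Z. g x = 0)"
      by (auto simp: vanishing_ideal_alt)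
  qed
  then show ?thesis by (simp add: polynomial_prime_def vanishing_ideal_alt)
qed

text \<open>If the fibres over general data points were infinite, then for a general \<open>u\<close> the points
  \<open>x / l(x)\<close> would form an infinite algebraic set. It is bounded: by elimination the hyperplane
  \<open>l = 0\<close>, which misses the finite fibre over \<open>u0\<close>, still misses the fibre over \<open>u\<close>.\<close>

lemma algebraic_over_data:
  assumes cone: "\<And>x c. x \<in> X \<Longrightarrow> c *s x \<in> X"
    and nonisotropic: "\<not> Z \<subseteq> singular_points X \<union> isotropic_quadric"
    and u0: "u0 \<in> ED_data_locus X Z" "u0 \<notin> positive_dim_fibres X"
  shows "E.alg (range Inr) (Inl j)"
proof (rule ccontr)
  assume na: "\<not> E.alg (range Inr) (Inl j)"
  let ?l = "proj_coords Inl :: complex^('n + 'n) \<Rightarrow> complex^'n"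
  let ?r = "proj_coords Inr :: complex^('n + 'n) \<Rightarrow> complex^'n"
  let ?J = "correspondence_equations (ED_corr X X)"
  have J: "?J \<subseteq> fst_homogeneous" unfolding correspondence_equations_def by blast
  have comp: "(\<lambda>p. ?l p $ i) \<in> poly_functions coords" "(\<lambda>p. ?r p $ i) \<in> poly_functions coords" for i
    using polys_in_coord_UNIV[of "Inl i :: 'n + 'n"] polys_in_coord_UNIV[of "Inr i :: 'n + 'n"]
    by (simp_all add: polys_in_UNIV)
  define q where "q = (\<lambda>p. bilin (?l p) (?l p))"
  have q: "q \<in> polys_in UNIV"
    unfolding q_def bilin_sum polys_in_UNIV by (intro polys_in_sum_fun poly_functions.mult comp)
  obtain x0 where x0: "x0 \<in> Z" "x0 \<notin> singular_points X" "x0 \<notin> isotropic_quadric"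
    using nonisotropic by blast
  then have "x0 \<in> smooth_points X" using ZX by (auto simp: singular_points_def)
  then have "join x0 x0 \<in> ED_points X Z" using x0(1) by (rule ED_points_diagonal)
  moreover have "q (join x0 x0) \<noteq> 0" using x0(3) by (simp add: q_def isotropic_quadric_def)
  ultimately have qn: "q \<notin> P\<^sub>E" using not_in_vanishing_ideal[OF q] by blast
  \<comment> \<open>The zero of \<open>P\<^sub>E\<close> found later need not lie over a smooth
    point, so every property needed there is recorded as membership in \<open>P\<^sub>E\<close>.
    Multiplication by \<open>q\<close> handles x = 0, where the equations are not known to
    hold.\<close>
  have eqJ: "(\<lambda>p. f (?l p, ?r p)) \<in> P\<^sub>E" if f: "f \<in> ?J" for f
  proof -
    have fp: "f \<in> poly_functions coords2" using f J by (auto simp: fst_homogeneous_def)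
    have fR: "(\<lambda>p. f (?l p, ?r p)) \<in> polys_in UNIV"
      using fp unfolding polys_in_UNIV
    proof (induction rule: poly_functions.induct)
      case (coord f)
      then show ?case using comp by (auto simp: coords2_def)
    qed (auto intro: poly_functions.intros)
    have "f (x, u) = 0" if "x \<in> smooth_points X" "x \<in> Z" "u - x \<in> normal_space X x" "bilin x x \<noteq> 0" for x u
    proof -
      have "(x, u) \<in> ED_corr X X" using that smooth_in_X by (intro ED_points_in_corr) auto
      moreover have "x \<noteq> 0" using that(4) by (auto simp: bilin_sum)
      ultimately show ?thesis using f unfolding correspondence_equations_def by blast
    qed
    then have "q * (\<lambda>p. f (?l p, ?r p)) \<in> P\<^sub>E"
      using polys_in_mult[OF q fR] by (auto simp: vanishing_ideal_ED_points q_def)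
    then show ?thesis using E.P_prime[OF q fR] qn by blast
  qed
  \<comment> \<open>Since \<open>X\<close> is a cone, x is tangent to \<open>X\<close> at x, so the
    normal vector \<open>u - x\<close> is orthogonal to it.\<close>
  define e where "e = (\<lambda>p. bilin (?r p - ?l p) (?l p))"
  have "e \<in> polys_in UNIV"
    unfolding e_def bilin_sum vector_minus_component polys_in_UNIV
    by (intro polys_in_sum_fun poly_functions.mult poly_functions_minus comp)
  moreover have "bilin (u - x) x = 0" if "x \<in> smooth_points X" "u - x \<in> normal_space X x" for x u
  proof -
    have "x \<in> tangent_at (vanishing_ideal X) x"
      unfolding tangent_at_def
    proof (intro CollectI ballI)
      fix f assume f: "f \<in> vanishing_ideal X"
      have "x + t *s x = (1 + t) *s x" for t by (simp add: vec_eq_iff algebra_simps)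
      moreover have "x \<in> X" using that(1) smooth_in_X by blast
      ultimately have "x + t *s x \<in> X" for t using cone by metis
      then have "(\<lambda>t. f (x + t *s x)) = (\<lambda>_. 0)" using f by (auto simp: vanishing_ideal_alt)
      then show "dir_deriv x x f = 0" by (simp add: dir_deriv_def)
    qed
    then show ?thesis using that(2) by (simp add: normal_space_def tangent_space_eq)
  qed
  ultimately have e: "e \<in> P\<^sub>E" by (simp add: vanishing_ideal_ED_points e_def)
  have "finite {proj_point x | x. x \<noteq> 0 \<and> x \<in> {x. \<forall>f\<in>?J. f (x, u0) = 0}}"
    using finite_fibre[OF u0(2)] by simp
  then obtain c where c: "\<And>x. x \<in> {x. \<forall>f\<in>?J. f (x, u0) = 0} \<Longrightarrow> bilin c x = 0 \<Longrightarrow> x = 0"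
    by (rule exists_hyperplane_avoiding_lines) blast
  \<comment> \<open>The hyperplane misses the fibre over \<open>u0\<close>; with its equation added,
    only x = 0 remains there, which is the hypothesis of \<open>elimination\<close>.\<close>
  let ?H = "\<lambda>p. bilin c (fst p)"
  have "?H \<in> poly_functions coords2"
    unfolding bilin_sum by (intro polys_in_sum_fun poly_functions.mult poly_functions.const poly_functions2_coord)
  moreover have "\<forall>t x u. ?H (t *s x, u) = t ^ 1 * ?H (x, u)"
    using bilin_scale[of _ _ c] by (simp add: bilin_commute[of c])
  ultimately have "?H \<in> fst_homogeneous" unfolding fst_homogeneous_def by blast
  then have F: "insert ?H ?J \<subseteq> fst_homogeneous" using J by blast
  have triv: "x = 0" if "\<forall>f\<in>insert ?H ?J. f (x, u0) = 0" for x using c[of x] that by simp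
  obtain g where g: "g \<in> polys_in UNIV" "g u0 \<noteq> 0"
    and elim: "\<And>u x. g u \<noteq> 0 \<Longrightarrow> \<forall>f\<in>insert ?H ?J. f (x, u) = 0 \<Longrightarrow> x = 0"
    by (rule elimination[OF F triv], assumption, rule that) blast+
  have "g \<notin> vanishing_ideal (ED_data_locus X Z)" using u0(1) g by (auto simp: vanishing_ideal_alt)
  then have gn: "(\<lambda>p. g (?r p)) \<notin> P\<^sub>E" using g(1) by (simp add: vanishing_ideal_data_locus)
  have gR: "(\<lambda>p. g (?r p)) \<in> polys_in UNIV"
    by (rule subsetD[OF E.polys_in_sub polys_in_proj_coords[OF g(1)]])
  have nr: "Inl j \<notin> range Inr" by auto
  \<comment> \<open>Coordinate \<open>Inl j\<close> was assumed transcendental over u, so over a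
    general u it can be made arbitrarily large at zeros with nonisotropic x.\<close>
  obtain h where h: "h \<in> polys_in (range Inr)" "h \<notin> P\<^sub>E"
    and ext: "\<And>p M. p \<in> E.zeros_on (range Inr) \<Longrightarrow> h p \<noteq> 0 \<Longrightarrow>
      \<exists>p'\<in>E.zeros_on UNIV. (\<forall>k\<in>range Inr. p' $ k = p $ k) \<and> q p' \<noteq> 0 \<and> norm (p' $ Inl j) > M"
    by (rule E.unbounded_extension[OF na nr q qn], rule that) blast+
  have hR: "h \<in> polys_in UNIV" using h(1) E.polys_in_sub by blast
  have "(\<lambda>p. g (?r p)) * h \<notin> P\<^sub>E" using E.P_prime[OF gR hR] gn h(2) by blast
  then obtain p0 where p0: "p0 \<in> E.zeros_on UNIV" "((\<lambda>p. g (?r p)) * h) p0 \<noteq> 0"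
    using E.nullstellensatz polys_in_mult[OF gR hR] by blast
  define u where "u = ?r p0"
  have gu: "g u \<noteq> 0" and hp0: "h p0 \<noteq> 0" using p0(2) by (auto simp: u_def)
  have p0r: "p0 \<in> E.zeros_on (range Inr)" using p0(1) E.zeros_on_mono[of "range Inr" UNIV] by blast
  let ?Y = "{z. bilin c z = 1 \<and> (\<forall>f\<in>?J. f (z, u) = 0)}"
  have "bounded ?Y"
  proof (rule bounded_affine_slice[OF J])
    fix x assume "\<forall>f\<in>?J. f (x, u) = 0" "bilin c x = 0"
    then have "\<forall>f\<in>insert ?H ?J. f (x, u) = 0" by simp
    then show "x = 0" by (rule elim[OF gu])
  qed
  moreover have "closedin zariski ?Y"
  proof -
    let ?G = "insert (\<lambda>z. bilin c z - 1) ((\<lambda>f z. f (z, u)) ` ?J)"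
    have "(\<lambda>z. bilin c z - 1) \<in> polys_in UNIV"
      using bilin_poly[of c] poly_functions_minus[OF _ poly_functions.const[of 1]]
      by (simp add: bilin_commute[of c] polys_in_UNIV)
    moreover have "(\<lambda>z. f (z, u)) \<in> polys_in UNIV" if "f \<in> ?J" for f
      using that J by (intro poly_functions2_slice) (auto simp: fst_homogeneous_def)
    ultimately have "?G \<subseteq> poly_functions coords" by (auto simp: polys_in_UNIV)
    moreover have "?Y = {z. \<forall>f\<in>?G. f z = 0}" by auto
    ultimately show ?thesis unfolding closedin_zariski_topology by blast
  qed
  ultimately have finY: "finite ?Y" by (intro bounded_closed_finite)
  \<comment> \<open>Recovers \<open>x $ j\<close> from the point y of the slice on the line of x:
    orthogonality gives \<open>bilin u x = bilin x x\<close>, so x is y times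
    \<open>bilin u y / bilin y y\<close>. Finiteness of the slice therefore bounds
    \<open>x $ j\<close>.\<close>
  define \<phi> where "\<phi> = (\<lambda>z. bilin u z / bilin z z * z $ j)"
  obtain M where M: "\<And>z. z \<in> ?Y \<Longrightarrow> norm (\<phi> z) \<le> M"
    using finite_imp_bounded[OF finite_imageI[OF finY, of \<phi>]] unfolding bounded_iff by blast
  obtain p where p: "p \<in> E.zeros_on UNIV" "\<forall>k\<in>range Inr. p $ k = p0 $ k" "q p \<noteq> 0" "norm (p $ Inl j) > M"
    using ext[OF p0r hp0, of M] by blast
  have z: "f p = 0" if "f \<in> P\<^sub>E" for f using p(1) that by (simp add: E.zeros_on_UNIV)
  define x where "x = ?l p"
  have ru: "?r p = u" using p(2) by (simp add: u_def vec_eq_iff)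
  have Jx: "\<forall>f\<in>?J. f (x, u) = 0"
  proof
    fix f assume "f \<in> ?J"
    from z[OF eqJ[OF this]] show "f (x, u) = 0" by (simp add: x_def ru)
  qed
  have qx: "bilin x x \<noteq> 0" using p(3) by (simp add: q_def x_def)
  have "bilin (u - x) x = 0" using z[OF e] by (simp add: e_def x_def ru)
  then have ux: "bilin u x = bilin x x" by (simp add: bilin_diff)
  have cx: "bilin c x \<noteq> 0"
  proof
    assume "bilin c x = 0"
    then have "\<forall>f\<in>insert ?H ?J. f (x, u) = 0" using Jx by simp
    then have "x = 0" by (rule elim[OF gu])
    then show False using qx by (simp add: bilin_sum)
  qed
  define y where "y = (1 / bilin c x) *s x"
  have bily: "bilin a y = bilin a x / bilin c x" for a
    using bilin_scale[of "1 / bilin c x" x a] by (simp add: y_def bilin_commute[of a])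
  have "y \<in> ?Y"
  proof (intro CollectI conjI ballI)
    show "bilin c y = 1" using cx by (simp add: bily)
    fix f assume f: "f \<in> ?J"
    then have "f \<in> fst_homogeneous" using J by blast
    then obtain k where "\<forall>t x u. f (t *s x, u) = t ^ k * f (x, u)"
      unfolding fst_homogeneous_def by blast
    then show "f (y, u) = 0" using Jx f by (simp add: y_def)
  qed
  then have "norm (\<phi> y) \<le> M" by (rule M)
  moreover have "bilin y y = bilin x x / (bilin c x * bilin c x)"
    using bily[of y] bily[of x] by (simp add: bilin_commute[of y x])
  then have "\<phi> y = x $ j"
    using cx qx ux by (simp add: \<phi>_def bily) (simp add: y_def)
  ultimately show False using p(4) by (simp add: x_def)
qed

end

theorem proposition6p4:
  fixes X Z :: "(complex^'n) set" and N n d :: nat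
  assumes "CARD('n) = N + 1"
    and "affine_cone X" and "irreducible_in zariski X"
    and "affine_cone Z" and "irreducible_in zariski Z"
    and "Z \<subseteq> X"
    and "krull_dim zariski X = enat (n + 1)"
    and "krull_dim zariski Z = enat (d + 1)"
    and "ED_regular_given X Z"
  shows "irreducible_in zariski (ED_data_locus X Z) \<and>
    krull_dim zariski (ED_data_locus X Z) = enat (N + 1 - n + d)"
proof -
  have Xc: "closedin zariski X" and cone: "\<And>x c. x \<in> X \<Longrightarrow> c *s x \<in> X" and Zc: "closedin zariski Z"
    using assms(2,4) by (auto simp: affine_cone_def)
  have reg: "\<not> Z \<subseteq> singular_points X \<union> isotropic_quadric"
    using assms(9) by (simp add: ED_regular_given_def)
  interpret ED_pair X Z
    by standard (use assms Xc Zc reg in auto)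
  obtain u0 where u0: "u0 \<in> ED_data_locus X Z" "u0 \<notin> positive_dim_fibres X"
    using assms(9) by (auto simp: ED_regular_given_def)
  let ?D = "ED_data_locus X Z"
  interpret D: polynomial_prime "vanishing_ideal ?D" by (rule prime_data_locus)
  have irr: "irreducible_in zariski ?D"
    by (rule prime_irreducible[OF prime_data_locus refl])
  have closed: "closedin zariski ?D" unfolding ED_data_locus_def by (rule closedin_closure_of)
  obtain B where B: "D.tower UNIV B" using D.exists_tower by blast
  have pull: "f \<in> vanishing_ideal ?D \<longleftrightarrow> (\<lambda>p. f (proj_coords Inr p)) \<in> P\<^sub>E" if "f \<in> polys_in UNIV" for f
    using that by (simp add: vanishing_ideal_data_locus)
  \<comment> \<open>The second order of the coordinates, u before x; all coordinates of x are
    algebraic over those of u, so the basis stays that of the data locus.\<close>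
  have "E.tower (range Inr) (Inr ` B)"
    by (rule tower_proj_coords[OF prime_data_locus prime_ED inj_Inr pull B])
  moreover have "E.alg (range Inr) k" if k: "k \<notin> range Inr" for k :: "'n + 'n"
  proof -
    obtain j where "k = Inl j" using k by (cases k) auto
    then show ?thesis using algebraic_over_data[OF cone reg u0] by simp
  qed
  ultimately have "E.tower UNIV (Inr ` B)" using E.tower_extend by blast
  then have "E.trdeg = card (Inr ` B :: ('n + 'n) set)" by (rule E.tower_card[symmetric])
  also have "\<dots> = zariski_dim ?D"
    unfolding zariski_dim_def D.tower_card[OF B, symmetric] by (simp add: card_image)
  finally have dim: "zariski_dim ?D + zariski_dim X = zariski_dim Z + CARD('n)" using trdeg_ED by simp
  have dX: "zariski_dim X = n + 1" and dZ: "zariski_dim Z = d + 1"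
    using krull_dim_eq[OF X] krull_dim_eq[OF Z] assms(7,8) by simp_all
  \<comment> \<open>The bound \<open>n \<le> N\<close> follows from dim \<open>X\<close> being at
    most the number of coordinates; without it the truncated subtraction in the goal would not match
    the additive formula.\<close>
  interpret PX: polynomial_prime "vanishing_ideal X" by (rule irreducible_prime[OF assms(3)])
  obtain T :: "'n set" where "card T = PX.trdeg"
    by (rule PX.exists_transcendence_basis)
  then have "zariski_dim X \<le> CARD('n)"
    using card_mono[OF finite subset_UNIV[of T]] by (simp add: zariski_dim_def)
  then have "zariski_dim ?D = N + 1 - n + d" using dim dX dZ assms(1) by simp
  then show ?thesis using irr krull_dim_eq[OF irr closed] by simp
qed

end
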